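(* Let $k$ be a field, $n\ge 2$, and let $\Lambda$ be the exterior algebra over $k$ on generators $x_1,\dots,x_n$. Let $(P_\bullet,\delta_\bullet)$ be the sequence of $\Lambda$-bimodules $P_m$ ($m\ge 0$) and bimodule homomorphisms $\delta_m:P_m\to P_{m-1}$ ($m\ge 1$) defined in the context. Then $$\cdots\to P_{m+1}\xrightarrow{\delta_{m+1}}P_m\xrightarrow{\delta_m}\cdots\xrightarrow{\delta_3}P_2\xrightarrow{\delta_2}P_1\xrightarrow{\delta_1}P_0\to 0$$ is a minimal projective bimodule resolution of $\Lambda$ (with augmentation $P_0=\Lambda\otimes_k\Lambda\to\Lambda$ given by multiplication).
   Context: The exterior algebra is the (ungraded) $k$-algebra $\Lambda=k\langle x_1,\dots,x_n\rangle/I$, where $k\langle x_1,\dots,x_n\rangle$ is the free associative algebra and $I$ is the two-sided ideal generated by $x_i^2$ ($1\le i\le n$) and $x_ix_j+x_jx_i$ ($1\le i<j\le n$). Write $\otimes=\otimes_k$, and let $k\langle x_1,\dots,x_n\rangle_m$ be the span of the monomials of degree $m$. For $m\ge 0$ and $(i_1,\dots,i_n)\in\mathbb{N}^n$ with $i_1+\cdots+i_n=m$ define $f^m_{1^{i_1}\cdots n^{i_n}}\in k\langle x_1,\dots,x_n\rangle_m$ by: $f^0_0=1$; $f^1_h=x_h$ for $1\le h\le n$ (the index with $i_h=1$ and all other exponents $0$); and for $m\ge2$, inductively, $f^m_{1^{i_1}\cdots n^{i_n}}=\sum_{h=1}^n f^{m-1}_{1^{i_1}\cdots h^{i_h-1}\cdots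 n^{i_n}}\,x_h$, where a symbol with a negative exponent is $0$. Put $P_m=\bigoplus_{i_1+\cdots+i_n=m}\Lambda\otimes f^m_{1^{i_1}\cdots n^{i_n}}\otimes\Lambda\subseteq\Lambda\otimes k\langle x_1,\dots,x_n\rangle_m\otimes\Lambda$, with $P_0$ identified with $\Lambda\otimes\Lambda$. Put $\widetilde f^m_{1^{i_1}\cdots n^{i_n}}=1\otimes f^m_{1^{i_1}\cdots n^{i_n}}\otimes 1$ for $m\ge 1$ and $\widetilde f^0_0=1\otimes1$. The bimodule homomorphism $\delta_m:P_m\to P_{m-1}$ is determined by $$\delta_m(\widetilde f^m_{1^{i_1}\cdots n^{i_n}})=\sum_{h=1}^n\left(x_h\widetilde f^{m-1}_{1^{i_1}\cdots h^{i_h-1}\cdots n^{i_n}}+(-1)^m\widetilde f^{m-1}_{1^{i_1}\cdots h^{i_h-1}\cdots n^{i_n}}x_h\right),$$ where terms with a negative exponent are $0$. "Projective bimodule resolution" means projective resolution of $\Lambda$ as a module over $\Lambda^e=\Lambda\otimes\Lambda^{op}$; minimal means the image of each $\delta_m$ lies in the radical of $P_{m-1}$. *)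

theory Defs
  imports "HOL-Algebra.Module" "HOL-Algebra.QuotRing"
begin

section \<open>Modules over a ring that need not be commutative\<close>

text \<open>The locale \<^locale>\<open>module\<close> requires a commutative ring of scalars. The record type of
  modules and the locale \<^locale>\<open>submodule\<close> do not, and are reused here.\<close>

locale left_module = R?: ring R + M?: abelian_group M
  for R :: "('r, 'e) ring_scheme" (structure) and M :: "('r, 'a, 'm) module_scheme" (structure) +
  assumes smult_closed:
      "\<lbrakk>a \<in> carrier R; x \<in> carrier M\<rbrakk> \<Longrightarrow> a \<odot>\<^bsub>M\<^esub> x \<in> carrier M"
    and smult_l_distr:
      "\<lbrakk>a \<in> carrier R; b \<in> carrier R; x \<in> carrier M\<rbrakk> \<Longrightarrow>
        (a \<oplus>\<^bsub>R\<^esub> b) \<odot>\<^bsub>M\<^esub> x = a \<odot>\<^bsub>M\<^esub> x \<oplus>\<^bsub>M\<^esub> b \<odot>\<^bsub>M\<^esub> x"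
    and smult_r_distr:
      "\<lbrakk>a \<in> carrier R; x \<in> carrier M; y \<in> carrier M\<rbrakk> \<Longrightarrow>
        a \<odot>\<^bsub>M\<^esub> (x \<oplus>\<^bsub>M\<^esub> y) = a \<odot>\<^bsub>M\<^esub> x \<oplus>\<^bsub>M\<^esub> a \<odot>\<^bsub>M\<^esub> y"
    and smult_assoc1:
      "\<lbrakk>a \<in> carrier R; b \<in> carrier R; x \<in> carrier M\<rbrakk> \<Longrightarrow>
        (a \<otimes>\<^bsub>R\<^esub> b) \<odot>\<^bsub>M\<^esub> x = a \<odot>\<^bsub>M\<^esub> (b \<odot>\<^bsub>M\<^esub> x)"
    and smult_one: "x \<in> carrier M \<Longrightarrow> \<one>\<^bsub>R\<^esub> \<odot>\<^bsub>M\<^esub> x = x"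

definition left_module_hom ::
  "('r, 'e) ring_scheme \<Rightarrow> ('r, 'a, 'm) module_scheme \<Rightarrow> ('r, 'b, 'n) module_scheme \<Rightarrow> ('a \<Rightarrow> 'b) set"
  where "left_module_hom R M N =
    {f \<in> carrier M \<rightarrow> carrier N.
      (\<forall>x\<in>carrier M. \<forall>y\<in>carrier M. f (x \<oplus>\<^bsub>M\<^esub> y) = f x \<oplus>\<^bsub>N\<^esub> f y) \<and>
      (\<forall>a\<in>carrier R. \<forall>x\<in>carrier M. f (a \<odot>\<^bsub>M\<^esub> x) = a \<odot>\<^bsub>N\<^esub> f x)}"

text \<open>A definition cannot quantify over types, so the lifting property is tested on epimorphisms
  \<open>M \<rightarrow> N\<close> whose elements have the types given by the two type arguments; with type variables
  there, it is the lifting property against all epimorphisms.\<close>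

definition projective_module ::
  "'c itself \<Rightarrow> 'd itself \<Rightarrow> ('r, 'e) ring_scheme \<Rightarrow> ('r, 'a, 'm) module_scheme \<Rightarrow> bool"
  where "projective_module tc td R P \<longleftrightarrow>
    left_module R P \<and>
    (\<forall>(M :: ('r, 'c) module) (N :: ('r, 'd) module) g f.
      left_module R M \<and> left_module R N \<and>
      g \<in> left_module_hom R M N \<and> g ` carrier M = carrier N \<and>
      f \<in> left_module_hom R P N \<longrightarrow>
      (\<exists>h \<in> left_module_hom R P M. \<forall>x \<in> carrier P. g (h x) = f x))"

definition maximal_submodule ::
  "'a set \<Rightarrow> ('r, 'e) ring_scheme \<Rightarrow> ('r, 'a, 'm) module_scheme \<Rightarrow> bool"
  where "maximal_submodule H R M \<longleftrightarrow>
    submodule H R M \<and> H \<noteq> carrier M \<and>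
    (\<forall>L. submodule L R M \<and> H \<subseteq> L \<longrightarrow> L = H \<or> L = carrier M)"

definition module_radical ::
  "('r, 'e) ring_scheme \<Rightarrow> ('r, 'a, 'm) module_scheme \<Rightarrow> 'a set"
  where "module_radical R M = carrier M \<inter> \<Inter>{H. maximal_submodule H R M}"

text \<open>In the following definitions the differential \<open>d m\<close> goes from \<open>P m\<close> to \<open>P (m - 1)\<close>, so that
  \<open>d 0\<close> plays no role.\<close>

definition projective_resolution ::
  "'c itself \<Rightarrow> 'd itself \<Rightarrow> ('r, 'e) ring_scheme \<Rightarrow>
    (nat \<Rightarrow> ('r, 'a, 'm) module_scheme) \<Rightarrow> (nat \<Rightarrow> 'a \<Rightarrow> 'a) \<Rightarrow>
    ('r, 'b, 'n) module_scheme \<Rightarrow> ('a \<Rightarrow> 'b) \<Rightarrow> bool"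
  where "projective_resolution tc td R P d M \<epsilon> \<longleftrightarrow>
    left_module R M \<and>
    (\<forall>m. projective_module tc td R (P m)) \<and>
    (\<forall>m. d (Suc m) \<in> left_module_hom R (P (Suc m)) (P m)) \<and>
    \<epsilon> \<in> left_module_hom R (P 0) M \<and>
    \<epsilon> ` carrier (P 0) = carrier M \<and>
    d 1 ` carrier (P 1) = {x \<in> carrier (P 0). \<epsilon> x = \<zero>\<^bsub>M\<^esub>} \<and>
    (\<forall>m. d (Suc (Suc m)) ` carrier (P (Suc (Suc m))) =
      {x \<in> carrier (P (Suc m)). d (Suc m) x = \<zero>\<^bsub>P m\<^esub>})"

definition minimal_complex ::
  "('r, 'e) ring_scheme \<Rightarrow> (nat \<Rightarrow> ('r, 'a, 'm) module_scheme) \<Rightarrow> (nat \<Rightarrow> 'a \<Rightarrow> 'a) \<Rightarrow> bool"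
  where "minimal_complex R P d \<longleftrightarrow>
    (\<forall>m. d (Suc m) ` carrier (P (Suc m)) \<subseteq> module_radical R (P m))"


section \<open>Linear algebra over a field\<close>

definition single :: "('k, 'e) ring_scheme \<Rightarrow> 's \<Rightarrow> 's \<Rightarrow> 'k"
  where "single K s = (\<lambda>t. if t = s then \<one>\<^bsub>K\<^esub> else \<zero>\<^bsub>K\<^esub>)"

definition free_module :: "('k, 'e) ring_scheme \<Rightarrow> 's set \<Rightarrow> ('k, 's \<Rightarrow> 'k) module"
  where "free_module K S =
    \<lparr>carrier = {f. range f \<subseteq> carrier K \<and> finite {s. f s \<noteq> \<zero>\<^bsub>K\<^esub>} \<and> {s. f s \<noteq> \<zero>\<^bsub>K\<^esub>} \<subseteq> S},
     mult = undefined, one = undefined,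
     zero = (\<lambda>s. \<zero>\<^bsub>K\<^esub>), add = (\<lambda>f g s. f s \<oplus>\<^bsub>K\<^esub> g s),
     smult = (\<lambda>c f s. c \<otimes>\<^bsub>K\<^esub> f s)\<rparr>"

definition generated_submodule ::
  "('k, 'e) ring_scheme \<Rightarrow> ('k, 'a, 'm) module_scheme \<Rightarrow> 'a set \<Rightarrow> 'a set"
  where "generated_submodule K M S = \<Inter>{H. submodule H K M \<and> S \<subseteq> H}"

definition quotient_module :: "('k, 'a, 'm) module_scheme \<Rightarrow> 'a set \<Rightarrow> ('k, 'a set) module"
  where "quotient_module M N =
    \<lparr>carrier = a_rcosets\<^bsub>M\<^esub> N, mult = undefined, one = undefined,
     zero = N, add = set_add M,
     smult = (\<lambda>c X. \<Union>x\<in>X. N +>\<^bsub>M\<^esub> (c \<odot>\<^bsub>M\<^esub> x))\<rparr>"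

definition tensor_relations ::
  "('k, 'e) ring_scheme \<Rightarrow> ('k, 'a, 'm) module_scheme \<Rightarrow> ('k, 'b, 'n) module_scheme \<Rightarrow>
    ('a \<times> 'b \<Rightarrow> 'k) set"
  where "tensor_relations K M N =
    (let F = free_module K (carrier M \<times> carrier N) in
      generated_submodule K F
       ({single K (a \<oplus>\<^bsub>M\<^esub> a', b) \<ominus>\<^bsub>F\<^esub> (single K (a, b) \<oplus>\<^bsub>F\<^esub> single K (a', b)) | a a' b.
          a \<in> carrier M \<and> a' \<in> carrier M \<and> b \<in> carrier N} \<union>
        {single K (a, b \<oplus>\<^bsub>N\<^esub> b') \<ominus>\<^bsub>F\<^esub> (single K (a, b) \<oplus>\<^bsub>F\<^esub> single K (a, b')) | a b b'.
          a \<in> carrier M \<and> b \<in> carrier N \<and> b' \<in> carrier N} \<union>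
        {single K (c \<odot>\<^bsub>M\<^esub> a, b) \<ominus>\<^bsub>F\<^esub> c \<odot>\<^bsub>F\<^esub> single K (a, b) | c a b.
          c \<in> carrier K \<and> a \<in> carrier M \<and> b \<in> carrier N} \<union>
        {single K (a, c \<odot>\<^bsub>N\<^esub> b) \<ominus>\<^bsub>F\<^esub> c \<odot>\<^bsub>F\<^esub> single K (a, b) | c a b.
          c \<in> carrier K \<and> a \<in> carrier M \<and> b \<in> carrier N}))"

definition tensor ::
  "('k, 'e) ring_scheme \<Rightarrow> ('k, 'a, 'm) module_scheme \<Rightarrow> ('k, 'b, 'n) module_scheme \<Rightarrow>
    ('k, ('a \<times> 'b \<Rightarrow> 'k) set) module"
  where "tensor K M N =
    quotient_module (free_module K (carrier M \<times> carrier N)) (tensor_relations K M N)"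

definition pure_tensor ::
  "('k, 'e) ring_scheme \<Rightarrow> ('k, 'a, 'm) module_scheme \<Rightarrow> ('k, 'b, 'n) module_scheme \<Rightarrow>
    'a \<Rightarrow> 'b \<Rightarrow> ('a \<times> 'b \<Rightarrow> 'k) set"
  where "pure_tensor K M N a b =
    tensor_relations K M N +>\<^bsub>free_module K (carrier M \<times> carrier N)\<^esub> single K (a, b)"

text \<open>The linear map on a tensor product (with values in \<open>V\<close>) that sends \<open>a \<otimes> b\<close> to
  \<open>\<beta> a b\<close>. For \<open>\<beta>\<close> bilinear, the value does not depend on the representative \<open>r\<close>.\<close>

definition tensor_lift ::
  "('k, 'e) ring_scheme \<Rightarrow> ('k, 'v, 'm) module_scheme \<Rightarrow> ('a \<Rightarrow> 'b \<Rightarrow> 'v) \<Rightarrow>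
    ('a \<times> 'b \<Rightarrow> 'k) set \<Rightarrow> 'v"
  where "tensor_lift K V \<beta> X =
    (let r = (SOME r. r \<in> X) in
      finsum V (\<lambda>p. r p \<odot>\<^bsub>V\<^esub> \<beta> (fst p) (snd p)) {p. r p \<noteq> \<zero>\<^bsub>K\<^esub>})"

definition opposite :: "('k, 'a, 'm) module_scheme \<Rightarrow> ('k, 'a, 'm) module_scheme"
  where "opposite A = A\<lparr>mult := (\<lambda>x y. y \<otimes>\<^bsub>A\<^esub> x)\<rparr>"

definition tensor_algebra ::
  "('k, 'e) ring_scheme \<Rightarrow> ('k, 'a, 'm) module_scheme \<Rightarrow> ('k, 'b, 'n) module_scheme \<Rightarrow>
    ('k, ('a \<times> 'b \<Rightarrow> 'k) set) module"
  where "tensor_algebra K A B = (tensor K A B)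
    \<lparr>mult := (\<lambda>X Y. tensor_lift K (tensor K A B) (\<lambda>a b.
        tensor_lift K (tensor K A B)
          (\<lambda>c d. pure_tensor K A B (a \<otimes>\<^bsub>A\<^esub> c) (b \<otimes>\<^bsub>B\<^esub> d)) Y) X),
     one := pure_tensor K A B \<one>\<^bsub>A\<^esub> \<one>\<^bsub>B\<^esub>\<rparr>"

definition enveloping_algebra ::
  "('k, 'e) ring_scheme \<Rightarrow> ('k, 'a, 'm) module_scheme \<Rightarrow> ('k, ('a \<times> 'a \<Rightarrow> 'k) set) module"
  where "enveloping_algebra K A = tensor_algebra K A (opposite A)"

text \<open>An \<open>A\<close>-bimodule \<open>M\<close>, with left action \<open>l\<close> and right action \<open>r\<close>, as a left module over the
  enveloping algebra: \<open>(a \<otimes> b) x = a x b\<close>.\<close>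

definition enveloping_module ::
  "('k, 'e) ring_scheme \<Rightarrow> ('k, 'x, 'm) module_scheme \<Rightarrow> ('a \<Rightarrow> 'x \<Rightarrow> 'x) \<Rightarrow> ('x \<Rightarrow> 'a \<Rightarrow> 'x) \<Rightarrow>
    (('a \<times> 'a \<Rightarrow> 'k) set, 'x) module"
  where "enveloping_module K M l r =
    \<lparr>carrier = carrier M, mult = mult M, one = one M, zero = zero M, add = add M,
     smult = (\<lambda>X x. tensor_lift K M (\<lambda>a b. r (l a x) b) X)\<rparr>"


section \<open>The exterior algebra\<close>

text \<open>Words in the letters \<open>1, \<dots>, n\<close> are lists, and an element of the free associative algebra is
  a finitely supported function on words.\<close>

definition words :: "nat \<Rightarrow> nat list set"
  where "words n = {w. set w \<subseteq> {1..n}}"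

definition free_algebra :: "('k, 'e) ring_scheme \<Rightarrow> nat \<Rightarrow> ('k, nat list \<Rightarrow> 'k) module"
  where "free_algebra K n = (free_module K (words n))
    \<lparr>mult := (\<lambda>f g w. finsum K (\<lambda>j. f (take j w) \<otimes>\<^bsub>K\<^esub> g (drop j w)) {0..length w}),
     one := single K []\<rparr>"

definition free_gen :: "('k, 'e) ring_scheme \<Rightarrow> nat \<Rightarrow> nat list \<Rightarrow> 'k"
  where "free_gen K h = single K [h]"

definition free_algebra_deg :: "('k, 'e) ring_scheme \<Rightarrow> nat \<Rightarrow> nat \<Rightarrow> ('k, nat list \<Rightarrow> 'k) module"
  where "free_algebra_deg K n m = free_module K {w \<in> words n. length w = m}"

definition exterior_ideal :: "('k, 'e) ring_scheme \<Rightarrow> nat \<Rightarrow> (nat list \<Rightarrow> 'k) set"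
  where "exterior_ideal K n =
    Idl\<^bsub>free_algebra K n\<^esub>
     ({free_gen K i \<otimes>\<^bsub>free_algebra K n\<^esub> free_gen K i | i. 1 \<le> i \<and> i \<le> n} \<union>
      {free_gen K i \<otimes>\<^bsub>free_algebra K n\<^esub> free_gen K j
         \<oplus>\<^bsub>free_algebra K n\<^esub> free_gen K j \<otimes>\<^bsub>free_algebra K n\<^esub> free_gen K i | i j.
         1 \<le> i \<and> i < j \<and> j \<le> n})"

text \<open>The factor ring, together with its scalar multiplication.\<close>

definition exterior_algebra :: "('k, 'e) ring_scheme \<Rightarrow> nat \<Rightarrow> ('k, (nat list \<Rightarrow> 'k) set) module"
  where "exterior_algebra K n =
    ring.extend (free_algebra K n Quot exterior_ideal K n)
      (module.fields (smult (quotient_module (free_algebra K n) (exterior_ideal K n))))"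

definition ext_gen :: "('k, 'e) ring_scheme \<Rightarrow> nat \<Rightarrow> nat \<Rightarrow> (nat list \<Rightarrow> 'k) set"
  where "ext_gen K n h = exterior_ideal K n +>\<^bsub>free_algebra K n\<^esub> free_gen K h"


section \<open>The complex\<close>

text \<open>An exponent vector is a function that vanishes outside of \<open>{1..n}\<close>.\<close>

definition multi_indices :: "nat \<Rightarrow> nat \<Rightarrow> (nat \<Rightarrow> nat) set"
  where "multi_indices n m = {i. (\<forall>h. h \<notin> {1..n} \<longrightarrow> i h = 0) \<and> (\<Sum>h = 1..n. i h) = m}"

text \<open>At \<open>m = 1\<close> the recursion gives \<open>1 \<cdot> x\<^sub>h\<close> for the exponent vector whose only nonzero entry is
  \<open>1\<close> at position \<open>h\<close>. Values at exponent vectors of the wrong total degree are not used.\<close>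

fun f_elt :: "('k, 'e) ring_scheme \<Rightarrow> nat \<Rightarrow> nat \<Rightarrow> (nat \<Rightarrow> nat) \<Rightarrow> nat list \<Rightarrow> 'k"
  where
    "f_elt K n 0 i = \<one>\<^bsub>free_algebra K n\<^esub>"
  | "f_elt K n (Suc m) i = finsum (free_algebra K n)
      (\<lambda>h. if i h = 0 then \<zero>\<^bsub>free_algebra K n\<^esub>
        else f_elt K n m (i(h := i h - 1)) \<otimes>\<^bsub>free_algebra K n\<^esub> free_gen K h) {1..n}"

type_synonym 'k ext = "(nat list \<Rightarrow> 'k) set"
type_synonym 'k ext_env = "('k ext \<times> 'k ext \<Rightarrow> 'k) set"
type_synonym 'k triple = "(('k ext \<times> (nat list \<Rightarrow> 'k) \<Rightarrow> 'k) set \<times> 'k ext \<Rightarrow> 'k) set"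

abbreviation ext_env :: "('k, 'e) ring_scheme \<Rightarrow> nat \<Rightarrow> ('k, 'k ext_env) module"
  where "ext_env K n \<equiv> enveloping_algebra K (exterior_algebra K n)"

text \<open>The space \<open>\<Lambda> \<otimes> k\<langle>x\<^sub>1, \<dots>, x\<^sub>n\<rangle>\<^sub>m \<otimes> \<Lambda>\<close>, its elements \<open>a \<otimes> u \<otimes> b\<close>, the linear maps on it, and its
  two actions of \<open>\<Lambda>\<close>.\<close>

definition left_factor ::
  "('k, 'e) ring_scheme \<Rightarrow> nat \<Rightarrow> nat \<Rightarrow> ('k, ('k ext \<times> (nat list \<Rightarrow> 'k) \<Rightarrow> 'k) set) module"
  where "left_factor K n m = tensor K (exterior_algebra K n) (free_algebra_deg K n m)"

definition triple_tensor :: "('k, 'e) ring_scheme \<Rightarrow> nat \<Rightarrow> nat \<Rightarrow> ('k, 'k triple) module"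
  where "triple_tensor K n m = tensor K (left_factor K n m) (exterior_algebra K n)"

definition pure_triple ::
  "('k, 'e) ring_scheme \<Rightarrow> nat \<Rightarrow> nat \<Rightarrow> 'k ext \<Rightarrow> (nat list \<Rightarrow> 'k) \<Rightarrow> 'k ext \<Rightarrow> 'k triple"
  where "pure_triple K n m a u b =
    pure_tensor K (left_factor K n m) (exterior_algebra K n)
      (pure_tensor K (exterior_algebra K n) (free_algebra_deg K n m) a u) b"

definition triple_lift ::
  "('k, 'e) ring_scheme \<Rightarrow> ('k, 'v, 'm) module_scheme \<Rightarrow>
    ('k ext \<Rightarrow> (nat list \<Rightarrow> 'k) \<Rightarrow> 'k ext \<Rightarrow> 'v) \<Rightarrow> 'k triple \<Rightarrow> 'v"
  where "triple_lift K V \<gamma> =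
    tensor_lift K V (\<lambda>t b. tensor_lift K V (\<lambda>a u. \<gamma> a u b) t)"

definition lact :: "('k, 'e) ring_scheme \<Rightarrow> nat \<Rightarrow> nat \<Rightarrow> 'k ext \<Rightarrow> 'k triple \<Rightarrow> 'k triple"
  where "lact K n m c =
    triple_lift K (triple_tensor K n m)
      (\<lambda>a u b. pure_triple K n m (c \<otimes>\<^bsub>exterior_algebra K n\<^esub> a) u b)"

definition ract :: "('k, 'e) ring_scheme \<Rightarrow> nat \<Rightarrow> nat \<Rightarrow> 'k triple \<Rightarrow> 'k ext \<Rightarrow> 'k triple"
  where "ract K n m t c =
    triple_lift K (triple_tensor K n m)
      (\<lambda>a u b. pure_triple K n m a u (b \<otimes>\<^bsub>exterior_algebra K n\<^esub> c)) t"

text \<open>The sum of the subspaces \<open>\<Lambda> \<otimes> f \<otimes> \<Lambda>\<close> is taken inside \<open>\<Lambda> \<otimes> k\<langle>x\<^sub>1, \<dots>, x\<^sub>n\<rangle>\<^sub>m \<otimes> \<Lambda>\<close>; it is direct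
  because the elements \<open>f\<close> belonging to different exponent vectors are nonzero and have disjoint
  sets of words as supports.\<close>

definition koszul_module ::
  "('k, 'e) ring_scheme \<Rightarrow> nat \<Rightarrow> nat \<Rightarrow> ('k ext_env, 'k triple) module"
  where "koszul_module K n m =
    (enveloping_module K (triple_tensor K n m) (lact K n m) (ract K n m))
    \<lparr>carrier := generated_submodule K (triple_tensor K n m)
      {pure_triple K n m a (f_elt K n m i) b | a i b.
        a \<in> carrier (exterior_algebra K n) \<and> i \<in> multi_indices n m \<and>
        b \<in> carrier (exterior_algebra K n)}\<rparr>"

definition f_tilde :: "('k, 'e) ring_scheme \<Rightarrow> nat \<Rightarrow> nat \<Rightarrow> (nat \<Rightarrow> nat) \<Rightarrow> 'k triple"
  where "f_tilde K n m i =
    pure_triple K n m \<one>\<^bsub>exterior_algebra K n\<^esub> (f_elt K n m i) \<one>\<^bsub>exterior_algebra K n\<^esub>"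

definition koszul_diff_value :: "('k, 'e) ring_scheme \<Rightarrow> nat \<Rightarrow> nat \<Rightarrow> (nat \<Rightarrow> nat) \<Rightarrow> 'k triple"
  where "koszul_diff_value K n m i =
    finsum (triple_tensor K n (m - 1))
      (\<lambda>h. if i h = 0 then \<zero>\<^bsub>triple_tensor K n (m - 1)\<^esub>
        else lact K n (m - 1) (ext_gen K n h) (f_tilde K n (m - 1) (i(h := i h - 1)))
          \<oplus>\<^bsub>triple_tensor K n (m - 1)\<^esub>
          ((\<ominus>\<^bsub>K\<^esub> \<one>\<^bsub>K\<^esub>) [^]\<^bsub>K\<^esub> m) \<odot>\<^bsub>triple_tensor K n (m - 1)\<^esub>
            ract K n (m - 1) (f_tilde K n (m - 1) (i(h := i h - 1))) (ext_gen K n h)) {1..n}"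

text \<open>The differential from degree \<open>m\<close> to degree \<open>m - 1\<close>, for \<open>m \<ge> 1\<close>: the bimodule homomorphism
  with the prescribed values on generators. Extensionality makes it unique as a function of the
  logic.\<close>

definition koszul_diff :: "('k, 'e) ring_scheme \<Rightarrow> nat \<Rightarrow> nat \<Rightarrow> 'k triple \<Rightarrow> 'k triple"
  where "koszul_diff K n m =
    (THE d. d \<in> left_module_hom (ext_env K n) (koszul_module K n m) (koszul_module K n (m - 1)) \<and>
      d \<in> extensional (carrier (koszul_module K n m)) \<and>
      (\<forall>i\<in>multi_indices n m. d (f_tilde K n m i) = koszul_diff_value K n m i))"

definition ext_bimodule :: "('k, 'e) ring_scheme \<Rightarrow> nat \<Rightarrow> ('k ext_env, 'k ext) module"
  where "ext_bimodule K n =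
    enveloping_module K (exterior_algebra K n)
      (mult (exterior_algebra K n)) (mult (exterior_algebra K n))"

text \<open>In degree \<open>0\<close> the middle factor consists of the scalar multiples of the empty word; under the
  identification \<open>a \<otimes> c \<otimes> b \<mapsto> c (a \<otimes> b)\<close> with \<open>\<Lambda> \<otimes> \<Lambda>\<close> the following map is multiplication.\<close>

definition koszul_aug :: "('k, 'e) ring_scheme \<Rightarrow> nat \<Rightarrow> 'k triple \<Rightarrow> 'k ext"
  where "koszul_aug K n =
    triple_lift K (exterior_algebra K n)
      (\<lambda>a u b. u [] \<odot>\<^bsub>exterior_algebra K n\<^esub> (a \<otimes>\<^bsub>exterior_algebra K n\<^esub> b))"

end

(*
  The bimodule P_m is free over the enveloping algebra A, with basis the elements f~_i, because
  the f_i have coefficients 0 and 1 and disjoint supports.  On this basis the differential is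
  d (Z f~_i) = sum_h Z y_h f~_(i - h), where y_h is x_h (x) 1 + (-1)^m 1 (x) x_h.

  For a fixed h let D_h be the antiderivation "contraction with x_h" of the exterior algebra,
  acting on the left factor of A.  Then s_h (Z f~_i) = D_h(Z) f~_(i + h) satisfies
  (d s_h + s_h d) (Z f~_i) = Z f~_i if i_h is nonzero, and otherwise it is a multiple of f~_i.
  So a cycle of positive degree can be changed by boundaries, one h after the other, until all
  its coordinates at i with i_1 + ... + i_h > 0 vanish; for h = n nothing is left.  In degree 0,
  a (x) b and 1 (x) ab differ by a boundary, by induction on the number of generators in a.

  Minimality: each of x_h (x) 1 and 1 (x) x_h generates a two-sided ideal of square zero in A,
  so it maps P_m into every maximal submodule.
*)

theory Submission
  imports Defs
begin

section \<open>Modules and linear maps\<close>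

text \<open>The obstacle is the characteristic. The sum of all homotopies s_h acts on Z f_i, up to
  contraction terms for the h with i_h = 0, as multiplication by the number of nonzero exponents of
  i, and this number may be zero in k. A single s_h has coefficient 1 but does not contract the
  complex. Using s_1, ..., s_n in succession works because d s_h + s_h d maps each Z f_i to a
  multiple of the same f_i: a coordinate is changed only by itself or by a contraction of itself
  times y_h, so a coordinate that is zero stays zero. The sign (-1)^m in y_h has two effects.
  Consecutive degrees carry opposite signs, which makes the products of their coefficients
  antisymmetric and gives d d = 0. And contracting the left factor alone satisfies D_h(Z y_g) +
  D_h(Z) y'_g = Z or 0, with y'_g from the neighbouring degree, because the parts in the right
  factor come with opposite signs. D_h is an antiderivation with respect to multiplication from the
  right, since left linearity of d puts y_h to the right of Z.\<close>

lemma (in abelian_group) diff_zero_imp_eq: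
  assumes "a \<in> carrier G" "b \<in> carrier G" "a \<ominus> b = \<zero>"
  shows "a = b"
proof -
  have "a = (a \<ominus> b) \<oplus> b" using assms(1,2) by (simp add: a_minus_def a_assoc l_neg)
  then show ?thesis using assms by simp
qed

lemma (in abelian_group) minus_add_right:
  "a \<in> carrier G \<Longrightarrow> b \<in> carrier G \<Longrightarrow> c \<in> carrier G \<Longrightarrow> a \<ominus> (b \<oplus> c) = (a \<ominus> b) \<ominus> c"
  by (simp add: a_minus_def minus_add a_ac)

text \<open>This is the shape in which the contraction of an anticommutator appears: the two
  products of letters contribute p - q and q - p beside the terms a and b that are to
  survive.\<close>

lemma (in abelian_group) cross_cancel:
  assumes "p \<in> carrier G" "q \<in> carrier G" "a \<in> carrier G" "b \<in> carrier G"
  shows "((p \<ominus> q) \<oplus> a) \<oplus> ((q \<ominus> p) \<oplus> b) = a \<oplus> b"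
proof -
  have "((p \<ominus> q) \<oplus> a) \<oplus> ((q \<ominus> p) \<oplus> b) = ((p \<ominus> p) \<oplus> (q \<ominus> q)) \<oplus> (a \<oplus> b)"
    using assms by (simp add: a_minus_def a_ac)
  then show ?thesis using assms by (simp add: a_minus_def r_neg)
qed

text \<open>Entries off the diagonal cancel in pairs. The diagonal has its own hypothesis, because
  twice an element may vanish without the element being zero. The lemma serves to show that the
  differential squares to zero.\<close>

lemma (in abelian_group) antisymmetric_double_sum:
  assumes "finite S" "\<And>g h. g \<in> S \<Longrightarrow> h \<in> S \<Longrightarrow> F g h \<in> carrier G"
    and "\<And>g. g \<in> S \<Longrightarrow> F g g = \<zero>"
    and "\<And>g h. g \<in> S \<Longrightarrow> h \<in> S \<Longrightarrow> F g h \<oplus> F h g = \<zero>"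
  shows "finsum G (\<lambda>g. finsum G (F g) S) S = \<zero>"
  using assms
proof (induction S rule: finite_induct)
  case (insert s S)
  have cl: "F g \<in> S \<rightarrow> carrier G" "(\<lambda>g. F g s) \<in> S \<rightarrow> carrier G" "F g s \<in> carrier G" "F s g \<in> carrier G"
    if "g \<in> insert s S" for g
    using insert.prems(1) that by auto
  have cl': "(\<lambda>g. finsum G (F g) S) \<in> S \<rightarrow> carrier G"
    using cl by auto
  have ih: "finsum G (\<lambda>g. finsum G (F g) S) S = \<zero>"
    by (rule insert.IH) (use insert.prems in auto)
  have rows: "finsum G (F g) (insert s S) = F g s \<oplus> finsum G (F g) S" if "g \<in> insert s S" for g
    using insert.hyps cl[OF that] by (intro finsum_insert) auto
  have "finsum G (\<lambda>g. finsum G (F g) (insert s S)) (insert s S) =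
      finsum G (\<lambda>g. F g s \<oplus> finsum G (F g) S) (insert s S)"
    using cl by (intro finsum_cong') (auto simp: rows)
  also have "\<dots> = (F s s \<oplus> finsum G (F s) S) \<oplus> finsum G (\<lambda>g. F g s \<oplus> finsum G (F g) S) S"
    using insert.hyps cl by (intro finsum_insert) auto
  also have "finsum G (\<lambda>g. F g s \<oplus> finsum G (F g) S) S =
      finsum G (\<lambda>g. F g s) S \<oplus> finsum G (\<lambda>g. finsum G (F g) S) S"
    using cl cl' by (intro finsum_addf) auto
  \<comment> \<open>The corner entry and the old square vanish; the new row and the new column
    remain and cancel entry by entry.\<close>
  also have "(F s s \<oplus> finsum G (F s) S) \<oplus> (finsum G (\<lambda>g. F g s) S \<oplus> finsum G (\<lambda>g. finsum G (F g) S) S) =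
      finsum G (F s) S \<oplus> finsum G (\<lambda>g. F g s) S"
    using cl[of s] insert.prems(2)[of s] ih by simp
  also have "\<dots> = finsum G (\<lambda>g. F s g \<oplus> F g s) S"
    using cl by (intro finsum_addf[symmetric]) auto
  also have "\<dots> = finsum G (\<lambda>g. \<zero>) S"
    using insert.prems(3) by (intro finsum_cong') auto
  finally show ?case by (simp add: finsum_zero)
qed simp

text \<open>The homotopies below are not linear over the enveloping algebra. Preservation of zero,
  negatives and finite sums is therefore proved for additive maps and reused for linear
  ones.\<close>

abbreviation add_hom :: "('a, 'm) ring_scheme \<Rightarrow> ('b, 'n) ring_scheme \<Rightarrow> ('a \<Rightarrow> 'b) set"
  where "add_hom M N \<equiv> hom (add_monoid M) (add_monoid N)"

lemma add_homI:
  assumes "\<And>x. x \<in> carrier M \<Longrightarrow> f x \<in> carrier N"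
    and "\<And>x y. x \<in> carrier M \<Longrightarrow> y \<in> carrier M \<Longrightarrow> f (x \<oplus>\<^bsub>M\<^esub> y) = f x \<oplus>\<^bsub>N\<^esub> f y"
  shows "f \<in> add_hom M N"
  using assms by (auto simp: hom_def)

lemma add_hom_closed: "f \<in> add_hom M N \<Longrightarrow> x \<in> carrier M \<Longrightarrow> f x \<in> carrier N"
  by (auto simp: hom_def)

lemma add_hom_add:
  "f \<in> add_hom M N \<Longrightarrow> x \<in> carrier M \<Longrightarrow> y \<in> carrier M \<Longrightarrow> f (x \<oplus>\<^bsub>M\<^esub> y) = f x \<oplus>\<^bsub>N\<^esub> f y"
  by (auto simp: hom_def)

lemma add_hom_zero:
  assumes "f \<in> add_hom M N" "abelian_group M" "abelian_group N"
  shows "f \<zero>\<^bsub>M\<^esub> = \<zero>\<^bsub>N\<^esub>"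
proof -
  interpret M: abelian_group M by fact
  interpret N: abelian_group N by fact
  interpret group_hom "add_monoid M" "add_monoid N" f
    by unfold_locales (use assms(1) in simp)
  show ?thesis using hom_one by simp
qed

lemma add_hom_minus:
  assumes "f \<in> add_hom M N" "abelian_group M" "abelian_group N" "x \<in> carrier M"
  shows "f (\<ominus>\<^bsub>M\<^esub> x) = \<ominus>\<^bsub>N\<^esub> f x"
proof -
  interpret M: abelian_group M by fact
  interpret N: abelian_group N by fact
  interpret group_hom "add_monoid M" "add_monoid N" f
    by unfold_locales (use assms(1) in simp)
  show ?thesis using hom_inv assms(4) by (simp add: a_inv_def)
qed

lemma add_hom_finsum:
  assumes "f \<in> add_hom M N" "abelian_group M" "abelian_group N" "g \<in> A \<rightarrow> carrier M"
  shows "f (finsum M g A) = finsum N (\<lambda>i. f (g i)) A"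
proof -
  interpret M: abelian_group M by fact
  interpret N: abelian_group N by fact
  show ?thesis using assms(4)
  proof (induction A rule: infinite_finite_induct)
    case (infinite A)
    then show ?case by (simp add: add_hom_zero[OF assms(1-3)])
  next
    case empty
    then show ?case by (simp add: add_hom_zero[OF assms(1-3)])
  next
    case (insert x F)
    have g: "g \<in> F \<rightarrow> carrier M" "g x \<in> carrier M" using insert.prems by auto
    have fg: "(\<lambda>i. f (g i)) \<in> F \<rightarrow> carrier N" "f (g x) \<in> carrier N"
      using g add_hom_closed[OF assms(1)] by auto
    show ?case
      using insert.hyps insert.IH[OF g(1)] g fg M.finsum_closed[OF g(1)]
      by (simp add: M.finsum_insert N.finsum_insert add_hom_add[OF assms(1)])
  qed
qed

section \<open>Linear maps and submodules over a ring that need not be commutative\<close>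

lemma left_module_homI:
  assumes "\<And>x. x \<in> carrier M \<Longrightarrow> f x \<in> carrier N"
    and "\<And>x y. x \<in> carrier M \<Longrightarrow> y \<in> carrier M \<Longrightarrow> f (x \<oplus>\<^bsub>M\<^esub> y) = f x \<oplus>\<^bsub>N\<^esub> f y"
    and "\<And>a x. a \<in> carrier R \<Longrightarrow> x \<in> carrier M \<Longrightarrow> f (a \<odot>\<^bsub>M\<^esub> x) = a \<odot>\<^bsub>N\<^esub> f x"
  shows "f \<in> left_module_hom R M N"
  using assms by (auto simp: left_module_hom_def)

lemma left_module_hom_add_hom: "f \<in> left_module_hom R M N \<Longrightarrow> f \<in> add_hom M N"
  by (auto simp: left_module_hom_def hom_def)

lemma left_module_hom_closed:
  "f \<in> left_module_hom R M N \<Longrightarrow> x \<in> carrier M \<Longrightarrow> f x \<in> carrier N"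
  by (auto simp: left_module_hom_def)

lemma left_module_hom_add:
  "f \<in> left_module_hom R M N \<Longrightarrow> x \<in> carrier M \<Longrightarrow> y \<in> carrier M \<Longrightarrow>
    f (x \<oplus>\<^bsub>M\<^esub> y) = f x \<oplus>\<^bsub>N\<^esub> f y"
  by (auto simp: left_module_hom_def)

lemma left_module_hom_smult:
  "f \<in> left_module_hom R M N \<Longrightarrow> a \<in> carrier R \<Longrightarrow> x \<in> carrier M \<Longrightarrow>
    f (a \<odot>\<^bsub>M\<^esub> x) = a \<odot>\<^bsub>N\<^esub> f x"
  by (auto simp: left_module_hom_def)

text \<open>The scalars are an arbitrary record here, so the criterion serves both for subspaces
  over \<open>K\<close> and for submodules over the enveloping algebra.\<close>

lemma submodule_iff:
  assumes "abelian_group M"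
  shows "submodule H R M \<longleftrightarrow> H \<subseteq> carrier M \<and> \<zero>\<^bsub>M\<^esub> \<in> H \<and> (\<forall>x\<in>H. \<forall>y\<in>H. x \<oplus>\<^bsub>M\<^esub> y \<in> H) \<and>
    (\<forall>x\<in>H. \<ominus>\<^bsub>M\<^esub> x \<in> H) \<and> (\<forall>a\<in>carrier R. \<forall>x\<in>H. a \<odot>\<^bsub>M\<^esub> x \<in> H)"
  unfolding submodule_def submodule_axioms_def subgroup_def by (auto simp: a_inv_def)

lemma left_module_smult_zero:
  assumes "left_module R M" "x \<in> carrier M"
  shows "\<zero>\<^bsub>R\<^esub> \<odot>\<^bsub>M\<^esub> x = \<zero>\<^bsub>M\<^esub>"
proof -
  interpret left_module R M by fact
  have "(\<lambda>a. a \<odot>\<^bsub>M\<^esub> x) \<in> add_hom R M"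
    using assms(2) by (intro add_homI) (auto simp: smult_closed smult_l_distr)
  from add_hom_zero[OF this R.abelian_group_axioms M.abelian_group_axioms] show ?thesis .
qed

lemma left_module_smult_minus:
  assumes "left_module R M" "x \<in> carrier M" "a \<in> carrier R"
  shows "(\<ominus>\<^bsub>R\<^esub> a) \<odot>\<^bsub>M\<^esub> x = \<ominus>\<^bsub>M\<^esub> (a \<odot>\<^bsub>M\<^esub> x)"
proof -
  interpret left_module R M by fact
  have "(\<lambda>a. a \<odot>\<^bsub>M\<^esub> x) \<in> add_hom R M"
    using assms(2) by (intro add_homI) (auto simp: smult_closed smult_l_distr)
  from add_hom_minus[OF this R.abelian_group_axioms M.abelian_group_axioms assms(3)] show ?thesis .
qed

lemma left_module_smult_finsum:
  assumes "left_module R M" "a \<in> carrier R" "f \<in> A \<rightarrow> carrier M"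
  shows "a \<odot>\<^bsub>M\<^esub> finsum M f A = finsum M (\<lambda>i. a \<odot>\<^bsub>M\<^esub> f i) A"
proof -
  interpret left_module R M by fact
  have "(\<lambda>x. a \<odot>\<^bsub>M\<^esub> x) \<in> add_hom M M"
    using assms(2) by (intro add_homI) (auto simp: smult_closed smult_r_distr)
  from add_hom_finsum[OF this M.abelian_group_axioms M.abelian_group_axioms assms(3)] show ?thesis .
qed

lemma left_module_submodule:
  assumes "left_module R M" "submodule H R M"
  shows "left_module R (M\<lparr>carrier := H\<rparr>)"
proof -
  interpret left_module R M by fact
  interpret S: submodule H R M by fact
  have sub: "H \<subseteq> carrier M" and z: "\<zero>\<^bsub>M\<^esub> \<in> H" and pl: "\<And>x y. x \<in> H \<Longrightarrow> y \<in> H \<Longrightarrow> x \<oplus>\<^bsub>M\<^esub> y \<in> H"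
    and mi: "\<And>x. x \<in> H \<Longrightarrow> \<ominus>\<^bsub>M\<^esub> x \<in> H" and sm: "\<And>a x. a \<in> carrier R \<Longrightarrow> x \<in> H \<Longrightarrow> a \<odot>\<^bsub>M\<^esub> x \<in> H"
    using assms(2) unfolding submodule_iff[OF M.abelian_group_axioms] by auto
  have c: "\<And>x. x \<in> H \<Longrightarrow> x \<in> carrier M" using sub by auto
  have "abelian_group (M\<lparr>carrier := H\<rparr>)"
    by (rule abelian_groupI)
       (auto simp: c z pl M.a_ac intro!: M.l_zero bexI[OF _ mi] M.r_neg)
  then show ?thesis
    by (intro left_module.intro left_module_axioms.intro R.ring_axioms)
       (auto simp: c sm smult_l_distr smult_r_distr smult_assoc1 smult_one)
qed

lemma kernel_submodule:
  assumes "module K M" "module K V" "f \<in> left_module_hom K M V"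
  shows "submodule {x \<in> carrier M. f x = \<zero>\<^bsub>V\<^esub>} K M"
proof -
  interpret M: module K M by fact
  interpret V: module K V by fact
  note f = left_module_hom_add_hom[OF assms(3)]
  show ?thesis
    unfolding submodule_iff[OF M.abelian_group_axioms]
    using add_hom_zero[OF f] add_hom_minus[OF f] left_module_hom_add[OF assms(3)]
      left_module_hom_smult[OF assms(3)] M.abelian_group_axioms V.abelian_group_axioms
    by auto
qed

section \<open>Generated submodules and linear combinations of maps\<close>

lemma generated_submodule_submodule:
  assumes "module K M" "S \<subseteq> carrier M"
  shows "submodule (generated_submodule K M S) K M"
proof -
  interpret M: module K M by fact
  have "submodule (carrier M) K M" by (rule M.carrier_is_submodule)
  then show ?thesis
    unfolding generated_submodule_def submodule_iff[OF M.abelian_group_axioms]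
    using assms(2) by auto
qed

lemma generated_submodule_incl: "S \<subseteq> generated_submodule K M S"
  by (auto simp: generated_submodule_def)

lemma generated_submodule_minimal:
  "submodule H K M \<Longrightarrow> S \<subseteq> H \<Longrightarrow> generated_submodule K M S \<subseteq> H"
  by (auto simp: generated_submodule_def)

lemma finsum_update [simp]: "finsum (M\<lparr>mult := u, one := v\<rparr>) = finsum M"
  by (simp add: finsum_def fun_eq_iff finprod_def)

lemma add_hom_comp: "f \<in> add_hom L M \<Longrightarrow> g \<in> add_hom M N \<Longrightarrow> (\<lambda>x. g (f x)) \<in> add_hom L N"
  by (auto simp: hom_def Pi_def)

lemma add_hom_diff:
  assumes "f \<in> add_hom M N" "abelian_group M" "abelian_group N" "x \<in> carrier M" "y \<in> carrier M"
  shows "f (x \<ominus>\<^bsub>M\<^esub> y) = f x \<ominus>\<^bsub>N\<^esub> f y"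
proof -
  interpret M: abelian_group M by fact
  show ?thesis
    using assms(4,5) add_hom_add[OF assms(1), of x "\<ominus>\<^bsub>M\<^esub> y"] add_hom_minus[OF assms(1-3,5)]
    by (simp add: a_minus_def)
qed

lemma left_module_hom_comp:
  "f \<in> left_module_hom K L M \<Longrightarrow> g \<in> left_module_hom K M N \<Longrightarrow> (\<lambda>x. g (f x)) \<in> left_module_hom K L N"
  by (auto simp: left_module_hom_def Pi_def)

lemma left_module_hom_id: "(\<lambda>x. x) \<in> left_module_hom K M M"
  by (auto simp: left_module_hom_def)

lemma left_module_hom_zero:
  assumes "module K V"
  shows "(\<lambda>x. \<zero>\<^bsub>V\<^esub>) \<in> left_module_hom K M V"
proof -
  interpret V: module K V by fact
  show ?thesis by (rule left_module_homI) simp_all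
qed

lemma left_module_hom_plus:
  assumes "module K M" "module K V" "f \<in> left_module_hom K M V" "g \<in> left_module_hom K M V"
  shows "(\<lambda>x. f x \<oplus>\<^bsub>V\<^esub> g x) \<in> left_module_hom K M V"
proof -
  interpret V: module K V by fact
  show ?thesis
    using assms(3,4)
    by (intro left_module_homI)
       (auto simp: left_module_hom_def Pi_def V.smult_r_distr V.M.a_ac)
qed

lemma left_module_hom_diff:
  assumes "module K M" "module K V" "f \<in> left_module_hom K M V" "g \<in> left_module_hom K M V"
  shows "(\<lambda>x. f x \<ominus>\<^bsub>V\<^esub> g x) \<in> left_module_hom K M V"
proof -
  interpret V: module K V by fact
  note cl = left_module_hom_closed[OF assms(3)] left_module_hom_closed[OF assms(4)]
  show ?thesis
  proof (rule left_module_homI)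
    fix x assume x: "x \<in> carrier M"
    then show "f x \<ominus>\<^bsub>V\<^esub> g x \<in> carrier V" using cl by simp
    show "f (c \<odot>\<^bsub>M\<^esub> x) \<ominus>\<^bsub>V\<^esub> g (c \<odot>\<^bsub>M\<^esub> x) = c \<odot>\<^bsub>V\<^esub> (f x \<ominus>\<^bsub>V\<^esub> g x)" if "c \<in> carrier K" for c
      using cl x that
      by (simp add: left_module_hom_smult[OF assms(3)] left_module_hom_smult[OF assms(4)]
          a_minus_def V.smult_r_distr V.smult_r_minus)
    fix y assume y: "y \<in> carrier M"
    show "f (x \<oplus>\<^bsub>M\<^esub> y) \<ominus>\<^bsub>V\<^esub> g (x \<oplus>\<^bsub>M\<^esub> y) = (f x \<ominus>\<^bsub>V\<^esub> g x) \<oplus>\<^bsub>V\<^esub> (f y \<ominus>\<^bsub>V\<^esub> g y)"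
      using cl x y
      by (simp add: left_module_hom_add[OF assms(3)] left_module_hom_add[OF assms(4)]
          a_minus_def V.M.minus_add V.M.a_ac)
  qed
qed

text \<open>A scalar multiple of a linear map is linear because the scalars commute with each
  other.\<close>

lemma left_module_hom_scale:
  assumes "module K M" "module K V" "f \<in> left_module_hom K M V" "c \<in> carrier K"
  shows "(\<lambda>x. c \<odot>\<^bsub>V\<^esub> f x) \<in> left_module_hom K M V"
proof -
  interpret V: module K V by fact
  show ?thesis
    using assms(3,4) V.R.m_comm
    by (intro left_module_homI)
       (auto simp: left_module_hom_def Pi_def V.smult_r_distr V.smult_assoc1[symmetric])
qed

lemma left_module_hom_finsum:
  assumes "module K M" "module K V" "finite B" "\<And>i. i \<in> B \<Longrightarrow> f i \<in> left_module_hom K M V"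
  shows "(\<lambda>x. finsum V (\<lambda>i. f i x) B) \<in> left_module_hom K M V"
proof -
  interpret V: module K V by fact
  have cl: "(\<lambda>i. f i x) \<in> B \<rightarrow> carrier V" if "x \<in> carrier M" for x
    using that left_module_hom_closed[OF assms(4)] by auto
  show ?thesis
  proof (rule left_module_homI)
    fix x assume x: "x \<in> carrier M"
    show "finsum V (\<lambda>i. f i x) B \<in> carrier V" by (rule V.M.finsum_closed[OF cl[OF x]])
    show "finsum V (\<lambda>i. f i (c \<odot>\<^bsub>M\<^esub> x)) B = c \<odot>\<^bsub>V\<^esub> finsum V (\<lambda>i. f i x) B" if c: "c \<in> carrier K" for c
    proof -
      have "finsum V (\<lambda>i. f i (c \<odot>\<^bsub>M\<^esub> x)) B = finsum V (\<lambda>i. c \<odot>\<^bsub>V\<^esub> f i x) B"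
        using cl[OF x] c
        by (intro V.M.finsum_cong') (auto simp: left_module_hom_smult[OF assms(4) c x])
      then show ?thesis using V.finsum_smult_ldistr[OF assms(3) c cl[OF x]] by simp
    qed
    fix y assume y: "y \<in> carrier M"
    have "finsum V (\<lambda>i. f i (x \<oplus>\<^bsub>M\<^esub> y)) B = finsum V (\<lambda>i. f i x \<oplus>\<^bsub>V\<^esub> f i y) B"
      using cl[OF x] cl[OF y]
      by (intro V.M.finsum_cong') (auto simp: left_module_hom_add[OF assms(4) x y])
    then show "finsum V (\<lambda>i. f i (x \<oplus>\<^bsub>M\<^esub> y)) B = finsum V (\<lambda>i. f i x) B \<oplus>\<^bsub>V\<^esub> finsum V (\<lambda>i. f i y) B"
      using V.M.finsum_addf[OF cl[OF x] cl[OF y]] by simp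
  qed
qed

lemma submodule_finsum_closed:
  assumes "abelian_group M" "submodule H K M" "\<And>i. i \<in> B \<Longrightarrow> f i \<in> H"
  shows "finsum M f B \<in> H"
proof -
  interpret M: abelian_group M by fact
  note H = assms(2)[unfolded submodule_iff[OF assms(1)]]
  show ?thesis using assms(3)
  proof (induction B rule: infinite_finite_induct)
    case (insert i B)
    then have "f i \<in> carrier M" "f \<in> B \<rightarrow> carrier M" using H by auto
    then show ?case using insert H by (simp add: M.finsum_insert)
  qed (use H in auto)
qed

lemma image_submodule:
  assumes "left_module R M" "left_module R N" "f \<in> left_module_hom R M N"
  shows "submodule (f ` carrier M) R N"
proof -
  interpret M: left_module R M by fact
  interpret N: left_module R N by fact
  note ha = left_module_hom_add_hom[OF assms(3)]
  note ag = M.M.abelian_group_axioms N.M.abelian_group_axioms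
  show ?thesis
    unfolding submodule_iff[OF ag(2)]
  proof (intro conjI ballI)
    show "f ` carrier M \<subseteq> carrier N" using left_module_hom_closed[OF assms(3)] by auto
    show "\<zero>\<^bsub>N\<^esub> \<in> f ` carrier M"
      using add_hom_zero[OF ha ag] by (intro image_eqI[of _ _ "\<zero>\<^bsub>M\<^esub>"]) auto
  next
    fix x y assume "x \<in> f ` carrier M" "y \<in> f ` carrier M"
    then obtain p q where "p \<in> carrier M" "x = f p" "q \<in> carrier M" "y = f q" by auto
    then show "x \<oplus>\<^bsub>N\<^esub> y \<in> f ` carrier M"
      by (intro image_eqI[of _ _ "p \<oplus>\<^bsub>M\<^esub> q"]) (auto simp: left_module_hom_add[OF assms(3)])
  next
    fix x assume "x \<in> f ` carrier M"
    then obtain p where "p \<in> carrier M" "x = f p" by auto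
    then show "\<ominus>\<^bsub>N\<^esub> x \<in> f ` carrier M"
      by (intro image_eqI[of _ _ "\<ominus>\<^bsub>M\<^esub> p"]) (auto simp: add_hom_minus[OF ha ag])
  next
    fix a x assume "a \<in> carrier R" "x \<in> f ` carrier M"
    then obtain p where "a \<in> carrier R" "p \<in> carrier M" "x = f p" by auto
    then show "a \<odot>\<^bsub>N\<^esub> x \<in> f ` carrier M"
      by (intro image_eqI[of _ _ "a \<odot>\<^bsub>M\<^esub> p"])
        (auto simp: left_module_hom_smult[OF assms(3)] M.smult_closed)
  qed
qed

text \<open>The algebras and bimodules are records made by overwriting fields of other records.
  Axioms are carried over along equality of the fields that they mention.\<close>

lemma abelian_group_transfer:
  assumes "abelian_group M" "carrier N = carrier M" "zero N = zero M" "add N = add M"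
  shows "abelian_group N"
proof -
  interpret M: abelian_group M by fact
  show ?thesis
  proof (rule abelian_groupI)
    fix x assume "x \<in> carrier N"
    then show "\<exists>y\<in>carrier N. y \<oplus>\<^bsub>N\<^esub> x = \<zero>\<^bsub>N\<^esub>"
      by (intro bexI[of _ "\<ominus>\<^bsub>M\<^esub> x"]) (auto simp: assms M.l_neg)
  qed (auto simp: assms M.a_ac)
qed

lemma abelian_group_update:
  "abelian_group M \<Longrightarrow> abelian_group (M\<lparr>mult := u, one := v\<rparr>)"
  by (erule abelian_group_transfer) simp_all

lemma module_transfer:
  assumes "module K M" "carrier N = carrier M" "zero N = zero M" "add N = add M" "smult N = smult M"
  shows "module K N"
proof -
  interpret M: module K M by fact
  show ?thesis
    by (intro moduleI M.R.cring_axioms abelian_group_transfer[OF M.M.abelian_group_axioms assms(2-4)])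
       (auto simp: assms M.smult_l_distr M.smult_r_distr M.smult_assoc1)
qed

lemma module_update:
  assumes "module K M"
  shows "module K (M\<lparr>mult := u, one := v\<rparr>)"
proof -
  interpret module K M by fact
  show ?thesis
    by (rule moduleI[OF R.cring_axioms abelian_group_update[OF M.abelian_group_axioms]])
       (auto simp: smult_l_distr smult_r_distr smult_assoc1)
qed

lemma ring_transfer:
  assumes "ring M" "carrier N = carrier M" "zero N = zero M" "add N = add M" "mult N = mult M"
    "one N = one M"
  shows "ring N"
proof -
  interpret M: ring M by fact
  show ?thesis
    by (intro ringI monoidI abelian_group_transfer[OF M.abelian_group_axioms assms(2-4)])
       (auto simp: assms M.l_distr M.r_distr M.m_assoc)
qed

section \<open>Free modules\<close>

lemma free_module_simps [simp]:
  "zero (free_module K S) = (\<lambda>s. \<zero>\<^bsub>K\<^esub>)"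
  "add (free_module K S) = (\<lambda>f g s. f s \<oplus>\<^bsub>K\<^esub> g s)"
  "smult (free_module K S) = (\<lambda>c f s. c \<otimes>\<^bsub>K\<^esub> f s)"
  by (simp_all add: free_module_def)

lemma free_module_mem_iff:
  "f \<in> carrier (free_module K S) \<longleftrightarrow>
    (\<forall>s. f s \<in> carrier K) \<and> finite {s. f s \<noteq> \<zero>\<^bsub>K\<^esub>} \<and> (\<forall>s. s \<notin> S \<longrightarrow> f s = \<zero>\<^bsub>K\<^esub>)"
  by (auto simp: free_module_def)

lemma free_module_apply [simp]: "f \<in> carrier (free_module K S) \<Longrightarrow> f s \<in> carrier K"
  by (simp add: free_module_mem_iff)

lemma free_module_module:
  assumes "cring K"
  shows "module K (free_module K S)"
proof -
  interpret K: cring K by fact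
  have fin: "finite {s. f s \<oplus>\<^bsub>K\<^esub> g s \<noteq> \<zero>\<^bsub>K\<^esub>}"
    if "finite {s. f s \<noteq> \<zero>\<^bsub>K\<^esub>}" "finite {s. g s \<noteq> \<zero>\<^bsub>K\<^esub>}" for f g
    by (rule finite_subset[OF _ finite_UnI[OF that]]) auto
  have fin2: "finite {s. c \<otimes>\<^bsub>K\<^esub> g s \<noteq> \<zero>\<^bsub>K\<^esub>}"
    if "finite {s. g s \<noteq> \<zero>\<^bsub>K\<^esub>}" "c \<in> carrier K" for c g
    by (rule finite_subset[OF _ that(1)]) (use that(2) in auto)
  have fin3: "finite {s. \<ominus>\<^bsub>K\<^esub> g s \<noteq> \<zero>\<^bsub>K\<^esub>}"
    if "finite {s. g s \<noteq> \<zero>\<^bsub>K\<^esub>}" for g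
    by (rule finite_subset[OF _ that(1)]) auto
  have "abelian_group (free_module K S)"
  proof (rule abelian_groupI)
    fix x assume "x \<in> carrier (free_module K S)"
    then show "\<exists>y\<in>carrier (free_module K S). y \<oplus>\<^bsub>free_module K S\<^esub> x = \<zero>\<^bsub>free_module K S\<^esub>"
      by (intro bexI[of _ "\<lambda>s. \<ominus>\<^bsub>K\<^esub> x s"]) (auto simp: free_module_mem_iff fin3 K.l_neg)
  qed (auto simp: free_module_mem_iff fin K.a_ac)
  then show ?thesis
    by (intro moduleI assms)
       (auto simp: free_module_mem_iff fin2 K.l_distr K.r_distr K.m_assoc)
qed

lemma single_closed:
  assumes "ring K" "s \<in> S"
  shows "single K s \<in> carrier (free_module K S)"
proof -
  interpret ring K by fact
  have "finite {t. single K s t \<noteq> \<zero>\<^bsub>K\<^esub>}"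
    by (rule finite_subset[of _ "{s}"]) (auto simp: single_def)
  then show ?thesis using assms(2) by (auto simp: free_module_mem_iff single_def)
qed

lemma finsum_free_module:
  assumes "cring K" "F \<in> A \<rightarrow> carrier (free_module K S)"
  shows "finsum (free_module K S) F A s = finsum K (\<lambda>x. F x s) A"
proof -
  interpret cring K by fact
  interpret F: module K "free_module K S" by (rule free_module_module[OF assms(1)])
  have "(\<lambda>f. f s) \<in> add_hom (free_module K S) K"
    by (intro add_homI) auto
  from add_hom_finsum[OF this F.abelian_group_axioms abelian_group_axioms assms(2)]
  show ?thesis by simp
qed

lemma free_module_induct [consumes 2, case_names zero add]:
  assumes "cring K" "f \<in> carrier (free_module K S)"
    and "P (\<lambda>s. \<zero>\<^bsub>K\<^esub>)"
    and "\<And>c s f. c \<in> carrier K \<Longrightarrow> s \<in> S \<Longrightarrow> f \<in> carrier (free_module K S) \<Longrightarrow> P f \<Longrightarrow>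
      P (c \<odot>\<^bsub>free_module K S\<^esub> single K s \<oplus>\<^bsub>free_module K S\<^esub> f)"
  shows "P f"
proof -
  interpret cring K by fact
  have "finite {s. f s \<noteq> \<zero>\<^bsub>K\<^esub>}" using assms(2) by (simp add: free_module_mem_iff)
  then have "f \<in> carrier (free_module K S) \<Longrightarrow> P f"
  proof (induction "{s. f s \<noteq> \<zero>\<^bsub>K\<^esub>}" arbitrary: f rule: finite_induct)
    case empty
    then have "f = (\<lambda>s. \<zero>\<^bsub>K\<^esub>)" by auto
    then show ?case using assms(3) by simp
  next
    case (insert x F)
    define g where "g = f(x := \<zero>\<^bsub>K\<^esub>)"
    have x: "f x \<noteq> \<zero>\<^bsub>K\<^esub>" using insert.hyps(4) by auto
    have Feq: "F = {s. g s \<noteq> \<zero>\<^bsub>K\<^esub>}"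
      using insert.hyps(2,4) x unfolding g_def by (auto split: if_splits)
    have g: "g \<in> carrier (free_module K S)"
      using insert.prems insert.hyps(1) Feq by (auto simp: free_module_mem_iff g_def)
    have xS: "x \<in> S" and fx: "f x \<in> carrier K"
      using insert.prems x by (auto simp: free_module_mem_iff)
    have "f = f x \<odot>\<^bsub>free_module K S\<^esub> single K x \<oplus>\<^bsub>free_module K S\<^esub> g"
      using insert.prems by (auto simp: g_def single_def fun_eq_iff free_module_mem_iff)
    then show ?case using assms(4)[OF fx xS g] insert.hyps(3)[OF Feq g] by simp
  qed
  then show ?thesis using assms(2) by simp
qed

text \<open>This is the sum in \<open>tensor_lift\<close> with the representative as an argument, so
  that linearity can be settled before the choice of a representative.\<close>

definition free_lift ::
  "('k, 'e) ring_scheme \<Rightarrow> ('k, 'v, 'm) module_scheme \<Rightarrow> ('s \<Rightarrow> 'v) \<Rightarrow> ('s \<Rightarrow> 'k) \<Rightarrow> 'v"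
  where "free_lift K V \<phi> f = finsum V (\<lambda>s. f s \<odot>\<^bsub>V\<^esub> \<phi> s) {s. f s \<noteq> \<zero>\<^bsub>K\<^esub>}"

text \<open>Points outside the support contribute zero. Additivity needs this in order to sum two
  functions over one common finite set.\<close>

lemma free_lift_superset:
  assumes "module K V" "f \<in> carrier (free_module K S)" "\<phi> \<in> S \<rightarrow> carrier V"
    "finite B" "B \<subseteq> S" "{s. f s \<noteq> \<zero>\<^bsub>K\<^esub>} \<subseteq> B"
  shows "free_lift K V \<phi> f = finsum V (\<lambda>s. f s \<odot>\<^bsub>V\<^esub> \<phi> s) B"
proof -
  interpret module K V by fact
  show ?thesis unfolding free_lift_def
    using assms(2-6)
    by (intro M.add.finprod_mono_neutral_cong_left) (auto simp: Pi_def subset_iff)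
qed

lemma free_lift_hom:
  assumes "module K V" "\<phi> \<in> S \<rightarrow> carrier V"
  shows "free_lift K V \<phi> \<in> left_module_hom K (free_module K S) V"
proof -
  interpret module K V by fact
  have cr: "cring K" by (rule R.cring_axioms)
  interpret F: module K "free_module K S" by (rule free_module_module[OF cr])
  note sup = free_lift_superset[OF assms(1) _ assms(2)]
  have cl: "(\<lambda>s. f s \<odot>\<^bsub>V\<^esub> \<phi> s) \<in> B \<rightarrow> carrier V"
    if "f \<in> carrier (free_module K S)" "B \<subseteq> S" for f B
    using that assms(2) by (auto simp: Pi_def subset_iff)
  have supp: "finite {s. f s \<noteq> \<zero>\<^bsub>K\<^esub>}" "{s. f s \<noteq> \<zero>\<^bsub>K\<^esub>} \<subseteq> S"
    if "f \<in> carrier (free_module K S)" for f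
    using that by (auto simp: free_module_mem_iff)
  show ?thesis
  proof (rule left_module_homI)
    fix f assume f: "f \<in> carrier (free_module K S)"
    show "free_lift K V \<phi> f \<in> carrier V"
      unfolding free_lift_def by (rule M.finsum_closed[OF cl[OF f supp(2)[OF f]]])
  next
    fix f g assume f: "f \<in> carrier (free_module K S)" and g: "g \<in> carrier (free_module K S)"
    define B where "B = {s. f s \<noteq> \<zero>\<^bsub>K\<^esub>} \<union> {s. g s \<noteq> \<zero>\<^bsub>K\<^esub>}"
    have B: "finite B" "B \<subseteq> S" using supp[OF f] supp[OF g] by (auto simp: B_def)
    have fg: "f \<oplus>\<^bsub>free_module K S\<^esub> g \<in> carrier (free_module K S)" using f g by (rule F.add.m_closed)
    have "free_lift K V \<phi> (f \<oplus>\<^bsub>free_module K S\<^esub> g) =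
        finsum V (\<lambda>s. f s \<odot>\<^bsub>V\<^esub> \<phi> s \<oplus>\<^bsub>V\<^esub> g s \<odot>\<^bsub>V\<^esub> \<phi> s) B"
    proof -
      have "{s. (f \<oplus>\<^bsub>free_module K S\<^esub> g) s \<noteq> \<zero>\<^bsub>K\<^esub>} \<subseteq> B"
        by (auto simp: B_def)
      note sup[OF fg B this]
      also have "finsum V (\<lambda>s. (f \<oplus>\<^bsub>free_module K S\<^esub> g) s \<odot>\<^bsub>V\<^esub> \<phi> s) B =
          finsum V (\<lambda>s. f s \<odot>\<^bsub>V\<^esub> \<phi> s \<oplus>\<^bsub>V\<^esub> g s \<odot>\<^bsub>V\<^esub> \<phi> s) B"
      proof (rule M.finsum_cong'[OF refl])
        show "(\<lambda>s. f s \<odot>\<^bsub>V\<^esub> \<phi> s \<oplus>\<^bsub>V\<^esub> g s \<odot>\<^bsub>V\<^esub> \<phi> s) \<in> B \<rightarrow> carrier V"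
          using cl[OF f B(2)] cl[OF g B(2)] by (auto simp: Pi_def)
        fix s assume "s \<in> B"
        then have "\<phi> s \<in> carrier V" using B(2) assms(2) by auto
        then show "(f \<oplus>\<^bsub>free_module K S\<^esub> g) s \<odot>\<^bsub>V\<^esub> \<phi> s = f s \<odot>\<^bsub>V\<^esub> \<phi> s \<oplus>\<^bsub>V\<^esub> g s \<odot>\<^bsub>V\<^esub> \<phi> s"
          using f g by (simp add: smult_l_distr)
      qed
      finally show ?thesis .
    qed
    also have "\<dots> = finsum V (\<lambda>s. f s \<odot>\<^bsub>V\<^esub> \<phi> s) B \<oplus>\<^bsub>V\<^esub> finsum V (\<lambda>s. g s \<odot>\<^bsub>V\<^esub> \<phi> s) B"
      by (rule M.finsum_addf[OF cl[OF f B(2)] cl[OF g B(2)]])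
    also have "\<dots> = free_lift K V \<phi> f \<oplus>\<^bsub>V\<^esub> free_lift K V \<phi> g"
      by (intro arg_cong2[where f = "add V"] sup[OF f B, symmetric] sup[OF g B, symmetric])
        (auto simp: B_def)
    finally show "free_lift K V \<phi> (f \<oplus>\<^bsub>free_module K S\<^esub> g) =
      free_lift K V \<phi> f \<oplus>\<^bsub>V\<^esub> free_lift K V \<phi> g" .
  next
    fix c f assume c: "c \<in> carrier K" and f: "f \<in> carrier (free_module K S)"
    note B = supp[OF f]
    have cf: "c \<odot>\<^bsub>free_module K S\<^esub> f \<in> carrier (free_module K S)" using c f by (rule F.smult_closed)
    have "free_lift K V \<phi> (c \<odot>\<^bsub>free_module K S\<^esub> f) =
        finsum V (\<lambda>s. c \<odot>\<^bsub>V\<^esub> (f s \<odot>\<^bsub>V\<^esub> \<phi> s)) {s. f s \<noteq> \<zero>\<^bsub>K\<^esub>}"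
    proof -
      have "{s. (c \<odot>\<^bsub>free_module K S\<^esub> f) s \<noteq> \<zero>\<^bsub>K\<^esub>} \<subseteq> {s. f s \<noteq> \<zero>\<^bsub>K\<^esub>}"
        using c by auto
      note sup[OF cf B this]
      also have "finsum V (\<lambda>s. (c \<odot>\<^bsub>free_module K S\<^esub> f) s \<odot>\<^bsub>V\<^esub> \<phi> s) {s. f s \<noteq> \<zero>\<^bsub>K\<^esub>} =
          finsum V (\<lambda>s. c \<odot>\<^bsub>V\<^esub> (f s \<odot>\<^bsub>V\<^esub> \<phi> s)) {s. f s \<noteq> \<zero>\<^bsub>K\<^esub>}"
      proof (rule M.finsum_cong'[OF refl])
        show "(\<lambda>s. c \<odot>\<^bsub>V\<^esub> (f s \<odot>\<^bsub>V\<^esub> \<phi> s)) \<in> {s. f s \<noteq> \<zero>\<^bsub>K\<^esub>} \<rightarrow> carrier V"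
          using cl[OF f B(2)] c by (auto simp: Pi_def)
        fix s assume "s \<in> {s. f s \<noteq> \<zero>\<^bsub>K\<^esub>}"
        then have "\<phi> s \<in> carrier V" using B(2) assms(2) by auto
        then show "(c \<odot>\<^bsub>free_module K S\<^esub> f) s \<odot>\<^bsub>V\<^esub> \<phi> s = c \<odot>\<^bsub>V\<^esub> (f s \<odot>\<^bsub>V\<^esub> \<phi> s)"
          using f c by (simp add: smult_assoc1)
      qed
      finally show ?thesis .
    qed
    then show "free_lift K V \<phi> (c \<odot>\<^bsub>free_module K S\<^esub> f) = c \<odot>\<^bsub>V\<^esub> free_lift K V \<phi> f"
      using finsum_smult_ldistr[OF B(1) c cl[OF f B(2)]] by (simp add: free_lift_def)
  qed
qed

lemma free_lift_single:
  assumes "module K V" "\<phi> \<in> S \<rightarrow> carrier V" "s \<in> S"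
  shows "free_lift K V \<phi> (single K s) = \<phi> s"
proof -
  interpret module K V by fact
  have "free_lift K V \<phi> (single K s) = finsum V (\<lambda>t. single K s t \<odot>\<^bsub>V\<^esub> \<phi> t) {s}"
    using assms(3)
    by (intro free_lift_superset[OF assms(1) single_closed[OF R.ring_axioms assms(3)] assms(2)])
       (auto simp: single_def)
  also have "\<dots> = \<phi> s" using assms(2,3) by (auto simp: single_def M.finsum_insert Pi_def)
  finally show ?thesis .
qed

section \<open>Quotient modules\<close>

lemma submodule_abelian_subgroup:
  assumes "module K M" "submodule N K M"
  shows "abelian_subgroup N M"
  using assms
  by (intro abelian_subgroupI3 additive_subgroup.intro) (auto simp: module_def submodule_def)

lemma quotient_module_simps [simp]:
  "zero (quotient_module M N) = N"
  "add (quotient_module M N) = set_add M"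
  "carrier (quotient_module M N) = a_rcosets\<^bsub>M\<^esub> N"
  by (simp_all add: quotient_module_def)

lemma quotient_module_cases:
  assumes "X \<in> carrier (quotient_module M N)"
  obtains x where "x \<in> carrier M" "X = N +>\<^bsub>M\<^esub> x"
  using assms by (auto simp: A_RCOSETS_def' a_r_coset_def')

lemma quotient_module_smult:
  assumes "module K M" "submodule N K M" "c \<in> carrier K" "x \<in> carrier M"
  shows "c \<odot>\<^bsub>quotient_module M N\<^esub> (N +>\<^bsub>M\<^esub> x) = N +>\<^bsub>M\<^esub> (c \<odot>\<^bsub>M\<^esub> x)"
proof -
  interpret module K M by fact
  interpret N: abelian_subgroup N M by (rule submodule_abelian_subgroup[OF assms(1,2)])
  have "N +>\<^bsub>M\<^esub> (c \<odot>\<^bsub>M\<^esub> y) = N +>\<^bsub>M\<^esub> (c \<odot>\<^bsub>M\<^esub> x)" if y: "y \<in> N +>\<^bsub>M\<^esub> x" for y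
  proof -
    obtain \<nu> where \<nu>: "\<nu> \<in> N" "y = \<nu> \<oplus>\<^bsub>M\<^esub> x" using y by (auto simp: a_r_coset_def')
    have "c \<odot>\<^bsub>M\<^esub> \<nu> \<in> N" using assms(2,3) \<nu>(1) by (auto simp: submodule_iff[OF M.abelian_group_axioms])
    moreover have "c \<odot>\<^bsub>M\<^esub> y = c \<odot>\<^bsub>M\<^esub> \<nu> \<oplus>\<^bsub>M\<^esub> c \<odot>\<^bsub>M\<^esub> x"
      using \<nu> assms(3,4) by (simp add: smult_r_distr)
    ultimately have "c \<odot>\<^bsub>M\<^esub> y \<in> N +>\<^bsub>M\<^esub> (c \<odot>\<^bsub>M\<^esub> x)" by (auto simp: a_r_coset_def')
    then show ?thesis using N.a_repr_independence' assms(3,4) by auto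
  qed
  then have "(\<Union>y\<in>N +>\<^bsub>M\<^esub> x. N +>\<^bsub>M\<^esub> (c \<odot>\<^bsub>M\<^esub> y)) = (\<Union>y\<in>N +>\<^bsub>M\<^esub> x. N +>\<^bsub>M\<^esub> (c \<odot>\<^bsub>M\<^esub> x))"
    by (intro SUP_cong refl)
  also have "\<dots> = N +>\<^bsub>M\<^esub> (c \<odot>\<^bsub>M\<^esub> x)" using N.a_rcos_self[OF assms(4)] by blast
  finally show ?thesis by (simp add: quotient_module_def)
qed

lemma quotient_module_module:
  assumes "module K M" "submodule N K M"
  shows "module K (quotient_module M N)"
proof -
  interpret module K M by fact
  interpret N: abelian_subgroup N M by (rule submodule_abelian_subgroup[OF assms])
  have cl: "N +>\<^bsub>M\<^esub> x \<in> carrier (quotient_module M N)" if "x \<in> carrier M" for x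
    using M.a_rcosetsI[OF N.a_subset that] by simp
  have zero: "N +>\<^bsub>M\<^esub> \<zero>\<^bsub>M\<^esub> = N" using M.a_coset_add_zero[OF N.a_subset] .
  note su = N.a_rcos_sum
  have "abelian_group (quotient_module M N)"
  proof (rule abelian_groupI)
    show "\<zero>\<^bsub>quotient_module M N\<^esub> \<in> carrier (quotient_module M N)"
      using cl[of "\<zero>\<^bsub>M\<^esub>"] zero by simp
    fix x assume "x \<in> carrier (quotient_module M N)"
    then obtain a where a: "a \<in> carrier M" "x = N +>\<^bsub>M\<^esub> a" by (rule quotient_module_cases)
    show "\<zero>\<^bsub>quotient_module M N\<^esub> \<oplus>\<^bsub>quotient_module M N\<^esub> x = x"
      using su[OF M.zero_closed a(1)] a zero by simp
    show "\<exists>y\<in>carrier (quotient_module M N). y \<oplus>\<^bsub>quotient_module M N\<^esub> x = \<zero>\<^bsub>quotient_module M N\<^esub>"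
      using su[of "\<ominus>\<^bsub>M\<^esub> a" a] a zero M.l_neg[OF a(1)] by (intro bexI[OF _ cl[of "\<ominus>\<^bsub>M\<^esub> a"]]) auto
  qed (auto elim!: quotient_module_cases simp del: quotient_module_simps(3)
        simp: su cl M.a_ac)
  note sm = quotient_module_smult[OF assms]
  from \<open>abelian_group (quotient_module M N)\<close> show ?thesis
    apply (intro moduleI R.cring_axioms)
    by (auto elim!: quotient_module_cases simp del: quotient_module_simps(3)
        simp: sm su cl smult_l_distr smult_r_distr smult_assoc1)
qed

section \<open>Tensor products\<close>

definition bilinear ::
  "('k, 'e) ring_scheme \<Rightarrow> ('k, 'a, 'm) module_scheme \<Rightarrow> ('k, 'b, 'n) module_scheme \<Rightarrow>
    ('k, 'v, 'p) module_scheme \<Rightarrow> ('a \<Rightarrow> 'b \<Rightarrow> 'v) \<Rightarrow> bool"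
  where "bilinear K M N V \<beta> \<longleftrightarrow>
    (\<forall>b\<in>carrier N. (\<lambda>a. \<beta> a b) \<in> left_module_hom K M V) \<and>
    (\<forall>a\<in>carrier M. \<beta> a \<in> left_module_hom K N V)"

lemma bilinearI:
  assumes "\<And>b. b \<in> carrier N \<Longrightarrow> (\<lambda>a. \<beta> a b) \<in> left_module_hom K M V"
    and "\<And>a. a \<in> carrier M \<Longrightarrow> \<beta> a \<in> left_module_hom K N V"
  shows "bilinear K M N V \<beta>"
  using assms by (auto simp: bilinear_def)

lemma bilinear_left: "bilinear K M N V \<beta> \<Longrightarrow> b \<in> carrier N \<Longrightarrow> (\<lambda>a. \<beta> a b) \<in> left_module_hom K M V"
  by (auto simp: bilinear_def)

lemma bilinear_right: "bilinear K M N V \<beta> \<Longrightarrow> a \<in> carrier M \<Longrightarrow> \<beta> a \<in> left_module_hom K N V"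
  by (auto simp: bilinear_def)

lemma bilinear_closed:
  "bilinear K M N V \<beta> \<Longrightarrow> a \<in> carrier M \<Longrightarrow> b \<in> carrier N \<Longrightarrow> \<beta> a b \<in> carrier V"
  by (auto simp: bilinear_def left_module_hom_def)

lemma bilinear_add_left:
  "bilinear K M N V \<beta> \<Longrightarrow> a \<in> carrier M \<Longrightarrow> a' \<in> carrier M \<Longrightarrow> b \<in> carrier N \<Longrightarrow>
    \<beta> (a \<oplus>\<^bsub>M\<^esub> a') b = \<beta> a b \<oplus>\<^bsub>V\<^esub> \<beta> a' b"
  by (auto simp: bilinear_def left_module_hom_def)

lemma bilinear_add_right:
  "bilinear K M N V \<beta> \<Longrightarrow> a \<in> carrier M \<Longrightarrow> b \<in> carrier N \<Longrightarrow> b' \<in> carrier N \<Longrightarrow>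
    \<beta> a (b \<oplus>\<^bsub>N\<^esub> b') = \<beta> a b \<oplus>\<^bsub>V\<^esub> \<beta> a b'"
  by (auto simp: bilinear_def left_module_hom_def)

lemma bilinear_smult_left:
  "bilinear K M N V \<beta> \<Longrightarrow> c \<in> carrier K \<Longrightarrow> a \<in> carrier M \<Longrightarrow> b \<in> carrier N \<Longrightarrow>
    \<beta> (c \<odot>\<^bsub>M\<^esub> a) b = c \<odot>\<^bsub>V\<^esub> \<beta> a b"
  by (auto simp: bilinear_def left_module_hom_def)

lemma bilinear_smult_right:
  "bilinear K M N V \<beta> \<Longrightarrow> c \<in> carrier K \<Longrightarrow> a \<in> carrier M \<Longrightarrow> b \<in> carrier N \<Longrightarrow>
    \<beta> a (c \<odot>\<^bsub>N\<^esub> b) = c \<odot>\<^bsub>V\<^esub> \<beta> a b"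
  by (auto simp: bilinear_def left_module_hom_def)

lemma bilinear_compose:
  assumes "bilinear K M' N' V \<beta>" "f \<in> left_module_hom K M M'" "g \<in> left_module_hom K N N'"
  shows "bilinear K M N V (\<lambda>a b. \<beta> (f a) (g b))"
  using assms
  by (auto simp: bilinear_def left_module_hom_def Pi_def)

lemma bilinear_postcompose:
  assumes "bilinear K M N V \<beta>" "h \<in> left_module_hom K V W"
  shows "bilinear K M N W (\<lambda>a b. h (\<beta> a b))"
  using assms
  by (auto simp: bilinear_def left_module_hom_def Pi_def)

abbreviation (input) pair_module ::
  "('k, 'e) ring_scheme \<Rightarrow> ('k, 'a, 'm) module_scheme \<Rightarrow> ('k, 'b, 'n) module_scheme \<Rightarrow>
    ('k, 'a \<times> 'b \<Rightarrow> 'k) module"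
  where "pair_module K M N \<equiv> free_module K (carrier M \<times> carrier N)"

lemma tensor_relations_minimal:
  assumes "submodule H K (pair_module K M N)"
    and "\<And>a a' b. a \<in> carrier M \<Longrightarrow> a' \<in> carrier M \<Longrightarrow> b \<in> carrier N \<Longrightarrow>
      single K (a \<oplus>\<^bsub>M\<^esub> a', b) \<ominus>\<^bsub>pair_module K M N\<^esub> (single K (a, b) \<oplus>\<^bsub>pair_module K M N\<^esub> single K (a', b)) \<in> H"
    and "\<And>a b b'. a \<in> carrier M \<Longrightarrow> b \<in> carrier N \<Longrightarrow> b' \<in> carrier N \<Longrightarrow>
      single K (a, b \<oplus>\<^bsub>N\<^esub> b') \<ominus>\<^bsub>pair_module K M N\<^esub> (single K (a, b) \<oplus>\<^bsub>pair_module K M N\<^esub> single K (a, b')) \<in> H"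
    and "\<And>c a b. c \<in> carrier K \<Longrightarrow> a \<in> carrier M \<Longrightarrow> b \<in> carrier N \<Longrightarrow>
      single K (c \<odot>\<^bsub>M\<^esub> a, b) \<ominus>\<^bsub>pair_module K M N\<^esub> c \<odot>\<^bsub>pair_module K M N\<^esub> single K (a, b) \<in> H"
    and "\<And>c a b. c \<in> carrier K \<Longrightarrow> a \<in> carrier M \<Longrightarrow> b \<in> carrier N \<Longrightarrow>
      single K (a, c \<odot>\<^bsub>N\<^esub> b) \<ominus>\<^bsub>pair_module K M N\<^esub> c \<odot>\<^bsub>pair_module K M N\<^esub> single K (a, b) \<in> H"
  shows "tensor_relations K M N \<subseteq> H"
  unfolding tensor_relations_def Let_def
  by (rule generated_submodule_minimal[OF assms(1)]) (use assms(2-5) in blast)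

context
  fixes K :: "('k, 'e) ring_scheme" and M :: "('k, 'a, 'm) module_scheme"
    and N :: "('k, 'b, 'n) module_scheme"
  assumes MN: "module K M" "module K N"
begin

interpretation M: module K M by (rule MN)
interpretation N: module K N by (rule MN)

private abbreviation (input) "F \<equiv> pair_module K M N"

interpretation F: module K F
  by (rule free_module_module[OF M.R.cring_axioms])

lemma single_pair_closed:
  "a \<in> carrier M \<Longrightarrow> b \<in> carrier N \<Longrightarrow> single K (a, b) \<in> carrier F"
  by (rule single_closed[OF M.R.ring_axioms]) simp

lemma tensor_relations_submodule: "submodule (tensor_relations K M N) K F"
  unfolding tensor_relations_def Let_def
  by (rule generated_submodule_submodule[OF F.module_axioms])
    (auto intro!: F.M.minus_closed F.M.a_closed F.smult_closed single_pair_closed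
      simp del: free_module_simps)

lemma tensor_relations_mem:
  shows "a \<in> carrier M \<Longrightarrow> a' \<in> carrier M \<Longrightarrow> b \<in> carrier N \<Longrightarrow>
      single K (a \<oplus>\<^bsub>M\<^esub> a', b) \<ominus>\<^bsub>F\<^esub> (single K (a, b) \<oplus>\<^bsub>F\<^esub> single K (a', b)) \<in> tensor_relations K M N"
    and "a \<in> carrier M \<Longrightarrow> b \<in> carrier N \<Longrightarrow> b' \<in> carrier N \<Longrightarrow>
      single K (a, b \<oplus>\<^bsub>N\<^esub> b') \<ominus>\<^bsub>F\<^esub> (single K (a, b) \<oplus>\<^bsub>F\<^esub> single K (a, b')) \<in> tensor_relations K M N"
    and "c \<in> carrier K \<Longrightarrow> a \<in> carrier M \<Longrightarrow> b \<in> carrier N \<Longrightarrow>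
      single K (c \<odot>\<^bsub>M\<^esub> a, b) \<ominus>\<^bsub>F\<^esub> c \<odot>\<^bsub>F\<^esub> single K (a, b) \<in> tensor_relations K M N"
    and "c \<in> carrier K \<Longrightarrow> a \<in> carrier M \<Longrightarrow> b \<in> carrier N \<Longrightarrow>
      single K (a, c \<odot>\<^bsub>N\<^esub> b) \<ominus>\<^bsub>F\<^esub> c \<odot>\<^bsub>F\<^esub> single K (a, b) \<in> tensor_relations K M N"
  unfolding tensor_relations_def Let_def
  by (rule subsetD[OF generated_submodule_incl], blast)+

interpretation S: abelian_subgroup "tensor_relations K M N" F
  by (rule submodule_abelian_subgroup[OF F.module_axioms tensor_relations_submodule])

lemma tensor_module: "module K (tensor K M N)"
  unfolding tensor_def by (rule quotient_module_module[OF F.module_axioms tensor_relations_submodule])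

interpretation T: module K "tensor K M N" by (rule tensor_module)

lemma pure_tensor_closed:
  assumes "a \<in> carrier M" "b \<in> carrier N"
  shows "pure_tensor K M N a b \<in> carrier (tensor K M N)"
  using F.M.a_rcosetsI[OF S.a_subset single_pair_closed[OF assms]]
  by (simp add: tensor_def pure_tensor_def)

lemma tensor_coset_eqI:
  assumes "x \<in> carrier F" "y \<in> carrier F" "x \<ominus>\<^bsub>F\<^esub> y \<in> tensor_relations K M N"
  shows "tensor_relations K M N +>\<^bsub>F\<^esub> x = tensor_relations K M N +>\<^bsub>F\<^esub> y"
  by (metis S.a_rcos_module S.a_repr_independence' F.M.minus_eq assms)

lemma tensor_coset_add:
  assumes "x \<in> carrier F" "y \<in> carrier F"
  shows "tensor_relations K M N +>\<^bsub>F\<^esub> (x \<oplus>\<^bsub>F\<^esub> y) =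
    (tensor_relations K M N +>\<^bsub>F\<^esub> x) \<oplus>\<^bsub>tensor K M N\<^esub> (tensor_relations K M N +>\<^bsub>F\<^esub> y)"
  using S.a_rcos_sum[OF assms] by (simp add: tensor_def)

lemma tensor_coset_smult:
  assumes "c \<in> carrier K" "x \<in> carrier F"
  shows "tensor_relations K M N +>\<^bsub>F\<^esub> (c \<odot>\<^bsub>F\<^esub> x) =
    c \<odot>\<^bsub>tensor K M N\<^esub> (tensor_relations K M N +>\<^bsub>F\<^esub> x)"
  unfolding tensor_def
  using quotient_module_smult[OF F.module_axioms tensor_relations_submodule assms] by simp

lemma pure_tensor_bilinear: "bilinear K M N (tensor K M N) (pure_tensor K M N)"
proof (rule bilinearI; rule left_module_homI)
  note sg = single_pair_closed
  note cl = F.M.a_closed F.smult_closed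
  {
    fix a b assume "a \<in> carrier M" "b \<in> carrier N"
    then show "pure_tensor K M N a b \<in> carrier (tensor K M N)"
      "pure_tensor K M N a b \<in> carrier (tensor K M N)" by (auto intro: pure_tensor_closed)
  next
    fix a a' b assume ab: "a \<in> carrier M" "a' \<in> carrier M" "b \<in> carrier N"
    show "pure_tensor K M N (a \<oplus>\<^bsub>M\<^esub> a') b =
        pure_tensor K M N a b \<oplus>\<^bsub>tensor K M N\<^esub> pure_tensor K M N a' b"
      unfolding pure_tensor_def tensor_coset_add[OF sg[OF ab(1,3)] sg[OF ab(2,3)], symmetric]
      by (rule tensor_coset_eqI[OF _ _ tensor_relations_mem(1)[OF ab]])
         (use ab in \<open>auto intro!: sg cl simp del: free_module_simps\<close>)
  next
    fix a b b' assume ab: "a \<in> carrier M" "b \<in> carrier N" "b' \<in> carrier N"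
    show "pure_tensor K M N a (b \<oplus>\<^bsub>N\<^esub> b') =
        pure_tensor K M N a b \<oplus>\<^bsub>tensor K M N\<^esub> pure_tensor K M N a b'"
      unfolding pure_tensor_def tensor_coset_add[OF sg[OF ab(1,2)] sg[OF ab(1,3)], symmetric]
      by (rule tensor_coset_eqI[OF _ _ tensor_relations_mem(2)[OF ab]])
         (use ab in \<open>auto intro!: sg cl simp del: free_module_simps\<close>)
  next
    fix c a b assume ab: "c \<in> carrier K" "a \<in> carrier M" "b \<in> carrier N"
    show "pure_tensor K M N (c \<odot>\<^bsub>M\<^esub> a) b = c \<odot>\<^bsub>tensor K M N\<^esub> pure_tensor K M N a b"
      unfolding pure_tensor_def tensor_coset_smult[OF ab(1) sg[OF ab(2,3)], symmetric]
      by (rule tensor_coset_eqI[OF _ _ tensor_relations_mem(3)[OF ab]])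
         (use ab in \<open>auto intro!: sg cl simp del: free_module_simps\<close>)
    show "pure_tensor K M N a (c \<odot>\<^bsub>N\<^esub> b) = c \<odot>\<^bsub>tensor K M N\<^esub> pure_tensor K M N a b"
      unfolding pure_tensor_def tensor_coset_smult[OF ab(1) sg[OF ab(2,3)], symmetric]
      by (rule tensor_coset_eqI[OF _ _ tensor_relations_mem(4)[OF ab]])
         (use ab in \<open>auto intro!: sg cl simp del: free_module_simps\<close>)
  }
qed

lemma tensor_cases:
  assumes "X \<in> carrier (tensor K M N)"
  obtains f where "f \<in> carrier F" "X = tensor_relations K M N +>\<^bsub>F\<^esub> f"
  using assms unfolding tensor_def by (rule quotient_module_cases)

text \<open>Zero and scalar multiples need no case: zero is the pure tensor of two zeros, and a
  scalar is absorbed into the left entry of a pure tensor.\<close>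

lemma tensor_induct [consumes 1, case_names pure add]:
  assumes X: "X \<in> carrier (tensor K M N)"
    and pure: "\<And>a b. a \<in> carrier M \<Longrightarrow> b \<in> carrier N \<Longrightarrow> P (pure_tensor K M N a b)"
    and add: "\<And>x y. x \<in> carrier (tensor K M N) \<Longrightarrow> y \<in> carrier (tensor K M N) \<Longrightarrow> P x \<Longrightarrow> P y \<Longrightarrow>
      P (x \<oplus>\<^bsub>tensor K M N\<^esub> y)"
  shows "P X"
proof -
  have coset: "tensor_relations K M N +>\<^bsub>F\<^esub> f \<in> carrier (tensor K M N)" if "f \<in> carrier F" for f
    using F.M.a_rcosetsI[OF S.a_subset that] by (simp add: tensor_def)
  have "P (tensor_relations K M N +>\<^bsub>F\<^esub> f)" if "f \<in> carrier F" for f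
    using M.R.cring_axioms that
  proof (induction f rule: free_module_induct)
    case zero
    have "pure_tensor K M N (\<zero>\<^bsub>K\<^esub> \<odot>\<^bsub>M\<^esub> \<zero>\<^bsub>M\<^esub>) \<zero>\<^bsub>N\<^esub> = \<zero>\<^bsub>tensor K M N\<^esub>"
      using bilinear_smult_left[OF pure_tensor_bilinear, of "\<zero>\<^bsub>K\<^esub>" "\<zero>\<^bsub>M\<^esub>" "\<zero>\<^bsub>N\<^esub>"]
        pure_tensor_closed[of "\<zero>\<^bsub>M\<^esub>" "\<zero>\<^bsub>N\<^esub>"] by simp
    then have "P \<zero>\<^bsub>tensor K M N\<^esub>" using pure[of "\<zero>\<^bsub>M\<^esub>" "\<zero>\<^bsub>N\<^esub>"] by simp
    moreover have "tensor_relations K M N +>\<^bsub>F\<^esub> \<zero>\<^bsub>F\<^esub> = \<zero>\<^bsub>tensor K M N\<^esub>"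
      unfolding tensor_def using F.M.a_coset_add_zero[OF S.a_subset] by simp
    ultimately show ?case by simp
  next
    case (add c s f)
    obtain a b where s: "s = (a, b)" "a \<in> carrier M" "b \<in> carrier N" using add.hyps(2) by auto
    note sg = single_pair_closed[OF s(2,3)]
    have "P (c \<odot>\<^bsub>tensor K M N\<^esub> pure_tensor K M N a b)"
      using pure[of "c \<odot>\<^bsub>M\<^esub> a" b] s add.hyps(1)
      by (simp add: bilinear_smult_left[OF pure_tensor_bilinear])
    then show ?case
      using assms(3)[OF _ coset[OF add.hyps(3)] _ add.IH] add.hyps(1) s sg
        pure_tensor_closed[OF s(2,3)]
      by (simp add: tensor_coset_add[OF F.smult_closed[OF add.hyps(1) sg] add.hyps(3)]
          tensor_coset_smult pure_tensor_def del: free_module_simps)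
  qed
  then show ?thesis using X by (metis tensor_cases)
qed

context
  fixes V :: "('k, 'v, 'p) module_scheme" and \<beta> :: "'a \<Rightarrow> 'b \<Rightarrow> 'v"
  assumes V: "module K V" and \<beta>: "bilinear K M N V \<beta>"
begin

interpretation V: module K V by (rule V)

private abbreviation (input) "lift \<equiv> free_lift K V (\<lambda>p. \<beta> (fst p) (snd p))"

lemma bilinear_fun: "(\<lambda>p. \<beta> (fst p) (snd p)) \<in> carrier M \<times> carrier N \<rightarrow> carrier V"
  using bilinear_closed[OF \<beta>] by auto

text \<open>Bilinearity of \<beta> puts the four families of relations into the kernel of the linear
  extension, and the kernel is a submodule. Hence \<open>tensor_lift\<close> will not depend on the
  representative.\<close>

lemma tensor_relations_lift_zero:
  assumes "f \<in> tensor_relations K M N"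
  shows "lift f = \<zero>\<^bsub>V\<^esub>"
proof -
  note h = free_lift_hom[OF V bilinear_fun]
  note sg = single_pair_closed
  have sv: "lift (single K (a, b)) = \<beta> a b" if "a \<in> carrier M" "b \<in> carrier N" for a b
    using free_lift_single[OF V bilinear_fun, of "(a, b)"] that by simp
  have diff: "x \<ominus>\<^bsub>F\<^esub> y \<in> {x \<in> carrier F. lift x = \<zero>\<^bsub>V\<^esub>}"
    if "x \<in> carrier F" "y \<in> carrier F" "lift x = lift y" for x y
    using that add_hom_diff[OF left_module_hom_add_hom[OF h] F.M.abelian_group_axioms
        V.M.abelian_group_axioms that(1,2)] left_module_hom_closed[OF h that(2)]
      F.M.minus_closed[OF that(1,2)] V.M.r_neg
    by (simp add: a_minus_def)
  have "tensor_relations K M N \<subseteq> {x \<in> carrier F. lift x = \<zero>\<^bsub>V\<^esub>}"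
    by (rule tensor_relations_minimal[OF kernel_submodule[OF F.module_axioms V h]])
      (rule diff; (auto intro!: sg F.M.a_closed F.smult_closed
        simp: left_module_hom_add[OF h sg sg] left_module_hom_smult[OF h _ sg] sv
          bilinear_add_left[OF \<beta>] bilinear_add_right[OF \<beta>]
          bilinear_smult_left[OF \<beta>] bilinear_smult_right[OF \<beta>]
        simp del: free_module_simps; fail))+
  then show ?thesis using assms by auto
qed

lemma tensor_lift_coset:
  assumes "f \<in> carrier F"
  shows "tensor_lift K V \<beta> (tensor_relations K M N +>\<^bsub>F\<^esub> f) = lift f"
proof -
  let ?X = "tensor_relations K M N +>\<^bsub>F\<^esub> f"
  have "(SOME r. r \<in> ?X) \<in> ?X" by (rule someI[where P = "\<lambda>r. r \<in> ?X", OF S.a_rcos_self[OF assms]])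
  then obtain \<nu> where \<nu>: "\<nu> \<in> tensor_relations K M N" "(SOME r. r \<in> ?X) = \<nu> \<oplus>\<^bsub>F\<^esub> f"
    unfolding a_r_coset_def' by blast
  have "tensor_lift K V \<beta> ?X = lift (SOME r. r \<in> ?X)"
    by (simp add: tensor_lift_def Let_def free_lift_def)
  also have "\<dots> = lift \<nu> \<oplus>\<^bsub>V\<^esub> lift f"
    unfolding \<nu>(2)
    by (rule left_module_hom_add[OF free_lift_hom[OF V bilinear_fun] S.a_Hcarr[OF \<nu>(1)] assms])
  also have "\<dots> = lift f"
    using tensor_relations_lift_zero[OF \<nu>(1)] left_module_hom_closed[OF free_lift_hom[OF V bilinear_fun] assms]
    by simp
  finally show ?thesis .
qed

lemma tensor_lift_pure:
  assumes "a \<in> carrier M" "b \<in> carrier N"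
  shows "tensor_lift K V \<beta> (pure_tensor K M N a b) = \<beta> a b"
  using free_lift_single[OF V bilinear_fun, of "(a, b)"] assms
  unfolding pure_tensor_def tensor_lift_coset[OF single_pair_closed[OF assms]] by simp

lemma tensor_lift_hom: "tensor_lift K V \<beta> \<in> left_module_hom K (tensor K M N) V"
proof (rule left_module_homI)
  note h = free_lift_hom[OF V bilinear_fun]
  fix X assume "X \<in> carrier (tensor K M N)"
  then obtain f where f: "f \<in> carrier F" "X = tensor_relations K M N +>\<^bsub>F\<^esub> f" by (rule tensor_cases)
  then show "tensor_lift K V \<beta> X \<in> carrier V"
    using left_module_hom_closed[OF h] by (simp add: tensor_lift_coset)
  show "tensor_lift K V \<beta> (c \<odot>\<^bsub>tensor K M N\<^esub> X) = c \<odot>\<^bsub>V\<^esub> tensor_lift K V \<beta> X"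
    if "c \<in> carrier K" for c
    unfolding f(2) tensor_coset_smult[OF that f(1), symmetric] tensor_lift_coset[OF f(1)]
      tensor_lift_coset[OF F.smult_closed[OF that f(1)]]
    by (rule left_module_hom_smult[OF h that f(1)])
  fix Y assume "Y \<in> carrier (tensor K M N)"
  then obtain g where g: "g \<in> carrier F" "Y = tensor_relations K M N +>\<^bsub>F\<^esub> g" by (rule tensor_cases)
  show "tensor_lift K V \<beta> (X \<oplus>\<^bsub>tensor K M N\<^esub> Y) = tensor_lift K V \<beta> X \<oplus>\<^bsub>V\<^esub> tensor_lift K V \<beta> Y"
    unfolding f(2) g(2) tensor_coset_add[OF f(1) g(1), symmetric] tensor_lift_coset[OF f(1)]
      tensor_lift_coset[OF g(1)] tensor_lift_coset[OF F.M.a_closed[OF f(1) g(1)]]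
    by (rule left_module_hom_add[OF h f(1) g(1)])
qed

end

text \<open>Pure tensors generate the tensor product already as an abelian group, so additivity of
  both maps is enough.\<close>

lemma tensor_add_hom_eq:
  assumes "f \<in> add_hom (tensor K M N) V" "g \<in> add_hom (tensor K M N) V"
    and "\<And>a b. a \<in> carrier M \<Longrightarrow> b \<in> carrier N \<Longrightarrow>
      f (pure_tensor K M N a b) = g (pure_tensor K M N a b)"
    and "x \<in> carrier (tensor K M N)"
  shows "f x = g x"
  using assms(4)
  by (induction x rule: tensor_induct)
    (auto simp: assms(3) add_hom_add[OF assms(1)] add_hom_add[OF assms(2)])

end

text \<open>A trilinear map stays linear in its third variable after the first two are merged into a
  tensor: for a fixed scalar or a fixed sum in the third variable, both sides are additive in
  \<open>t\<close> and agree on pure tensors. Iterated tensor products and the multiplication of a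
  tensor product of algebras are built on this.\<close>

lemma tensor_lift_bilinear:
  assumes M: "module K M" and N: "module K N" and B: "module K B" and V: "module K V"
    and 1: "\<And>b. b \<in> carrier B \<Longrightarrow> bilinear K M N V (\<lambda>a u. \<gamma> a u b)"
    and 2: "\<And>a u. a \<in> carrier M \<Longrightarrow> u \<in> carrier N \<Longrightarrow> (\<lambda>b. \<gamma> a u b) \<in> left_module_hom K B V"
  shows "bilinear K (tensor K M N) B V (\<lambda>t b. tensor_lift K V (\<lambda>a u. \<gamma> a u b) t)"
proof (rule bilinearI)
  note h = tensor_lift_hom[OF M N V 1]
  fix b assume b: "b \<in> carrier B"
  then show "tensor_lift K V (\<lambda>a u. \<gamma> a u b) \<in> left_module_hom K (tensor K M N) V" by (rule h)
next
  interpret T: module K "tensor K M N" by (rule tensor_module[OF M N])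
  interpret V: module K V by fact
  interpret B: module K B by fact
  note h = tensor_lift_hom[OF M N V 1]
  note ha = left_module_hom_add_hom[OF h]
  note p = tensor_lift_pure[OF M N V 1]
  fix t assume t: "t \<in> carrier (tensor K M N)"
  show "(\<lambda>b. tensor_lift K V (\<lambda>a u. \<gamma> a u b) t) \<in> left_module_hom K B V"
  proof (rule left_module_homI)
    fix b assume b: "b \<in> carrier B"
    show "tensor_lift K V (\<lambda>a u. \<gamma> a u b) t \<in> carrier V"
      by (rule left_module_hom_closed[OF h[OF b] t])
    show "tensor_lift K V (\<lambda>a u. \<gamma> a u (c \<odot>\<^bsub>B\<^esub> b)) t = c \<odot>\<^bsub>V\<^esub> tensor_lift K V (\<lambda>a u. \<gamma> a u b) t"
      if c: "c \<in> carrier K" for c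
      by (rule tensor_add_hom_eq[OF M N ha[OF B.smult_closed[OF c b]]
            left_module_hom_add_hom[OF left_module_hom_scale[OF T.module_axioms V h[OF b] c]] _ t])
         (simp add: p b c left_module_hom_smult[OF 2 c b])
    fix b' assume b': "b' \<in> carrier B"
    show "tensor_lift K V (\<lambda>a u. \<gamma> a u (b \<oplus>\<^bsub>B\<^esub> b')) t =
        tensor_lift K V (\<lambda>a u. \<gamma> a u b) t \<oplus>\<^bsub>V\<^esub> tensor_lift K V (\<lambda>a u. \<gamma> a u b') t"
      by (rule tensor_add_hom_eq[OF M N ha[OF B.M.a_closed[OF b b']]
            left_module_hom_add_hom[OF left_module_hom_plus[OF T.module_axioms V h[OF b] h[OF b']]] _ t])
         (simp add: p b b' left_module_hom_add[OF 2 b b'])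
  qed
qed

section \<open>Algebras and bimodules\<close>

locale assoc_algebra = M: module K A + A: ring A
  for K :: "('k, 'e) ring_scheme" and A :: "('k, 'a, 'm) module_scheme" +
  assumes mult_bilinear: "bilinear K A A A (mult A)"

text \<open>Both distributive laws are part of bilinearity, so only the unit laws and associativity
  remain to be checked.\<close>

lemma ring_of_bilinear_mult:
  assumes "module K A" "bilinear K A A A (mult A)" "\<one>\<^bsub>A\<^esub> \<in> carrier A"
    and "\<And>x. x \<in> carrier A \<Longrightarrow> \<one>\<^bsub>A\<^esub> \<otimes>\<^bsub>A\<^esub> x = x" "\<And>x. x \<in> carrier A \<Longrightarrow> x \<otimes>\<^bsub>A\<^esub> \<one>\<^bsub>A\<^esub> = x"
    and "\<And>x y z. x \<in> carrier A \<Longrightarrow> y \<in> carrier A \<Longrightarrow> z \<in> carrier A \<Longrightarrow>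
      (x \<otimes>\<^bsub>A\<^esub> y) \<otimes>\<^bsub>A\<^esub> z = x \<otimes>\<^bsub>A\<^esub> (y \<otimes>\<^bsub>A\<^esub> z)"
  shows "assoc_algebra K A"
proof -
  interpret module K A by fact
  have "ring A"
    by (intro ringI monoidI M.abelian_group_axioms)
       (auto simp: assms bilinear_closed[OF assms(2)] bilinear_add_left[OF assms(2)]
          bilinear_add_right[OF assms(2)])
  then show ?thesis using assms(1,2) by (simp add: assoc_algebra_def assoc_algebra_axioms_def)
qed

context assoc_algebra
begin

lemma mult_smult_left:
  "c \<in> carrier K \<Longrightarrow> x \<in> carrier A \<Longrightarrow> y \<in> carrier A \<Longrightarrow> (c \<odot>\<^bsub>A\<^esub> x) \<otimes>\<^bsub>A\<^esub> y = c \<odot>\<^bsub>A\<^esub> (x \<otimes>\<^bsub>A\<^esub> y)"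
  by (rule bilinear_smult_left[OF mult_bilinear])

lemma mult_smult_right:
  "c \<in> carrier K \<Longrightarrow> x \<in> carrier A \<Longrightarrow> y \<in> carrier A \<Longrightarrow> x \<otimes>\<^bsub>A\<^esub> (c \<odot>\<^bsub>A\<^esub> y) = c \<odot>\<^bsub>A\<^esub> (x \<otimes>\<^bsub>A\<^esub> y)"
  by (rule bilinear_smult_right[OF mult_bilinear])

lemma left_mult_hom: "a \<in> carrier A \<Longrightarrow> mult A a \<in> left_module_hom K A A"
  by (rule bilinear_right[OF mult_bilinear])

lemma right_mult_hom: "a \<in> carrier A \<Longrightarrow> (\<lambda>x. x \<otimes>\<^bsub>A\<^esub> a) \<in> left_module_hom K A A"
  by (rule bilinear_left[OF mult_bilinear])

end

lemma opposite_simps [simp]: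
  "carrier (opposite A) = carrier A" "zero (opposite A) = zero A" "one (opposite A) = one A"
  "add (opposite A) = add A" "smult (opposite A) = smult A"
  "mult (opposite A) = (\<lambda>x y. y \<otimes>\<^bsub>A\<^esub> x)"
  by (simp_all add: opposite_def)

lemma left_module_hom_opposite [simp]:
  "left_module_hom K (opposite A) M = left_module_hom K A M"
  "left_module_hom K M (opposite A) = left_module_hom K M A"
  by (simp_all add: left_module_hom_def)

lemma opposite_assoc_algebra:
  assumes "assoc_algebra K A"
  shows "assoc_algebra K (opposite A)"
proof -
  interpret assoc_algebra K A by fact
  have "opposite A = A\<lparr>mult := (\<lambda>x y. y \<otimes>\<^bsub>A\<^esub> x), one := \<one>\<^bsub>A\<^esub>\<rparr>"
    by (simp add: opposite_def)
  then have "module K (opposite A)" using module_update[OF M.module_axioms] by (rule ssubst)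
  moreover have "bilinear K (opposite A) (opposite A) (opposite A) (mult (opposite A))"
    using mult_bilinear by (auto simp: bilinear_def)
  ultimately show ?thesis
    by (rule ring_of_bilinear_mult) (auto simp: A.m_assoc)
qed

section \<open>The tensor product of two algebras\<close>

lemma tensor_algebra_simps [simp]:
  "carrier (tensor_algebra K A B) = carrier (tensor K A B)"
  "zero (tensor_algebra K A B) = zero (tensor K A B)"
  "add (tensor_algebra K A B) = add (tensor K A B)"
  "smult (tensor_algebra K A B) = smult (tensor K A B)"
  "one (tensor_algebra K A B) = pure_tensor K A B \<one>\<^bsub>A\<^esub> \<one>\<^bsub>B\<^esub>"
  by (simp_all add: tensor_algebra_def)

lemma left_module_hom_tensor_algebra [simp]:
  "left_module_hom K (tensor_algebra K A B) M = left_module_hom K (tensor K A B) M"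
  "left_module_hom K M (tensor_algebra K A B) = left_module_hom K M (tensor K A B)"
  by (simp_all add: left_module_hom_def)

context
  fixes K :: "('k, 'e) ring_scheme" and A :: "('k, 'a, 'm) module_scheme"
    and B :: "('k, 'b, 'n) module_scheme"
  assumes AB: "assoc_algebra K A" "assoc_algebra K B"
begin

interpretation A: assoc_algebra K A by (rule AB)
interpretation B: assoc_algebra K B by (rule AB)

private abbreviation (input) "T \<equiv> tensor K A B"
private abbreviation (input) "TA \<equiv> tensor_algebra K A B"
private abbreviation (input) "pt \<equiv> pure_tensor K A B"

interpretation T: module K T by (rule tensor_module[OF A.M.module_axioms B.M.module_axioms])

private lemma pt_bilinear: "bilinear K A B T pt"
  by (rule pure_tensor_bilinear[OF A.M.module_axioms B.M.module_axioms])

private lemma inner_bilinear: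
  assumes "a \<in> carrier A" "b \<in> carrier B"
  shows "bilinear K A B T (\<lambda>c d. pt (a \<otimes>\<^bsub>A\<^esub> c) (b \<otimes>\<^bsub>B\<^esub> d))"
  by (rule bilinear_compose[OF pt_bilinear A.left_mult_hom[OF assms(1)] B.left_mult_hom[OF assms(2)]])

text \<open>The product of \<open>X\<close> and \<open>Y\<close> is a lift in \<open>X\<close> of a
  lift in \<open>Y\<close>. Linearity in \<open>X\<close> holds because the inner lift is bilinear
  in \<open>a\<close> and \<open>b\<close>; linearity in \<open>Y\<close> is
  \<open>tensor_lift_bilinear\<close> with \<open>Y\<close> as the third variable.\<close>

private lemma mult_bilinear_aux:
  "bilinear K T T T (\<lambda>Y X. tensor_lift K T (\<lambda>a b.
    tensor_lift K T (\<lambda>c d. pt (a \<otimes>\<^bsub>A\<^esub> c) (b \<otimes>\<^bsub>B\<^esub> d)) Y) X)"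
proof -
  note m = A.M.module_axioms B.M.module_axioms
  have inner: "bilinear K A B T (\<lambda>a b. tensor_lift K T (\<lambda>c d. pt (a \<otimes>\<^bsub>A\<^esub> c) (b \<otimes>\<^bsub>B\<^esub> d)) Y)"
    if Y: "Y \<in> carrier T" for Y
  proof (rule bilinearI)
    fix b assume b: "b \<in> carrier B"
    have "bilinear K T A T (\<lambda>Y a. tensor_lift K T (\<lambda>c d. pt (a \<otimes>\<^bsub>A\<^esub> c) (b \<otimes>\<^bsub>B\<^esub> d)) Y)"
      by (rule tensor_lift_bilinear[OF m A.M.module_axioms T.module_axioms inner_bilinear[OF _ b]
            left_module_hom_comp[OF A.right_mult_hom bilinear_left[OF pt_bilinear B.A.m_closed[OF b]]]])
    then show "(\<lambda>a. tensor_lift K T (\<lambda>c d. pt (a \<otimes>\<^bsub>A\<^esub> c) (b \<otimes>\<^bsub>B\<^esub> d)) Y) \<in> left_module_hom K A T"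
      by (rule bilinear_right[OF _ Y])
  next
    fix a assume a: "a \<in> carrier A"
    have "bilinear K T B T (\<lambda>Y b. tensor_lift K T (\<lambda>c d. pt (a \<otimes>\<^bsub>A\<^esub> c) (b \<otimes>\<^bsub>B\<^esub> d)) Y)"
      by (rule tensor_lift_bilinear[OF m B.M.module_axioms T.module_axioms inner_bilinear[OF a]
            left_module_hom_comp[OF B.right_mult_hom bilinear_right[OF pt_bilinear A.A.m_closed[OF a]]]])
    then show "(\<lambda>b. tensor_lift K T (\<lambda>c d. pt (a \<otimes>\<^bsub>A\<^esub> c) (b \<otimes>\<^bsub>B\<^esub> d)) Y) \<in> left_module_hom K B T"
      by (rule bilinear_right[OF _ Y])
  qed
  show ?thesis
  proof (rule bilinearI)
    fix X assume X: "X \<in> carrier T"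
    have "bilinear K T T T (\<lambda>X Y. tensor_lift K T (\<lambda>a b.
        tensor_lift K T (\<lambda>c d. pt (a \<otimes>\<^bsub>A\<^esub> c) (b \<otimes>\<^bsub>B\<^esub> d)) Y) X)"
      by (rule tensor_lift_bilinear[OF m T.module_axioms T.module_axioms inner
            tensor_lift_hom[OF m T.module_axioms inner_bilinear]])
    then show "(\<lambda>Y. tensor_lift K T (\<lambda>a b.
        tensor_lift K T (\<lambda>c d. pt (a \<otimes>\<^bsub>A\<^esub> c) (b \<otimes>\<^bsub>B\<^esub> d)) Y) X) \<in> left_module_hom K T T"
      by (rule bilinear_right[OF _ X])
  next
    fix Y assume Y: "Y \<in> carrier T"
    show "tensor_lift K T (\<lambda>a b. tensor_lift K T (\<lambda>c d. pt (a \<otimes>\<^bsub>A\<^esub> c) (b \<otimes>\<^bsub>B\<^esub> d)) Y)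
        \<in> left_module_hom K T T"
      by (rule tensor_lift_hom[OF m T.module_axioms inner[OF Y]])
  qed
qed

lemma tensor_algebra_bilinear: "bilinear K T T T (mult TA)"
  using mult_bilinear_aux by (auto simp: bilinear_def tensor_algebra_def)

lemma tensor_algebra_mult_pure:
  assumes "a \<in> carrier A" "b \<in> carrier B" "c \<in> carrier A" "d \<in> carrier B"
  shows "pt a b \<otimes>\<^bsub>TA\<^esub> pt c d = pt (a \<otimes>\<^bsub>A\<^esub> c) (b \<otimes>\<^bsub>B\<^esub> d)"
proof -
  note m = A.M.module_axioms B.M.module_axioms
  have cd: "pt c d \<in> carrier T" by (rule pure_tensor_closed[OF m assms(3,4)])
  have in1: "tensor_lift K T (\<lambda>c d. pt (a \<otimes>\<^bsub>A\<^esub> c) (b \<otimes>\<^bsub>B\<^esub> d)) (pt c d) = pt (a \<otimes>\<^bsub>A\<^esub> c) (b \<otimes>\<^bsub>B\<^esub> d)"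
    if "a \<in> carrier A" "b \<in> carrier B" for a b
    by (rule tensor_lift_pure[OF m T.module_axioms inner_bilinear[OF that] assms(3,4)])
  have "bilinear K A B T (\<lambda>a b. pt (a \<otimes>\<^bsub>A\<^esub> c) (b \<otimes>\<^bsub>B\<^esub> d))"
    by (rule bilinear_compose[OF pt_bilinear A.right_mult_hom[OF assms(3)] B.right_mult_hom[OF assms(4)]])
  then have "bilinear K A B T (\<lambda>a b. tensor_lift K T (\<lambda>c d. pt (a \<otimes>\<^bsub>A\<^esub> c) (b \<otimes>\<^bsub>B\<^esub> d)) (pt c d))"
    by (auto simp: bilinear_def left_module_hom_def in1 Pi_def)
  from tensor_lift_pure[OF m T.module_axioms this assms(1,2)]
  show ?thesis by (simp add: tensor_algebra_def in1[OF assms(1,2)])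
qed

text \<open>Associativity is additive in each argument and is reduced to pure tensors in one
  argument after the other, beginning with the last. There it is associativity in the two
  factors.\<close>

lemma tensor_algebra_assoc_algebra: "assoc_algebra K TA"
proof (rule ring_of_bilinear_mult)
  note m = A.M.module_axioms B.M.module_axioms
  note bl = tensor_algebra_bilinear
  note cl = bilinear_closed[OF bl]
  note dl = bilinear_add_left[OF bl]
  note dr = bilinear_add_right[OF bl]
  note mp = tensor_algebra_mult_pure
  note pc = pure_tensor_closed[OF m]
  show "module K TA"
    unfolding tensor_algebra_def by (rule module_update[OF T.module_axioms])
  show "bilinear K TA TA TA (mult TA)" using bl by (simp add: bilinear_def)
  show "\<one>\<^bsub>TA\<^esub> \<in> carrier TA" by (simp add: pc)
  show "\<one>\<^bsub>TA\<^esub> \<otimes>\<^bsub>TA\<^esub> x = x" if "x \<in> carrier TA" for x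
    using that[simplified] by (induction x rule: tensor_induct[OF m]) (use that in \<open>simp_all add: mp dr pc\<close>)
  show "x \<otimes>\<^bsub>TA\<^esub> \<one>\<^bsub>TA\<^esub> = x" if "x \<in> carrier TA" for x
    using that[simplified] by (induction x rule: tensor_induct[OF m]) (use that in \<open>simp_all add: mp dl pc\<close>)
  have 1: "(pt a b \<otimes>\<^bsub>TA\<^esub> pt c d) \<otimes>\<^bsub>TA\<^esub> z = pt a b \<otimes>\<^bsub>TA\<^esub> (pt c d \<otimes>\<^bsub>TA\<^esub> z)"
    if "a \<in> carrier A" "b \<in> carrier B" "c \<in> carrier A" "d \<in> carrier B" "z \<in> carrier T" for a b c d z
    using that(5) by (induction z rule: tensor_induct[OF m])
      (simp_all add: mp dr cl pc that A.A.m_assoc B.A.m_assoc)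
  have 2: "(pt a b \<otimes>\<^bsub>TA\<^esub> y) \<otimes>\<^bsub>TA\<^esub> z = pt a b \<otimes>\<^bsub>TA\<^esub> (y \<otimes>\<^bsub>TA\<^esub> z)"
    if "a \<in> carrier A" "b \<in> carrier B" "z \<in> carrier T" "y \<in> carrier T" for a b y z
    using that(4) by (induction y rule: tensor_induct[OF m])
      (simp_all add: 1 that dl dr cl pc)
  show "(x \<otimes>\<^bsub>TA\<^esub> y) \<otimes>\<^bsub>TA\<^esub> z = x \<otimes>\<^bsub>TA\<^esub> (y \<otimes>\<^bsub>TA\<^esub> z)"
    if "x \<in> carrier TA" "y \<in> carrier TA" "z \<in> carrier TA" for x y z
    using that(1)[simplified] by (induction x rule: tensor_induct[OF m])
      (use that in \<open>simp_all add: 2 dl dr cl pc\<close>)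
qed

end

section \<open>Bimodules as modules over the enveloping algebra\<close>

text \<open>Both actions are bilinear for the same scalar action on \<open>M\<close>. Thus scalars
  act centrally, as they must if the two actions are to factor through a tensor product over
  \<open>K\<close>.\<close>

locale bimodule = A: assoc_algebra K A + M: module K M
  for K :: "('k, 'e) ring_scheme" and A :: "('k, 'a, 'm) module_scheme"
    and M :: "('k, 'x, 'n) module_scheme" +
  fixes l :: "'a \<Rightarrow> 'x \<Rightarrow> 'x" and r :: "'x \<Rightarrow> 'a \<Rightarrow> 'x"
  assumes l_bilinear: "bilinear K A M M l"
    and r_bilinear: "bilinear K M A M r"
    and l_one: "x \<in> carrier M \<Longrightarrow> l \<one>\<^bsub>A\<^esub> x = x"
    and r_one: "x \<in> carrier M \<Longrightarrow> r x \<one>\<^bsub>A\<^esub> = x"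
    and l_mult: "a \<in> carrier A \<Longrightarrow> b \<in> carrier A \<Longrightarrow> x \<in> carrier M \<Longrightarrow> l (a \<otimes>\<^bsub>A\<^esub> b) x = l a (l b x)"
    and r_mult: "a \<in> carrier A \<Longrightarrow> b \<in> carrier A \<Longrightarrow> x \<in> carrier M \<Longrightarrow> r x (a \<otimes>\<^bsub>A\<^esub> b) = r (r x a) b"
    and l_r_commute: "a \<in> carrier A \<Longrightarrow> b \<in> carrier A \<Longrightarrow> x \<in> carrier M \<Longrightarrow> r (l a x) b = l a (r x b)"
begin

abbreviation "Ae \<equiv> enveloping_algebra K A"
abbreviation "Me \<equiv> enveloping_module K M l r"
abbreviation "pe \<equiv> pure_tensor K A (opposite A)"

lemma opposite_algebra: "assoc_algebra K (opposite A)"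
  by (rule opposite_assoc_algebra) (rule A.assoc_algebra_axioms)

lemma enveloping_assoc_algebra: "assoc_algebra K Ae"
  unfolding enveloping_algebra_def
  by (rule tensor_algebra_assoc_algebra[OF A.assoc_algebra_axioms opposite_algebra])

sublocale E: assoc_algebra K Ae by (rule enveloping_assoc_algebra)

sublocale op: assoc_algebra K "opposite A" by (rule opposite_algebra)

lemmas AAop = A.M.module_axioms op.M.module_axioms

lemma enveloping_carrier: "carrier Ae = carrier (tensor K A (opposite A))"
  by (simp add: enveloping_algebra_def)

lemma enveloping_algebra_hom: "left_module_hom K Ae N = left_module_hom K (tensor K A (opposite A)) N"
  by (simp add: enveloping_algebra_def)

lemma pe_closed: "a \<in> carrier A \<Longrightarrow> b \<in> carrier A \<Longrightarrow> pe a b \<in> carrier Ae"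
  unfolding enveloping_carrier by (rule pure_tensor_closed[OF AAop]) simp_all

lemma pe_bilinear: "bilinear K A A Ae pe"
  using pure_tensor_bilinear[OF AAop] by (simp add: bilinear_def enveloping_algebra_def)

lemma pe_mult:
  "a \<in> carrier A \<Longrightarrow> b \<in> carrier A \<Longrightarrow> c \<in> carrier A \<Longrightarrow> d \<in> carrier A \<Longrightarrow>
    pe a b \<otimes>\<^bsub>Ae\<^esub> pe c d = pe (a \<otimes>\<^bsub>A\<^esub> c) (d \<otimes>\<^bsub>A\<^esub> b)"
  unfolding enveloping_algebra_def
  using tensor_algebra_mult_pure[OF A.assoc_algebra_axioms opposite_algebra, of a b c d] by simp

lemma pe_one: "\<one>\<^bsub>Ae\<^esub> = pe \<one>\<^bsub>A\<^esub> \<one>\<^bsub>A\<^esub>"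
  by (simp add: enveloping_algebra_def)

lemma enveloping_induct [consumes 1, case_names pure add]:
  assumes "X \<in> carrier Ae"
    and "\<And>a b. a \<in> carrier A \<Longrightarrow> b \<in> carrier A \<Longrightarrow> P (pe a b)"
    and "\<And>x y. x \<in> carrier Ae \<Longrightarrow> y \<in> carrier Ae \<Longrightarrow> P x \<Longrightarrow> P y \<Longrightarrow> P (x \<oplus>\<^bsub>Ae\<^esub> y)"
  shows "P X"
  using assms(1)[unfolded enveloping_carrier]
  by (induction X rule: tensor_induct[OF AAop])
     (use assms in \<open>simp_all add: enveloping_algebra_def\<close>)

lemma enveloping_module_simps [simp]:
  "carrier Me = carrier M" "zero Me = zero M" "add Me = add M"
  by (simp_all add: enveloping_module_def)

lemma action_bilinear: "x \<in> carrier M \<Longrightarrow> bilinear K A (opposite A) M (\<lambda>a b. r (l a x) b)"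
proof (rule bilinearI)
  fix b assume x: "x \<in> carrier M" and "b \<in> carrier (opposite A)"
  then show "(\<lambda>a. r (l a x) b) \<in> left_module_hom K A M"
    by (intro left_module_hom_comp[OF bilinear_left[OF l_bilinear x] bilinear_left[OF r_bilinear]]) simp
next
  fix a assume x: "x \<in> carrier M" and "a \<in> carrier A"
  then show "r (l a x) \<in> left_module_hom K (opposite A) M"
    using bilinear_right[OF r_bilinear bilinear_closed[OF l_bilinear]] by simp
qed

lemma enveloping_smult_bilinear: "bilinear K Ae M M (smult Me)"
proof -
  have "bilinear K (tensor K A (opposite A)) M M (\<lambda>X x. tensor_lift K M (\<lambda>a b. r (l a x) b) X)"
    by (rule tensor_lift_bilinear[OF AAop M.module_axioms M.module_axioms action_bilinear
          left_module_hom_comp[OF bilinear_right[OF l_bilinear] bilinear_left[OF r_bilinear]]])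
       simp_all
  then show ?thesis
    by (simp add: bilinear_def enveloping_algebra_def enveloping_module_def)
qed

lemma enveloping_smult_pure:
  "a \<in> carrier A \<Longrightarrow> b \<in> carrier A \<Longrightarrow> x \<in> carrier M \<Longrightarrow> pe a b \<odot>\<^bsub>Me\<^esub> x = r (l a x) b"
  using tensor_lift_pure[OF AAop M.module_axioms action_bilinear, of x a b]
  by (simp add: enveloping_module_def)

text \<open>The opposite multiplication in the second factor matches the order of right actions: the
  product of \<open>pe a b\<close> and \<open>pe c d\<close> acts by a c on the left and by d b on
  the right. Two inductions extend this from pure tensors.\<close>

lemma enveloping_left_module: "left_module Ae Me"
proof -
  note bl = enveloping_smult_bilinear
  note sp = enveloping_smult_pure
  note lc = bilinear_closed[OF l_bilinear] bilinear_closed[OF r_bilinear]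
  note scl = bilinear_closed[OF bl]
  have ag: "abelian_group Me"
    by (rule abelian_group_transfer[OF M.M.abelian_group_axioms]) simp_all
  have 1: "(pe a b \<otimes>\<^bsub>Ae\<^esub> Y) \<odot>\<^bsub>Me\<^esub> x = pe a b \<odot>\<^bsub>Me\<^esub> (Y \<odot>\<^bsub>Me\<^esub> x)"
    if ab: "a \<in> carrier A" "b \<in> carrier A" and x: "x \<in> carrier M" and Y: "Y \<in> carrier Ae" for a b Y x
    using Y
  proof (induction Y rule: enveloping_induct)
    case (pure c d)
    then show ?case
      by (simp add: pe_mult ab sp x lc l_mult r_mult l_r_commute)
  next
    case (add y z)
    then show ?case
      using pe_closed[OF ab] x
      by (simp add: E.A.r_distr bilinear_add_left[OF bl] bilinear_add_right[OF bl] scl)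
  qed
  have 2: "(X \<otimes>\<^bsub>Ae\<^esub> Y) \<odot>\<^bsub>Me\<^esub> x = X \<odot>\<^bsub>Me\<^esub> (Y \<odot>\<^bsub>Me\<^esub> x)"
    if x: "x \<in> carrier M" and Y: "Y \<in> carrier Ae" and X: "X \<in> carrier Ae" for X Y x
    using X
  proof (induction X rule: enveloping_induct)
    case (pure c d)
    then show ?case using 1 x Y by simp
  next
    case (add y z)
    then show ?case
      using x Y
      by (simp add: E.A.l_distr bilinear_add_left[OF bl] bilinear_add_right[OF bl] scl)
  qed
  show ?thesis
    by (intro left_module.intro left_module_axioms.intro E.A.ring_axioms ag)
       (auto simp: scl bilinear_add_left[OF bl] bilinear_add_right[OF bl] 2 pe_one sp l_one r_one)
qed

end

lemma (in assoc_algebra) regular_bimodule: "bimodule K A A (mult A) (mult A)"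
  by (intro bimodule.intro bimodule_axioms.intro assoc_algebra_axioms M.module_axioms mult_bilinear)
     (auto simp: A.m_assoc)

section \<open>The exterior algebra\<close>

lemma free_module_hom_eq:
  assumes "module K V" "f \<in> left_module_hom K (free_module K S) V"
    "g \<in> left_module_hom K (free_module K S) V"
    and "\<And>s. s \<in> S \<Longrightarrow> f (single K s) = g (single K s)"
    and "x \<in> carrier (free_module K S)"
  shows "f x = g x"
proof -
  interpret V: module K V by fact
  interpret F: module K "free_module K S" by (rule free_module_module[OF V.R.cring_axioms])
  note ha = left_module_hom_add_hom
  from V.R.cring_axioms assms(5) show ?thesis
  proof (induction x rule: free_module_induct)
    case zero
    show ?case
      using add_hom_zero[OF ha[OF assms(2)] F.M.abelian_group_axioms V.M.abelian_group_axioms]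
        add_hom_zero[OF ha[OF assms(3)] F.M.abelian_group_axioms V.M.abelian_group_axioms] by simp
  next
    case (add c s x)
    note sg = single_closed[OF V.R.ring_axioms add.hyps(2)]
    show ?case
      unfolding left_module_hom_add[OF assms(2) F.smult_closed[OF add.hyps(1) sg] add.hyps(3)]
        left_module_hom_add[OF assms(3) F.smult_closed[OF add.hyps(1) sg] add.hyps(3)]
        left_module_hom_smult[OF assms(2) add.hyps(1) sg]
        left_module_hom_smult[OF assms(3) add.hyps(1) sg]
      by (simp add: assms(4) add)
  qed
qed

section \<open>Words and the free associative algebra\<close>

lemma words_append [simp]: "u @ v \<in> words n \<longleftrightarrow> u \<in> words n \<and> v \<in> words n"
  by (auto simp: words_def)

lemma words_Nil [simp]: "[] \<in> words n"
  by (simp add: words_def)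

lemma words_single [simp]: "[h] \<in> words n \<longleftrightarrow> h \<in> {1..n}"
  by (auto simp: words_def)

locale exterior = K: cring K for K :: "('k, 'e) ring_scheme" +
  fixes n :: nat
begin

abbreviation "T \<equiv> free_algebra K n"
abbreviation "W \<equiv> free_module K (words n)"
abbreviation "E \<equiv> exterior_algebra K n"
abbreviation "I \<equiv> exterior_ideal K n"
abbreviation "gen \<equiv> free_gen K"
abbreviation "x \<equiv> ext_gen K n"

interpretation W: module K W by (rule free_module_module[OF K.cring_axioms])

lemma free_algebra_simps [simp]:
  "carrier T = carrier W" "zero T = zero W" "add T = add W" "smult T = smult W"
  "one T = single K []"
  by (simp_all add: free_algebra_def)

lemma free_algebra_hom [simp]:
  "left_module_hom K T M = left_module_hom K W M" "left_module_hom K M T = left_module_hom K M W"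
  by (simp_all add: left_module_hom_def)

lemma free_mult_apply:
  "(f \<otimes>\<^bsub>T\<^esub> g) w = finsum K (\<lambda>j. f (take j w) \<otimes>\<^bsub>K\<^esub> g (drop j w)) {0..length w}"
  by (simp add: free_algebra_def)

lemma single_word_closed: "w \<in> words n \<Longrightarrow> single K w \<in> carrier W"
  by (rule single_closed[OF K.ring_axioms])

text \<open>The support of a product consists of concatenations of words from the two supports,
  which gives finiteness and the restriction on letters.\<close>

lemma free_mult_closed:
  assumes f: "f \<in> carrier W" and g: "g \<in> carrier W"
  shows "f \<otimes>\<^bsub>T\<^esub> g \<in> carrier W"
proof -
  have split: "\<exists>j. f (take j w) \<noteq> \<zero>\<^bsub>K\<^esub> \<and> g (drop j w) \<noteq> \<zero>\<^bsub>K\<^esub>" if "(f \<otimes>\<^bsub>T\<^esub> g) w \<noteq> \<zero>\<^bsub>K\<^esub>" for w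
  proof (rule ccontr)
    assume "\<not> ?thesis"
    then have "f (take j w) \<otimes>\<^bsub>K\<^esub> g (drop j w) = \<zero>\<^bsub>K\<^esub>" for j
      using f g by (metis K.l_null K.r_null free_module_apply)
    then have "(f \<otimes>\<^bsub>T\<^esub> g) w = \<zero>\<^bsub>K\<^esub>"
      unfolding free_mult_apply by (simp add: K.finsum_zero)
    with that show False by simp
  qed
  have sub: "{w. (f \<otimes>\<^bsub>T\<^esub> g) w \<noteq> \<zero>\<^bsub>K\<^esub>} \<subseteq>
      (\<lambda>(u, v). u @ v) ` ({u. f u \<noteq> \<zero>\<^bsub>K\<^esub>} \<times> {v. g v \<noteq> \<zero>\<^bsub>K\<^esub>})"
  proof
    fix w assume "w \<in> {w. (f \<otimes>\<^bsub>T\<^esub> g) w \<noteq> \<zero>\<^bsub>K\<^esub>}"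
    then obtain j where "f (take j w) \<noteq> \<zero>\<^bsub>K\<^esub>" "g (drop j w) \<noteq> \<zero>\<^bsub>K\<^esub>" using split by auto
    then show "w \<in> (\<lambda>(u, v). u @ v) ` ({u. f u \<noteq> \<zero>\<^bsub>K\<^esub>} \<times> {v. g v \<noteq> \<zero>\<^bsub>K\<^esub>})"
      by (intro image_eqI[of _ _ "(take j w, drop j w)"]) auto
  qed
  have "finite {w. (f \<otimes>\<^bsub>T\<^esub> g) w \<noteq> \<zero>\<^bsub>K\<^esub>}"
    by (rule finite_subset[OF sub]) (use f g in \<open>auto simp: free_module_mem_iff\<close>)
  moreover have "(f \<otimes>\<^bsub>T\<^esub> g) w \<in> carrier K" for w
    unfolding free_mult_apply using f g by (intro K.finsum_closed) auto
  moreover have "w \<in> words n" if w: "(f \<otimes>\<^bsub>T\<^esub> g) w \<noteq> \<zero>\<^bsub>K\<^esub>" for w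
  proof -
    obtain j where "f (take j w) \<noteq> \<zero>\<^bsub>K\<^esub>" "g (drop j w) \<noteq> \<zero>\<^bsub>K\<^esub>" using split[OF w] by auto
    then have "take j w \<in> words n" "drop j w \<in> words n"
      using f g by (auto simp: free_module_mem_iff)
    then have "take j w @ drop j w \<in> words n" by (simp del: append_take_drop_id)
    then show ?thesis by simp
  qed
  ultimately show ?thesis by (auto simp: free_module_mem_iff)
qed

lemma free_mult_bilinear: "bilinear K W W W (mult T)"
proof (rule bilinearI; rule left_module_homI)
  fix f g assume fg: "f \<in> carrier W" "g \<in> carrier W"
  then show "f \<otimes>\<^bsub>T\<^esub> g \<in> carrier W" "f \<otimes>\<^bsub>T\<^esub> g \<in> carrier W"
    using free_mult_closed by auto
  fix c assume c: "c \<in> carrier K"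
  have cl: "(\<lambda>j. f (take j w) \<otimes>\<^bsub>K\<^esub> g (drop j w)) \<in> {0..length w} \<rightarrow> carrier K" for w
    using fg by auto
  show "(c \<odot>\<^bsub>W\<^esub> f) \<otimes>\<^bsub>T\<^esub> g = c \<odot>\<^bsub>W\<^esub> (f \<otimes>\<^bsub>T\<^esub> g)"
  proof
    fix w
    show "((c \<odot>\<^bsub>W\<^esub> f) \<otimes>\<^bsub>T\<^esub> g) w = (c \<odot>\<^bsub>W\<^esub> (f \<otimes>\<^bsub>T\<^esub> g)) w"
      using K.finsum_rdistr[OF _ c cl[of w]] fg c by (simp add: free_mult_apply K.m_assoc)
  qed
  show "f \<otimes>\<^bsub>T\<^esub> (c \<odot>\<^bsub>W\<^esub> g) = c \<odot>\<^bsub>W\<^esub> (f \<otimes>\<^bsub>T\<^esub> g)"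
  proof
    fix w
    show "(f \<otimes>\<^bsub>T\<^esub> (c \<odot>\<^bsub>W\<^esub> g)) w = (c \<odot>\<^bsub>W\<^esub> (f \<otimes>\<^bsub>T\<^esub> g)) w"
      using K.finsum_rdistr[OF _ c cl[of w]] fg c by (simp add: free_mult_apply K.m_lcomm)
  qed
next
  fix f f' g assume fg: "f \<in> carrier W" "f' \<in> carrier W" "g \<in> carrier W"
  show "(f \<oplus>\<^bsub>W\<^esub> f') \<otimes>\<^bsub>T\<^esub> g = f \<otimes>\<^bsub>T\<^esub> g \<oplus>\<^bsub>W\<^esub> f' \<otimes>\<^bsub>T\<^esub> g"
  proof
    fix w
    show "((f \<oplus>\<^bsub>W\<^esub> f') \<otimes>\<^bsub>T\<^esub> g) w = (f \<otimes>\<^bsub>T\<^esub> g \<oplus>\<^bsub>W\<^esub> f' \<otimes>\<^bsub>T\<^esub> g) w"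
      using fg by (simp add: free_mult_apply K.l_distr flip: K.finsum_addf)
  qed
  show "g \<otimes>\<^bsub>T\<^esub> (f \<oplus>\<^bsub>W\<^esub> f') = g \<otimes>\<^bsub>T\<^esub> f \<oplus>\<^bsub>W\<^esub> g \<otimes>\<^bsub>T\<^esub> f'"
  proof
    fix w
    show "(g \<otimes>\<^bsub>T\<^esub> (f \<oplus>\<^bsub>W\<^esub> f')) w = (g \<otimes>\<^bsub>T\<^esub> f \<oplus>\<^bsub>W\<^esub> g \<otimes>\<^bsub>T\<^esub> f') w"
      using fg by (simp add: free_mult_apply K.r_distr flip: K.finsum_addf)
  qed
qed

text \<open>Among all ways to cut a word in two, only the cut after \<open>length u\<close> letters
  can produce \<open>u\<close> and \<open>v\<close>.\<close>

lemma single_mult: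
  "single K u \<otimes>\<^bsub>T\<^esub> single K v = single K (u @ v)"
proof
  fix w
  have e: "single K u (take j w) \<otimes>\<^bsub>K\<^esub> single K v (drop j w) =
      (if j = length u then if w = u @ v then \<one>\<^bsub>K\<^esub> else \<zero>\<^bsub>K\<^esub> else \<zero>\<^bsub>K\<^esub>)"
    if j: "j \<in> {0..length w}" for j
  proof -
    have iff: "take j w = u \<and> drop j w = v \<longleftrightarrow> j = length u \<and> w = u @ v"
    proof
      assume "take j w = u \<and> drop j w = v"
      then show "j = length u \<and> w = u @ v" using j by auto
    qed auto
    have "single K u (take j w) \<otimes>\<^bsub>K\<^esub> single K v (drop j w) =
        (if take j w = u \<and> drop j w = v then \<one>\<^bsub>K\<^esub> else \<zero>\<^bsub>K\<^esub>)"
      by (simp add: single_def)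
    also have "\<dots> = (if j = length u \<and> w = u @ v then \<one>\<^bsub>K\<^esub> else \<zero>\<^bsub>K\<^esub>)"
      unfolding iff ..
    also have "\<dots> = (if j = length u then if w = u @ v then \<one>\<^bsub>K\<^esub> else \<zero>\<^bsub>K\<^esub> else \<zero>\<^bsub>K\<^esub>)"
      by simp
    finally show ?thesis .
  qed
  show "(single K u \<otimes>\<^bsub>T\<^esub> single K v) w = single K (u @ v) w"
  proof (cases "w = u @ v")
    case True
    have "(single K u \<otimes>\<^bsub>T\<^esub> single K v) w =
        finsum K (\<lambda>j. if length u = j then \<one>\<^bsub>K\<^esub> else \<zero>\<^bsub>K\<^esub>) {0..length w}"
      unfolding free_mult_apply using e True by (intro K.finsum_cong') auto
    also have "\<dots> = \<one>\<^bsub>K\<^esub>" using True by (intro K.finsum_singleton) auto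
    finally show ?thesis using True by (simp add: single_def)
  next
    case False
    have "(single K u \<otimes>\<^bsub>T\<^esub> single K v) w = finsum K (\<lambda>j. \<zero>\<^bsub>K\<^esub>) {0..length w}"
      unfolding free_mult_apply using e False by (intro K.finsum_cong') auto
    then show ?thesis using False by (simp add: single_def K.finsum_zero)
  qed
qed

text \<open>On words the ring laws are those of concatenation. They extend by linearity, for
  associativity in one argument after the other.\<close>

lemma free_algebra_assoc_algebra: "assoc_algebra K T"
proof (rule ring_of_bilinear_mult)
  note bl = free_mult_bilinear
  note L = bilinear_left[OF bl] and R = bilinear_right[OF bl]
  note s = single_word_closed
  note comp = left_module_hom_comp
  show "module K T" by (rule module_transfer[OF W.module_axioms]) simp_all
  show "bilinear K T T T (mult T)" using bl by (simp add: bilinear_def)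
  show "\<one>\<^bsub>T\<^esub> \<in> carrier T" by (simp add: s)
  show "\<one>\<^bsub>T\<^esub> \<otimes>\<^bsub>T\<^esub> f = f" if "f \<in> carrier T" for f
    by (rule free_module_hom_eq[OF W.module_axioms, of "\<lambda>f. \<one>\<^bsub>T\<^esub> \<otimes>\<^bsub>T\<^esub> f" "words n" "\<lambda>f. f"])
       (use that in \<open>auto intro!: R s left_module_hom_id simp: single_mult\<close>)
  show "f \<otimes>\<^bsub>T\<^esub> \<one>\<^bsub>T\<^esub> = f" if "f \<in> carrier T" for f
    by (rule free_module_hom_eq[OF W.module_axioms, of "\<lambda>f. f \<otimes>\<^bsub>T\<^esub> \<one>\<^bsub>T\<^esub>" "words n" "\<lambda>f. f"])
       (use that in \<open>auto intro!: L s left_module_hom_id simp: single_mult\<close>)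
  have 1: "(single K u \<otimes>\<^bsub>T\<^esub> single K v) \<otimes>\<^bsub>T\<^esub> h = single K u \<otimes>\<^bsub>T\<^esub> (single K v \<otimes>\<^bsub>T\<^esub> h)"
    if "u \<in> words n" "v \<in> words n" "h \<in> carrier W" for u v h
    by (rule free_module_hom_eq[OF W.module_axioms R[OF free_mult_closed[OF s s]]
          comp[OF R[OF s] R[OF s]] _ that(3)])
       (use that in \<open>simp_all add: single_mult\<close>)
  have 2: "(single K u \<otimes>\<^bsub>T\<^esub> g) \<otimes>\<^bsub>T\<^esub> h = single K u \<otimes>\<^bsub>T\<^esub> (g \<otimes>\<^bsub>T\<^esub> h)"
    if "u \<in> words n" "g \<in> carrier W" "h \<in> carrier W" for u g h
    by (rule free_module_hom_eq[OF W.module_axioms comp[OF R[OF s] L] comp[OF L R[OF s]] _ that(2)])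
       (use that in \<open>simp_all add: 1\<close>)
  show "(f \<otimes>\<^bsub>T\<^esub> g) \<otimes>\<^bsub>T\<^esub> h = f \<otimes>\<^bsub>T\<^esub> (g \<otimes>\<^bsub>T\<^esub> h)"
    if "f \<in> carrier T" "g \<in> carrier T" "h \<in> carrier T" for f g h
    by (rule free_module_hom_eq[OF W.module_axioms comp[OF L L] L[OF free_mult_closed]])
       (use that in \<open>simp_all add: 2\<close>)
qed

sublocale T: assoc_algebra K T by (rule free_algebra_assoc_algebra)

lemma gen_closed: "h \<in> {1..n} \<Longrightarrow> gen h \<in> carrier T"
  by (simp add: free_gen_def single_word_closed)

text \<open>Words grow at their right end, in agreement with the recursion of the
  contractions.\<close>

lemma free_algebra_induct [consumes 1, case_names one gen add smult]:
  assumes f: "f \<in> carrier T"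
    and one: "P \<one>\<^bsub>T\<^esub>"
    and gen: "\<And>f h. f \<in> carrier T \<Longrightarrow> h \<in> {1..n} \<Longrightarrow> P f \<Longrightarrow> P (f \<otimes>\<^bsub>T\<^esub> gen h)"
    and add: "\<And>f g. f \<in> carrier T \<Longrightarrow> g \<in> carrier T \<Longrightarrow> P f \<Longrightarrow> P g \<Longrightarrow> P (f \<oplus>\<^bsub>T\<^esub> g)"
    and smult: "\<And>c f. c \<in> carrier K \<Longrightarrow> f \<in> carrier T \<Longrightarrow> P f \<Longrightarrow> P (c \<odot>\<^bsub>T\<^esub> f)"
  shows "P f"
proof -
  have w: "P (single K w)" if "w \<in> words n" for w
    using that
  proof (induction w rule: rev_induct)
    case Nil
    show ?case using one by simp
  next
    case (snoc h w)
    then show ?case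
      using gen[of "single K w" h] single_word_closed[of w] by (simp add: free_gen_def single_mult)
  qed
  from K.cring_axioms f[simplified] show ?thesis
  proof (induction f rule: free_module_induct)
    case zero
    have "P (\<zero>\<^bsub>K\<^esub> \<odot>\<^bsub>T\<^esub> \<one>\<^bsub>T\<^esub>)" by (rule smult[OF _ _ one]) (simp_all add: single_word_closed)
    then show ?case by (subst (asm) T.M.smult_l_null) (simp_all add: single_word_closed)
  next
    case (add c s f)
    have "P (c \<odot>\<^bsub>T\<^esub> single K s \<oplus>\<^bsub>T\<^esub> f)"
      using add.hyps add.IH w single_word_closed T.M.smult_closed[of c "single K s"]
      by (intro assms(4) smult) simp_all
    then show ?case by simp
  qed
qed

text \<open>From here on the free algebra is used through its ring laws. Rewriting its operations
  into those of the module of functions would hide them.\<close>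

declare free_algebra_simps [simp del]

section \<open>The ideal of relations and the exterior algebra\<close>

definition relations :: "(nat list \<Rightarrow> 'k) set"
  where "relations = {gen i \<otimes>\<^bsub>T\<^esub> gen i | i. 1 \<le> i \<and> i \<le> n} \<union>
    {gen i \<otimes>\<^bsub>T\<^esub> gen j \<oplus>\<^bsub>T\<^esub> gen j \<otimes>\<^bsub>T\<^esub> gen i | i j. 1 \<le> i \<and> i < j \<and> j \<le> n}"

lemma exterior_ideal_eq: "I = genideal T relations"
  by (simp add: exterior_ideal_def relations_def)

lemma relations_carrier: "relations \<subseteq> carrier T"
  unfolding relations_def
  by (auto intro!: T.A.m_closed T.M.M.a_closed gen_closed)

lemma exterior_ideal_ideal: "ideal I T"
  unfolding exterior_ideal_eq by (rule T.A.genideal_ideal[OF relations_carrier])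

sublocale I: ideal I T by (rule exterior_ideal_ideal)

text \<open>A ring ideal is closed under scalars because c f is the product of c 1 and f.\<close>

lemma exterior_ideal_submodule: "submodule I K T"
proof -
  have "c \<odot>\<^bsub>T\<^esub> f \<in> I" if c: "c \<in> carrier K" and f: "f \<in> I" for c f
  proof -
    have "c \<odot>\<^bsub>T\<^esub> f = (c \<odot>\<^bsub>T\<^esub> \<one>\<^bsub>T\<^esub>) \<otimes>\<^bsub>T\<^esub> f"
      using T.mult_smult_left[OF c T.A.one_closed I.a_Hcarr[OF f]] T.A.l_one[OF I.a_Hcarr[OF f]]
      by simp
    then show ?thesis
      using I.I_l_closed[OF f T.M.smult_closed[OF c T.A.one_closed]] by simp
  qed
  then show ?thesis
    unfolding submodule_iff[OF T.M.M.abelian_group_axioms]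
    using I.a_subset I.a_closed I.a_inv_closed I.zero_closed by (auto)
qed

lemma exterior_algebra_simps:
  "carrier E = carrier (T Quot I)" "zero E = zero (T Quot I)" "add E = add (T Quot I)"
  "mult E = mult (T Quot I)" "one E = one (T Quot I)" "smult E = smult (quotient_module T I)"
  by (simp_all add: exterior_algebra_def ring.defs module.defs)

definition proj :: "(nat list \<Rightarrow> 'k) \<Rightarrow> 'k ext"
  where "proj f = I +>\<^bsub>T\<^esub> f"

lemma ext_gen_eq: "x h = proj (gen h)"
  by (simp add: ext_gen_def proj_def)

lemma proj_ring_hom: "proj \<in> ring_hom T E"
  using I.rcos_ring_hom
  by (auto simp: ring_hom_def proj_def exterior_algebra_simps Pi_def)

lemma proj_hom: "proj \<in> left_module_hom K T E"
proof (rule left_module_homI)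
  fix f assume f: "f \<in> carrier T"
  show "proj f \<in> carrier E" by (rule ring_hom_closed[OF proj_ring_hom f])
  show "proj (f \<oplus>\<^bsub>T\<^esub> g) = proj f \<oplus>\<^bsub>E\<^esub> proj g" if "g \<in> carrier T" for g
    by (rule ring_hom_add[OF proj_ring_hom f that])
  show "proj (c \<odot>\<^bsub>T\<^esub> f) = c \<odot>\<^bsub>E\<^esub> proj f" if "c \<in> carrier K" for c
    using quotient_module_smult[OF T.M.module_axioms exterior_ideal_submodule that f]
    by (simp add: exterior_algebra_simps proj_def)
qed

lemma proj_cases:
  assumes "a \<in> carrier E"
  obtains f where "f \<in> carrier T" "a = proj f"
  using assms by (auto simp: exterior_algebra_simps FactRing_def A_RCOSETS_def' a_r_coset_def' proj_def)

lemma proj_mult: "f \<in> carrier T \<Longrightarrow> g \<in> carrier T \<Longrightarrow> proj (f \<otimes>\<^bsub>T\<^esub> g) = proj f \<otimes>\<^bsub>E\<^esub> proj g"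
  by (rule ring_hom_mult[OF proj_ring_hom])

lemma proj_one: "proj \<one>\<^bsub>T\<^esub> = \<one>\<^bsub>E\<^esub>"
  by (rule ring_hom_one[OF proj_ring_hom])

lemma proj_closed: "f \<in> carrier T \<Longrightarrow> proj f \<in> carrier E"
  by (rule ring_hom_closed[OF proj_ring_hom])

text \<open>The ring laws come from the factor ring and the module laws from the quotient module,
  which share carrier, zero and addition. Compatibility of scalars with products is checked on
  representatives.\<close>

lemma exterior_assoc_algebra: "assoc_algebra K E"
proof -
  have mod: "module K E"
    by (rule module_transfer[OF quotient_module_module[OF T.M.module_axioms exterior_ideal_submodule]])
       (simp_all add: exterior_algebra_simps FactRing_def)
  interpret E: module K E by (rule mod)
  have rng: "ring E"
    by (rule ring_transfer[OF I.quotient_is_ring]) (simp_all add: exterior_algebra_simps)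
  interpret E: ring E by (rule rng)
  have "bilinear K E E E (mult E)"
  proof (rule bilinearI; rule left_module_homI)
    fix a b c assume ab: "a \<in> carrier E" "b \<in> carrier E" and c: "c \<in> carrier K"
    obtain f where f: "f \<in> carrier T" "a = proj f" using ab(1) by (rule proj_cases)
    obtain g where g: "g \<in> carrier T" "b = proj g" using ab(2) by (rule proj_cases)
    note sm = left_module_hom_smult[OF proj_hom c, symmetric]
    note cl = T.A.m_closed[OF f(1) g(1)] T.M.smult_closed[OF c f(1)] T.M.smult_closed[OF c g(1)]
    show "(c \<odot>\<^bsub>E\<^esub> a) \<otimes>\<^bsub>E\<^esub> b = c \<odot>\<^bsub>E\<^esub> (a \<otimes>\<^bsub>E\<^esub> b)"
      unfolding f(2) g(2) sm[OF f(1)] proj_mult[OF f(1) g(1), symmetric] sm[OF cl(1)]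
        proj_mult[OF cl(2) g(1), symmetric] T.mult_smult_left[OF c f(1) g(1)] ..
    show "a \<otimes>\<^bsub>E\<^esub> (c \<odot>\<^bsub>E\<^esub> b) = c \<odot>\<^bsub>E\<^esub> (a \<otimes>\<^bsub>E\<^esub> b)"
      unfolding f(2) g(2) sm[OF g(1)] proj_mult[OF f(1) g(1), symmetric] sm[OF cl(1)]
        proj_mult[OF f(1) cl(3), symmetric] T.mult_smult_right[OF c f(1) g(1)] ..
  qed (auto simp: E.l_distr E.r_distr)
  then show ?thesis
    using mod rng by (simp add: assoc_algebra_def assoc_algebra_axioms_def)
qed

sublocale E: assoc_algebra K E by (rule exterior_assoc_algebra)

lemma x_closed [simp]: "h \<in> {1..n} \<Longrightarrow> x h \<in> carrier E"
  unfolding ext_gen_eq by (rule proj_closed[OF gen_closed])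

lemma ext_induct [consumes 1, case_names one gen add smult]:
  assumes a: "a \<in> carrier E"
    and one: "P \<one>\<^bsub>E\<^esub>"
    and gen: "\<And>a h. a \<in> carrier E \<Longrightarrow> h \<in> {1..n} \<Longrightarrow> P a \<Longrightarrow> P (a \<otimes>\<^bsub>E\<^esub> x h)"
    and add: "\<And>a b. a \<in> carrier E \<Longrightarrow> b \<in> carrier E \<Longrightarrow> P a \<Longrightarrow> P b \<Longrightarrow> P (a \<oplus>\<^bsub>E\<^esub> b)"
    and smult: "\<And>c a. c \<in> carrier K \<Longrightarrow> a \<in> carrier E \<Longrightarrow> P a \<Longrightarrow> P (c \<odot>\<^bsub>E\<^esub> a)"
  shows "P a"
proof -
  obtain f where f: "f \<in> carrier T" "a = proj f" using a by (rule proj_cases)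
  have "P (proj f)" using f(1)
  proof (induction f rule: free_algebra_induct)
    case one then show ?case using assms(2) by (simp add: proj_one)
  next
    case (gen f h)
    then show ?case using assms(3)[of "proj f" h]
      by (simp add: proj_mult gen_closed proj_closed ext_gen_eq)
  next
    case (add f g)
    then show ?case using assms(4)[of "proj f" "proj g"]
      by (simp add: left_module_hom_add[OF proj_hom] proj_closed)
  next
    case (smult c f)
    then show ?case using assms(5)[of c "proj f"]
      by (simp add: left_module_hom_smult[OF proj_hom] proj_closed)
  qed
  then show ?thesis using f(2) by simp
qed

lemma proj_ideal: "f \<in> I \<Longrightarrow> proj f = \<zero>\<^bsub>E\<^esub>"
  by (simp add: proj_def exterior_algebra_simps FactRing_def I.a_rcos_const)

lemma x_square: "h \<in> {1..n} \<Longrightarrow> x h \<otimes>\<^bsub>E\<^esub> x h = \<zero>\<^bsub>E\<^esub>"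
  unfolding ext_gen_eq proj_mult[OF gen_closed gen_closed, symmetric]
  by (rule proj_ideal, unfold exterior_ideal_eq, rule subsetD[OF T.A.genideal_self[OF relations_carrier]])
     (auto simp: relations_def)

text \<open>The ideal has this relation only for increasing pairs of indices. A decreasing pair
  follows by commuting the sum, and an equal pair from \<open>x_square\<close>.\<close>

lemma x_anticommute:
  assumes "g \<in> {1..n}" "h \<in> {1..n}"
  shows "x g \<otimes>\<^bsub>E\<^esub> x h \<oplus>\<^bsub>E\<^esub> x h \<otimes>\<^bsub>E\<^esub> x g = \<zero>\<^bsub>E\<^esub>"
proof -
  have lt: "x i \<otimes>\<^bsub>E\<^esub> x j \<oplus>\<^bsub>E\<^esub> x j \<otimes>\<^bsub>E\<^esub> x i = \<zero>\<^bsub>E\<^esub>" if "1 \<le> i" "i < j" "j \<le> n" for i j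
  proof -
    have ij: "gen i \<in> carrier T" "gen j \<in> carrier T" using gen_closed[of i] gen_closed[of j] that by simp_all
    have "gen i \<otimes>\<^bsub>T\<^esub> gen j \<oplus>\<^bsub>T\<^esub> gen j \<otimes>\<^bsub>T\<^esub> gen i \<in> I"
      unfolding exterior_ideal_eq
      by (rule subsetD[OF T.A.genideal_self[OF relations_carrier]]) (use that in \<open>auto simp: relations_def\<close>)
    from proj_ideal[OF this] show ?thesis
      unfolding ext_gen_eq proj_mult[OF ij, symmetric] proj_mult[OF ij(2,1), symmetric]
        left_module_hom_add[OF proj_hom T.A.m_closed[OF ij] T.A.m_closed[OF ij(2,1)]] .
  qed
  show ?thesis
  proof (cases g h rule: linorder_cases)
    case less then show ?thesis using lt[of g h] assms by simp
  next
    case equal then show ?thesis using x_square assms by simp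
  next
    case greater
    then show ?thesis using lt[of h g] assms E.M.M.a_comm[of "x g \<otimes>\<^bsub>E\<^esub> x h"] by simp
  qed
qed

end

section \<open>Contractions\<close>

context exterior
begin

text \<open>The argument is a reversed word: the recursion splits off the last letter of the word.\<close>

primrec contract_word :: "nat \<Rightarrow> nat list \<Rightarrow> nat list \<Rightarrow> 'k"
  where
    "contract_word h [] = \<zero>\<^bsub>T\<^esub>"
  | "contract_word h (g # w) =
      (if g = h then single K (rev w) else \<zero>\<^bsub>T\<^esub>) \<ominus>\<^bsub>T\<^esub> contract_word h w \<otimes>\<^bsub>T\<^esub> gen g"

text \<open>On a word the result is the alternating sum over the occurrences of \<open>h\<close> of
  the word with that letter removed. Signs are counted from the right end, so removing the last
  letter has sign plus.\<close>

definition contract :: "nat \<Rightarrow> (nat list \<Rightarrow> 'k) \<Rightarrow> nat list \<Rightarrow> 'k"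
  where "contract h = free_lift K T (\<lambda>w. contract_word h (rev w))"

lemma single_word_closed': "w \<in> words n \<Longrightarrow> single K w \<in> carrier T"
  using single_word_closed by (simp add: free_algebra_simps)

lemma contract_word_closed: "w \<in> words n \<Longrightarrow> contract_word h w \<in> carrier T"
proof (induction w)
  case (Cons g w)
  then have "g \<in> {1..n}" "w \<in> words n" "rev w \<in> words n" by (auto simp: words_def)
  then show ?case using Cons.IH
    by (auto intro!: T.M.M.minus_closed T.A.m_closed gen_closed single_word_closed')
qed simp

lemma contract_hom: "contract h \<in> left_module_hom K T T"
  unfolding contract_def free_algebra_hom(1)
  by (rule free_lift_hom[OF T.M.module_axioms]) (auto intro!: contract_word_closed simp: words_def)

lemma contract_closed: "f \<in> carrier T \<Longrightarrow> contract h f \<in> carrier T"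
  by (rule left_module_hom_closed[OF contract_hom])

lemma contract_single:
  "w \<in> words n \<Longrightarrow> contract h (single K w) = contract_word h (rev w)"
  unfolding contract_def
  by (rule free_lift_single[OF T.M.module_axioms, where S = "words n"]) (auto intro!: contract_word_closed simp: words_def)

text \<open>Both sides are linear in \<open>f\<close>, and for a word the equation is the defining
  recursion.\<close>

lemma contract_gen:
  assumes f: "f \<in> carrier T" and g: "g \<in> {1..n}"
  shows "contract h (f \<otimes>\<^bsub>T\<^esub> gen g) = (if g = h then f else \<zero>\<^bsub>T\<^esub>) \<ominus>\<^bsub>T\<^esub> contract h f \<otimes>\<^bsub>T\<^esub> gen g"
proof (rule free_module_hom_eq[OF T.M.module_axioms, where S = "words n"
      and f = "\<lambda>f. contract h (f \<otimes>\<^bsub>T\<^esub> gen g)"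
      and g = "\<lambda>f. (if g = h then f else \<zero>\<^bsub>T\<^esub>) \<ominus>\<^bsub>T\<^esub> contract h f \<otimes>\<^bsub>T\<^esub> gen g"])
  note r = T.right_mult_hom[OF gen_closed[OF g]]
  show "(\<lambda>f. contract h (f \<otimes>\<^bsub>T\<^esub> gen g)) \<in> left_module_hom K W T"
    using left_module_hom_comp[OF r contract_hom] by simp
  have "(\<lambda>f. if g = h then f else \<zero>\<^bsub>T\<^esub>) \<in> left_module_hom K T T"
    using left_module_hom_id[of K T] left_module_hom_zero[OF T.M.module_axioms, of T]
    by (cases "g = h") simp_all
  from left_module_hom_diff[OF T.M.module_axioms T.M.module_axioms this
      left_module_hom_comp[OF contract_hom r]]
  show "(\<lambda>f. (if g = h then f else \<zero>\<^bsub>T\<^esub>) \<ominus>\<^bsub>T\<^esub> contract h f \<otimes>\<^bsub>T\<^esub> gen g) \<in> left_module_hom K W T"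
    by simp
  show "f \<in> carrier W" using f by (simp add: free_algebra_simps)
  fix w assume w: "w \<in> words n"
  then have "contract h (single K w \<otimes>\<^bsub>T\<^esub> gen g) = contract_word h (g # rev w)"
    using g by (simp add: free_gen_def single_mult contract_single del: contract_word.simps)
  then show "contract h (single K w \<otimes>\<^bsub>T\<^esub> gen g) =
      (if g = h then single K w else \<zero>\<^bsub>T\<^esub>) \<ominus>\<^bsub>T\<^esub> contract h (single K w) \<otimes>\<^bsub>T\<^esub> gen g"
    using w by (simp add: contract_single)
qed

text \<open>Passing two letters changes the sign twice, so the contraction of \<open>u\<close> keeps
  its sign. The bracket collects the terms in which one of the two new letters is removed.\<close>

lemma contract_gen_gen:
  assumes u: "u \<in> carrier T" and i: "i \<in> {1..n}" and j: "j \<in> {1..n}"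
  shows "contract h (u \<otimes>\<^bsub>T\<^esub> (gen i \<otimes>\<^bsub>T\<^esub> gen j)) =
    ((if j = h then u \<otimes>\<^bsub>T\<^esub> gen i else \<zero>\<^bsub>T\<^esub>) \<ominus>\<^bsub>T\<^esub> (if i = h then u \<otimes>\<^bsub>T\<^esub> gen j else \<zero>\<^bsub>T\<^esub>))
      \<oplus>\<^bsub>T\<^esub> contract h u \<otimes>\<^bsub>T\<^esub> (gen i \<otimes>\<^bsub>T\<^esub> gen j)"
proof -
  note gi = gen_closed[OF i] and gj = gen_closed[OF j] and cu = contract_closed[OF u]
  have "contract h (u \<otimes>\<^bsub>T\<^esub> (gen i \<otimes>\<^bsub>T\<^esub> gen j)) = contract h ((u \<otimes>\<^bsub>T\<^esub> gen i) \<otimes>\<^bsub>T\<^esub> gen j)"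
    using u gi gj by (simp add: T.A.m_assoc)
  also have "\<dots> = (if j = h then u \<otimes>\<^bsub>T\<^esub> gen i else \<zero>\<^bsub>T\<^esub>) \<ominus>\<^bsub>T\<^esub>
      ((if i = h then u else \<zero>\<^bsub>T\<^esub>) \<ominus>\<^bsub>T\<^esub> contract h u \<otimes>\<^bsub>T\<^esub> gen i) \<otimes>\<^bsub>T\<^esub> gen j"
    unfolding contract_gen[OF T.A.m_closed[OF u gi] j] contract_gen[OF u i] ..
  also have "\<dots> = ((if j = h then u \<otimes>\<^bsub>T\<^esub> gen i else \<zero>\<^bsub>T\<^esub>) \<ominus>\<^bsub>T\<^esub> (if i = h then u \<otimes>\<^bsub>T\<^esub> gen j else \<zero>\<^bsub>T\<^esub>))
      \<oplus>\<^bsub>T\<^esub> contract h u \<otimes>\<^bsub>T\<^esub> (gen i \<otimes>\<^bsub>T\<^esub> gen j)"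
    using u gi gj cu
    by (simp add: a_minus_def T.A.l_distr T.A.l_minus T.M.M.minus_add T.A.m_assoc T.M.M.a_ac)
  finally show ?thesis .
qed

text \<open>The relations are quadratic and chosen so that the bracket of
  \<open>contract_gen_gen\<close> disappears: for a square it is a difference of equal terms, and
  for an anticommutator the brackets of the two summands are opposite.\<close>

lemma contract_relation:
  assumes u: "u \<in> carrier T" and r: "r \<in> relations"
  shows "contract h (u \<otimes>\<^bsub>T\<^esub> r) = contract h u \<otimes>\<^bsub>T\<^esub> r"
proof -
  note cu = contract_closed[OF u]
  from r have "(\<exists>i. i \<in> {1..n} \<and> r = gen i \<otimes>\<^bsub>T\<^esub> gen i) \<or>
      (\<exists>i j. (1 \<le> i \<and> i < j \<and> j \<le> n) \<and> r = gen i \<otimes>\<^bsub>T\<^esub> gen j \<oplus>\<^bsub>T\<^esub> gen j \<otimes>\<^bsub>T\<^esub> gen i)"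
    unfolding relations_def atLeastAtMost_iff by blast
  then consider (sq) i where "i \<in> {1..n}" "r = gen i \<otimes>\<^bsub>T\<^esub> gen i"
    | (alt) i j where "1 \<le> i \<and> i < j \<and> j \<le> n" "r = gen i \<otimes>\<^bsub>T\<^esub> gen j \<oplus>\<^bsub>T\<^esub> gen j \<otimes>\<^bsub>T\<^esub> gen i"
    by blast
  then show ?thesis
  proof cases
    case sq
    note gi = gen_closed[OF sq(1)]
    have "(if i = h then u \<otimes>\<^bsub>T\<^esub> gen i else \<zero>\<^bsub>T\<^esub>) \<ominus>\<^bsub>T\<^esub> (if i = h then u \<otimes>\<^bsub>T\<^esub> gen i else \<zero>\<^bsub>T\<^esub>) = \<zero>\<^bsub>T\<^esub>"
      unfolding a_minus_def by (rule T.M.M.r_neg) (use u gi in auto)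
    then show ?thesis
      unfolding sq(2) contract_gen_gen[OF u sq(1,1)] using cu gi by simp
  next
    case alt
    then have ac: "i \<in> {1..n}" "j \<in> {1..n}" by auto
    note gi = gen_closed[OF ac(1)] and gj = gen_closed[OF ac(2)]
    have "contract h (u \<otimes>\<^bsub>T\<^esub> r) =
        contract h (u \<otimes>\<^bsub>T\<^esub> (gen i \<otimes>\<^bsub>T\<^esub> gen j)) \<oplus>\<^bsub>T\<^esub> contract h (u \<otimes>\<^bsub>T\<^esub> (gen j \<otimes>\<^bsub>T\<^esub> gen i))"
      using u gi gj by (simp add: alt(2) T.A.r_distr left_module_hom_add[OF contract_hom])
    also have "\<dots> = contract h u \<otimes>\<^bsub>T\<^esub> r"
      unfolding contract_gen_gen[OF u ac(1,2)] contract_gen_gen[OF u ac(2,1)] alt(2)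
      by (subst T.M.M.cross_cancel) (use u gi gj cu in \<open>simp_all add: T.A.r_distr\<close>)
    finally show ?thesis .
  qed
qed

lemma contract_exterior_ideal:
  assumes a: "a \<in> I"
  shows "contract h a \<in> I"
proof -
  \<comment> \<open>The quantifier over \<open>u\<close> makes \<open>J\<close> a left ideal, so that no product rule for the contraction is needed.\<close>
  define J where "J = {a \<in> I. \<forall>u\<in>carrier T. contract h (u \<otimes>\<^bsub>T\<^esub> a) \<in> I}"
  note ch = contract_hom[of h]
  have cha: "contract h \<in> add_hom T T" by (rule left_module_hom_add_hom[OF ch])
  have Jc: "\<And>a. a \<in> J \<Longrightarrow> a \<in> carrier T" and JI: "\<And>a. a \<in> J \<Longrightarrow> a \<in> I"
    and JJ: "\<And>a u. a \<in> J \<Longrightarrow> u \<in> carrier T \<Longrightarrow> contract h (u \<otimes>\<^bsub>T\<^esub> a) \<in> I"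
    unfolding J_def using I.a_Hcarr by auto
  have "ideal J T"
  proof (rule idealI[OF T.A.ring_axioms])
    show "subgroup J (add_monoid T)"
    proof (unfold subgroup_def, intro conjI ballI impI allI)
      show "J \<subseteq> carrier (add_monoid T)" using Jc by auto
      show "a \<otimes>\<^bsub>add_monoid T\<^esub> b \<in> J" if "a \<in> J" "b \<in> J" for a b
      proof -
        have "contract h (u \<otimes>\<^bsub>T\<^esub> (a \<oplus>\<^bsub>T\<^esub> b)) \<in> I" if u: "u \<in> carrier T" for u
          using I.a_closed[OF JJ[OF \<open>a \<in> J\<close> u] JJ[OF \<open>b \<in> J\<close> u]] u Jc[OF \<open>a \<in> J\<close>] Jc[OF \<open>b \<in> J\<close>]
          by (simp add: T.A.r_distr left_module_hom_add[OF ch])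
        then show ?thesis using I.a_closed[OF JI[OF that(1)] JI[OF that(2)]] by (simp add: J_def)
      qed
      have "contract h \<zero>\<^bsub>T\<^esub> = \<zero>\<^bsub>T\<^esub>"
        by (rule add_hom_zero[OF cha T.M.M.abelian_group_axioms T.M.M.abelian_group_axioms])
      then show "\<one>\<^bsub>add_monoid T\<^esub> \<in> J" using I.zero_closed by (simp add: J_def)
      show "inv\<^bsub>add_monoid T\<^esub> a \<in> J" if "a \<in> J" for a
      proof -
        have "contract h (u \<otimes>\<^bsub>T\<^esub> (\<ominus>\<^bsub>T\<^esub> a)) \<in> I" if u: "u \<in> carrier T" for u
          using I.a_inv_closed[OF JJ[OF \<open>a \<in> J\<close> u]] u Jc[OF \<open>a \<in> J\<close>]
            add_hom_minus[OF cha T.M.M.abelian_group_axioms T.M.M.abelian_group_axioms, of "u \<otimes>\<^bsub>T\<^esub> a"]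
          by (simp add: T.A.r_minus)
        then show ?thesis using I.a_inv_closed[OF JI[OF that]] by (simp add: J_def flip: a_inv_def)
      qed
    qed
    show "v \<otimes>\<^bsub>T\<^esub> a \<in> J" if "a \<in> J" "v \<in> carrier T" for a v
    proof -
      have "contract h (u \<otimes>\<^bsub>T\<^esub> (v \<otimes>\<^bsub>T\<^esub> a)) \<in> I" if u: "u \<in> carrier T" for u
        using JJ[OF \<open>a \<in> J\<close> T.A.m_closed[OF u \<open>v \<in> carrier T\<close>]] u Jc[OF \<open>a \<in> J\<close>] \<open>v \<in> carrier T\<close>
        by (simp add: T.A.m_assoc)
      then show ?thesis using I.I_l_closed[OF JI[OF that(1)] that(2)] by (simp add: J_def)
    qed
    \<comment> \<open>The right factor is built letter by letter. Removing the last letter leaves a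
      product that lies in \<open>I\<close>, which is why \<open>J\<close> is defined as a part of
      \<open>I\<close>; the other term is covered by the induction hypothesis.\<close>
    have "contract h (u \<otimes>\<^bsub>T\<^esub> (a \<otimes>\<^bsub>T\<^esub> v)) \<in> I" if a: "a \<in> J" and u: "u \<in> carrier T" and v: "v \<in> carrier T"
      for a v u
      using v
    proof (induction v rule: free_algebra_induct)
      case one
      then show ?case using JJ[OF a u] Jc[OF a] by simp
    next
      case (gen f g)
      have uaf: "u \<otimes>\<^bsub>T\<^esub> (a \<otimes>\<^bsub>T\<^esub> f) \<in> I" "u \<otimes>\<^bsub>T\<^esub> (a \<otimes>\<^bsub>T\<^esub> f) \<in> carrier T"
        using JI[OF a] u gen.hyps(1) I.I_l_closed I.I_r_closed Jc[OF a] by auto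
      have "contract h (u \<otimes>\<^bsub>T\<^esub> (a \<otimes>\<^bsub>T\<^esub> (f \<otimes>\<^bsub>T\<^esub> gen g))) = contract h ((u \<otimes>\<^bsub>T\<^esub> (a \<otimes>\<^bsub>T\<^esub> f)) \<otimes>\<^bsub>T\<^esub> gen g)"
        using u Jc[OF a] gen.hyps gen_closed by (simp add: T.A.m_assoc)
      also have "\<dots> = (if g = h then u \<otimes>\<^bsub>T\<^esub> (a \<otimes>\<^bsub>T\<^esub> f) else \<zero>\<^bsub>T\<^esub>) \<ominus>\<^bsub>T\<^esub>
          contract h (u \<otimes>\<^bsub>T\<^esub> (a \<otimes>\<^bsub>T\<^esub> f)) \<otimes>\<^bsub>T\<^esub> gen g"
        by (rule contract_gen[OF uaf(2) gen.hyps(2)])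
      also have "\<dots> \<in> I"
        using uaf(1) I.zero_closed I.I_r_closed[OF gen.IH gen_closed[OF gen.hyps(2)]]
        unfolding a_minus_def by (intro I.a_closed I.a_inv_closed) auto
      finally show ?case .
    next
      case (add f g)
      then show ?case
        using u Jc[OF a] by (simp add: T.A.r_distr left_module_hom_add[OF ch])
    next
      case (smult c f)
      then have "contract h (u \<otimes>\<^bsub>T\<^esub> (a \<otimes>\<^bsub>T\<^esub> (c \<odot>\<^bsub>T\<^esub> f))) = c \<odot>\<^bsub>T\<^esub> contract h (u \<otimes>\<^bsub>T\<^esub> (a \<otimes>\<^bsub>T\<^esub> f))"
        using u Jc[OF a] by (simp add: T.mult_smult_right left_module_hom_smult[OF ch])
      then show ?case
        using smult exterior_ideal_submodule
        unfolding submodule_iff[OF T.M.M.abelian_group_axioms] by simp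
    qed
    then show "a \<otimes>\<^bsub>T\<^esub> v \<in> J" if "a \<in> J" "v \<in> carrier T" for a v
      using that I.I_r_closed[OF JI[OF that(1)] that(2)] by (simp add: J_def)
  qed
  moreover have "relations \<subseteq> J"
  proof
    fix r assume r: "r \<in> relations"
    then have "r \<in> I"
      unfolding exterior_ideal_eq using T.A.genideal_self[OF relations_carrier] by auto
    then show "r \<in> J"
      using I.I_l_closed contract_closed by (auto simp: J_def contract_relation[OF _ r])
  qed
  ultimately have "I \<subseteq> J"
    unfolding exterior_ideal_eq by (rule T.A.genideal_minimal)
  then have "contract h (\<one>\<^bsub>T\<^esub> \<otimes>\<^bsub>T\<^esub> a) \<in> I" using a JJ by blast
  then show ?thesis using I.a_Hcarr[OF a] by simp
qed

definition ext_contract :: "nat \<Rightarrow> 'k ext \<Rightarrow> 'k ext"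
  where "ext_contract h a = proj (contract h (SOME f. f \<in> a))"

text \<open>Two representatives differ by an element of the ideal, and its contraction lies in the
  ideal again.\<close>

lemma ext_contract_proj:
  assumes f: "f \<in> carrier T"
  shows "ext_contract h (proj f) = proj (contract h f)"
proof -
  have "(SOME r. r \<in> proj f) \<in> proj f"
    unfolding proj_def by (rule someI[where P = "\<lambda>r. r \<in> I +>\<^bsub>T\<^esub> f", OF I.a_rcos_self[OF f]])
  then obtain i where i: "i \<in> I" "(SOME r. r \<in> proj f) = i \<oplus>\<^bsub>T\<^esub> f"
    unfolding proj_def a_r_coset_def' by blast
  note ic = I.a_Hcarr[OF i(1)]
  show ?thesis
    unfolding ext_contract_def i(2)
    using left_module_hom_add[OF contract_hom ic f]
      left_module_hom_add[OF proj_hom contract_closed[OF ic] contract_closed[OF f]]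
      proj_ideal[OF contract_exterior_ideal[OF i(1)]] proj_closed[OF contract_closed[OF f]]
    by simp
qed

lemma ext_contract_hom: "ext_contract h \<in> left_module_hom K E E"
proof (rule left_module_homI)
  fix a assume "a \<in> carrier E"
  then obtain f where f: "f \<in> carrier T" "a = proj f" by (rule proj_cases)
  show "ext_contract h a \<in> carrier E"
    using f by (simp add: ext_contract_proj proj_closed contract_closed)
  show "ext_contract h (c \<odot>\<^bsub>E\<^esub> a) = c \<odot>\<^bsub>E\<^esub> ext_contract h a" if "c \<in> carrier K" for c
    using that f
    by (simp add: left_module_hom_smult[OF proj_hom, symmetric] ext_contract_proj contract_closed
        left_module_hom_smult[OF contract_hom])
  fix b assume "b \<in> carrier E"
  then obtain g where g: "g \<in> carrier T" "b = proj g" by (rule proj_cases)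
  show "ext_contract h (a \<oplus>\<^bsub>E\<^esub> b) = ext_contract h a \<oplus>\<^bsub>E\<^esub> ext_contract h b"
    using g f
    by (simp add: left_module_hom_add[OF proj_hom, symmetric] ext_contract_proj contract_closed
        left_module_hom_add[OF contract_hom])
qed

lemma ext_contract_closed: "a \<in> carrier E \<Longrightarrow> ext_contract h a \<in> carrier E"
  by (rule left_module_hom_closed[OF ext_contract_hom])

text \<open>The rule of \<open>contract_gen\<close> is written as a sum because the two parts of the
  homotopy identity will be added.\<close>

lemma ext_contract_x:
  assumes a: "a \<in> carrier E" and g: "g \<in> {1..n}"
  shows "ext_contract h (a \<otimes>\<^bsub>E\<^esub> x g) \<oplus>\<^bsub>E\<^esub> ext_contract h a \<otimes>\<^bsub>E\<^esub> x g = (if g = h then a else \<zero>\<^bsub>E\<^esub>)"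
proof -
  obtain f where f: "f \<in> carrier T" "a = proj f" using a by (rule proj_cases)
  note gg = gen_closed[OF g] and cf = contract_closed[OF f(1)]
  have "ext_contract h (a \<otimes>\<^bsub>E\<^esub> x g) \<oplus>\<^bsub>E\<^esub> ext_contract h a \<otimes>\<^bsub>E\<^esub> x g =
      proj (contract h (f \<otimes>\<^bsub>T\<^esub> gen g) \<oplus>\<^bsub>T\<^esub> contract h f \<otimes>\<^bsub>T\<^esub> gen g)"
    unfolding f(2) ext_gen_eq
    using f(1) gg cf
    by (simp add: proj_mult[symmetric] ext_contract_proj contract_closed
        left_module_hom_add[OF proj_hom, symmetric])
  also have "contract h (f \<otimes>\<^bsub>T\<^esub> gen g) \<oplus>\<^bsub>T\<^esub> contract h f \<otimes>\<^bsub>T\<^esub> gen g = (if g = h then f else \<zero>\<^bsub>T\<^esub>)"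
    using f(1) gg cf by (simp add: contract_gen[OF f(1) g] a_minus_def T.M.M.a_assoc T.M.M.l_neg)
  finally show ?thesis using f(2) proj_ideal[OF I.zero_closed] by auto
qed

section \<open>Moving a generator across an element\<close>

text \<open>The witness is \<open>a\<close> with a sign on its parts of odd degree. The existential
  form makes a grading of the exterior algebra unnecessary.\<close>

lemma x_commute:
  assumes a: "a \<in> carrier E" and h: "h \<in> {1..n}"
  shows "\<exists>b\<in>carrier E. x h \<otimes>\<^bsub>E\<^esub> a = b \<otimes>\<^bsub>E\<^esub> x h"
  using a
proof (induction a rule: ext_induct)
  case one
  then show ?case using h by (intro bexI[of _ "\<one>\<^bsub>E\<^esub>"]) auto
next
  case (gen a g)
  then obtain b where b: "b \<in> carrier E" "x h \<otimes>\<^bsub>E\<^esub> a = b \<otimes>\<^bsub>E\<^esub> x h" by blast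
  have "x h \<otimes>\<^bsub>E\<^esub> x g = \<ominus>\<^bsub>E\<^esub> (x g \<otimes>\<^bsub>E\<^esub> x h)"
    using x_anticommute[OF h gen.hyps(2)] h gen.hyps(2) by (intro E.M.M.minus_equality[symmetric]) auto
  then have "x h \<otimes>\<^bsub>E\<^esub> (a \<otimes>\<^bsub>E\<^esub> x g) = (\<ominus>\<^bsub>E\<^esub> (b \<otimes>\<^bsub>E\<^esub> x g)) \<otimes>\<^bsub>E\<^esub> x h"
    using gen.hyps h b
    by (simp add: E.A.m_assoc[symmetric]) (simp add: E.A.m_assoc E.A.l_minus E.A.r_minus)
  then show ?case using gen.hyps b by (intro bexI[of _ "\<ominus>\<^bsub>E\<^esub> (b \<otimes>\<^bsub>E\<^esub> x g)"]) auto
next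
  case (add a a')
  then obtain b b' where "b \<in> carrier E" "x h \<otimes>\<^bsub>E\<^esub> a = b \<otimes>\<^bsub>E\<^esub> x h"
    "b' \<in> carrier E" "x h \<otimes>\<^bsub>E\<^esub> a' = b' \<otimes>\<^bsub>E\<^esub> x h" by blast
  then show ?case using add.hyps h
    by (intro bexI[of _ "b \<oplus>\<^bsub>E\<^esub> b'"]) (auto simp: E.A.l_distr E.A.r_distr)
next
  case (smult c a)
  then obtain b where "b \<in> carrier E" "x h \<otimes>\<^bsub>E\<^esub> a = b \<otimes>\<^bsub>E\<^esub> x h" by blast
  then show ?case using smult.hyps h
    by (intro bexI[of _ "c \<odot>\<^bsub>E\<^esub> b"]) (auto simp: E.mult_smult_left E.mult_smult_right)
qed

text \<open>Moving the first generator across \<open>a\<close> brings the two copies next to each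
  other, where they square to zero.\<close>

lemma x_sandwich:
  assumes a: "a \<in> carrier E" and h: "h \<in> {1..n}"
  shows "x h \<otimes>\<^bsub>E\<^esub> a \<otimes>\<^bsub>E\<^esub> x h = \<zero>\<^bsub>E\<^esub>"
proof -
  obtain b where "b \<in> carrier E" "x h \<otimes>\<^bsub>E\<^esub> a = b \<otimes>\<^bsub>E\<^esub> x h" using x_commute[OF a h] by blast
  then show ?thesis using h by (simp add: E.A.m_assoc x_square)
qed

sublocale reg: bimodule K E E "mult E" "mult E"
  by (rule E.regular_bimodule)

section \<open>Coefficients of the differential and contractions in the enveloping algebra\<close>

abbreviation "A \<equiv> ext_env K n"
abbreviation "pe \<equiv> pure_tensor K E (opposite E)"
abbreviation "X h \<equiv> pe (x h) \<one>\<^bsub>E\<^esub>"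
abbreviation "Y h \<equiv> pe \<one>\<^bsub>E\<^esub> (x h)"

lemma X_closed [simp]: "h \<in> {1..n} \<Longrightarrow> X h \<in> carrier A"
  by (simp add: reg.pe_closed)

lemma Y_closed [simp]: "h \<in> {1..n} \<Longrightarrow> Y h \<in> carrier A"
  by (simp add: reg.pe_closed)

lemma pe_add_left:
  "a \<in> carrier E \<Longrightarrow> a' \<in> carrier E \<Longrightarrow> b \<in> carrier E \<Longrightarrow> pe (a \<oplus>\<^bsub>E\<^esub> a') b = pe a b \<oplus>\<^bsub>A\<^esub> pe a' b"
  by (rule bilinear_add_left[OF reg.pe_bilinear])

lemma pe_add_right:
  "a \<in> carrier E \<Longrightarrow> b \<in> carrier E \<Longrightarrow> b' \<in> carrier E \<Longrightarrow> pe a (b \<oplus>\<^bsub>E\<^esub> b') = pe a b \<oplus>\<^bsub>A\<^esub> pe a b'"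
  by (rule bilinear_add_right[OF reg.pe_bilinear])

lemma pe_zero_left: "b \<in> carrier E \<Longrightarrow> pe \<zero>\<^bsub>E\<^esub> b = \<zero>\<^bsub>A\<^esub>"
  using add_hom_zero[OF left_module_hom_add_hom[OF bilinear_left[OF reg.pe_bilinear]]
      E.M.M.abelian_group_axioms reg.E.M.M.abelian_group_axioms] by simp

lemma pe_zero_right: "a \<in> carrier E \<Longrightarrow> pe a \<zero>\<^bsub>E\<^esub> = \<zero>\<^bsub>A\<^esub>"
  using add_hom_zero[OF left_module_hom_add_hom[OF bilinear_right[OF reg.pe_bilinear]]
      E.M.M.abelian_group_axioms reg.E.M.M.abelian_group_axioms] by simp

lemma X_sandwich:
  assumes "Z \<in> carrier A" "h \<in> {1..n}"
  shows "X h \<otimes>\<^bsub>A\<^esub> Z \<otimes>\<^bsub>A\<^esub> X h = \<zero>\<^bsub>A\<^esub>"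
  using assms(1)
proof (induction Z rule: reg.enveloping_induct)
  case (pure a b)
  then show ?case using assms(2) by (simp add: reg.pe_mult x_sandwich pe_zero_left)
next
  case (add y z)
  then show ?case using assms(2) by (simp add: reg.E.A.l_distr reg.E.A.r_distr)
qed

lemma Y_sandwich:
  assumes "Z \<in> carrier A" "h \<in> {1..n}"
  shows "Y h \<otimes>\<^bsub>A\<^esub> Z \<otimes>\<^bsub>A\<^esub> Y h = \<zero>\<^bsub>A\<^esub>"
  using assms(1)
proof (induction Z rule: reg.enveloping_induct)
  case (pure a b)
  then show ?case using assms(2)
    by (simp add: reg.pe_mult x_sandwich pe_zero_right flip: E.A.m_assoc)
next
  case (add y z)
  then show ?case using assms(2) by (simp add: reg.E.A.l_distr reg.E.A.r_distr)
qed

text \<open>With \<open>s = (-1)\<^sup>m\<close> these are the coefficients of the differential in degree \<open>m\<close>.\<close>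

definition y :: "'k \<Rightarrow> nat \<Rightarrow> 'k ext_env"
  where "y s h = X h \<oplus>\<^bsub>A\<^esub> s \<odot>\<^bsub>A\<^esub> Y h"

lemma y_closed [simp]: "s \<in> carrier K \<Longrightarrow> h \<in> {1..n} \<Longrightarrow> y s h \<in> carrier A"
  by (simp add: y_def)

text \<open>Consecutive differentials have opposite signs, so products of this form are the
  coefficients of their composite. The first bracket has the products within one tensor factor,
  reversed in the right factor because of the opposite multiplication; the second has the mixed
  products.\<close>

lemma y_mult:
  assumes s: "s \<in> carrier K" and g: "g \<in> {1..n}" and h: "h \<in> {1..n}"
  shows "y (\<ominus>\<^bsub>K\<^esub> s) g \<otimes>\<^bsub>A\<^esub> y s h =
    (pe (x g \<otimes>\<^bsub>E\<^esub> x h) \<one>\<^bsub>E\<^esub> \<ominus>\<^bsub>A\<^esub> (s \<otimes>\<^bsub>K\<^esub> s) \<odot>\<^bsub>A\<^esub> pe \<one>\<^bsub>E\<^esub> (x h \<otimes>\<^bsub>E\<^esub> x g)) \<oplus>\<^bsub>A\<^esub>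
      (s \<odot>\<^bsub>A\<^esub> pe (x g) (x h) \<ominus>\<^bsub>A\<^esub> s \<odot>\<^bsub>A\<^esub> pe (x h) (x g))"
proof -
  have c: "pe (x g \<otimes>\<^bsub>E\<^esub> x h) \<one>\<^bsub>E\<^esub> \<in> carrier A" "pe \<one>\<^bsub>E\<^esub> (x h \<otimes>\<^bsub>E\<^esub> x g) \<in> carrier A"
    "pe (x g) (x h) \<in> carrier A" "pe (x h) (x g) \<in> carrier A"
    using g h by (auto intro!: reg.pe_closed)
  show ?thesis
    using s g h c
    by (simp add: y_def reg.E.M.smult_l_minus reg.E.A.l_distr reg.E.A.r_distr reg.E.A.l_minus
        reg.E.mult_smult_left reg.E.mult_smult_right reg.pe_mult reg.E.M.smult_r_distr
        reg.E.M.smult_assoc1 reg.E.M.smult_r_minus a_minus_def reg.E.M.M.minus_add reg.E.M.M.a_ac)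
qed

lemma y_square:
  assumes s: "s \<in> carrier K" and g: "g \<in> {1..n}"
  shows "y (\<ominus>\<^bsub>K\<^esub> s) g \<otimes>\<^bsub>A\<^esub> y s g = \<zero>\<^bsub>A\<^esub>"
  unfolding y_mult[OF s g g]
  using s g by (simp add: x_square pe_zero_left pe_zero_right reg.pe_closed
      reg.E.M.M.r_neg a_minus_def)

lemma y_anticommute:
  assumes s: "s \<in> carrier K" and g: "g \<in> {1..n}" and h: "h \<in> {1..n}"
  shows "y (\<ominus>\<^bsub>K\<^esub> s) g \<otimes>\<^bsub>A\<^esub> y s h \<oplus>\<^bsub>A\<^esub> y (\<ominus>\<^bsub>K\<^esub> s) h \<otimes>\<^bsub>A\<^esub> y s g = \<zero>\<^bsub>A\<^esub>"
proof -
  \<comment> \<open>Products in the left factor, products in the right factor, and mixed products.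
    \<open>P\<close> and \<open>Q\<close> cancel under exchange of \<open>g\<close> and
    \<open>h\<close> because the generators anticommute. The mixed part is a difference that changes
    sign under the exchange.\<close>
  define P where "P g h = pe (x g \<otimes>\<^bsub>E\<^esub> x h) \<one>\<^bsub>E\<^esub>" for g h
  define Q where "Q g h = (s \<otimes>\<^bsub>K\<^esub> s) \<odot>\<^bsub>A\<^esub> pe \<one>\<^bsub>E\<^esub> (x h \<otimes>\<^bsub>E\<^esub> x g)" for g h
  define R where "R g h = s \<odot>\<^bsub>A\<^esub> pe (x g) (x h)" for g h
  have cl: "P g h \<in> carrier A" "P h g \<in> carrier A" "Q g h \<in> carrier A" "Q h g \<in> carrier A"
    "R g h \<in> carrier A" "R h g \<in> carrier A"
    using s g h by (auto simp: P_def Q_def R_def intro!: reg.pe_closed reg.E.M.smult_closed)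
  have P: "P g h \<oplus>\<^bsub>A\<^esub> P h g = \<zero>\<^bsub>A\<^esub>"
    unfolding P_def using g h
    by (simp add: pe_add_left[symmetric] x_anticommute pe_zero_left)
  have Q: "Q g h \<oplus>\<^bsub>A\<^esub> Q h g = \<zero>\<^bsub>A\<^esub>"
    unfolding Q_def using g h s
    by (simp add: reg.E.M.smult_r_distr[symmetric] reg.pe_closed pe_add_right[symmetric]
        x_anticommute pe_zero_right)
  have "y (\<ominus>\<^bsub>K\<^esub> s) g \<otimes>\<^bsub>A\<^esub> y s h \<oplus>\<^bsub>A\<^esub> y (\<ominus>\<^bsub>K\<^esub> s) h \<otimes>\<^bsub>A\<^esub> y s g =
      ((P g h \<ominus>\<^bsub>A\<^esub> Q g h) \<oplus>\<^bsub>A\<^esub> (R g h \<ominus>\<^bsub>A\<^esub> R h g)) \<oplus>\<^bsub>A\<^esub>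
      ((P h g \<ominus>\<^bsub>A\<^esub> Q h g) \<oplus>\<^bsub>A\<^esub> (R h g \<ominus>\<^bsub>A\<^esub> R g h))"
    unfolding y_mult[OF s g h] y_mult[OF s h g] P_def Q_def R_def ..
  also have "\<dots> = ((P g h \<oplus>\<^bsub>A\<^esub> P h g) \<ominus>\<^bsub>A\<^esub> (Q g h \<oplus>\<^bsub>A\<^esub> Q h g)) \<oplus>\<^bsub>A\<^esub>
      ((R g h \<ominus>\<^bsub>A\<^esub> R g h) \<oplus>\<^bsub>A\<^esub> (R h g \<ominus>\<^bsub>A\<^esub> R h g))"
    using cl by (simp add: a_minus_def reg.E.M.M.minus_add reg.E.M.M.a_ac)
  also have "\<dots> = \<zero>\<^bsub>A\<^esub>"
    using cl by (simp add: P Q a_minus_def reg.E.M.M.r_neg)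
  finally show ?thesis .
qed

definition env_contract :: "nat \<Rightarrow> 'k ext_env \<Rightarrow> 'k ext_env"
  where "env_contract h = tensor_lift K A (\<lambda>a b. pe (ext_contract h a) b)"

lemma env_contract_bilinear: "bilinear K E (opposite E) A (\<lambda>a b. pe (ext_contract h a) b)"
proof -
  have "bilinear K E (opposite E) A pe" using reg.pe_bilinear by (simp add: bilinear_def)
  from bilinear_compose[OF this ext_contract_hom left_module_hom_id] show ?thesis by simp
qed

lemma env_contract_hom: "env_contract h \<in> left_module_hom K A A"
  unfolding env_contract_def reg.enveloping_algebra_hom
  by (rule tensor_lift_hom[OF reg.AAop reg.E.M.module_axioms env_contract_bilinear])

lemma env_contract_closed: "Z \<in> carrier A \<Longrightarrow> env_contract h Z \<in> carrier A"
  by (rule left_module_hom_closed[OF env_contract_hom])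

lemma env_contract_pure:
  "a \<in> carrier E \<Longrightarrow> b \<in> carrier E \<Longrightarrow> env_contract h (pe a b) = pe (ext_contract h a) b"
  unfolding env_contract_def
  using tensor_lift_pure[OF reg.AAop reg.E.M.module_axioms env_contract_bilinear, of a b] by simp

text \<open>The contraction does not touch the right tensor factor, so the contributions of
  \<open>Y g\<close> carry \<open>s\<close> in one summand and its negative in the other and cancel.
  What is left is \<open>ext_contract_x\<close> in the left factor.\<close>

lemma env_contract_y:
  assumes Z: "Z \<in> carrier A" and s: "s \<in> carrier K" and g: "g \<in> {1..n}"
  shows "env_contract h (Z \<otimes>\<^bsub>A\<^esub> y s g) \<oplus>\<^bsub>A\<^esub> env_contract h Z \<otimes>\<^bsub>A\<^esub> y (\<ominus>\<^bsub>K\<^esub> s) g =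
    (if g = h then Z else \<zero>\<^bsub>A\<^esub>)"
  using Z
proof (induction Z rule: reg.enveloping_induct)
  case (pure a b)
  let ?D = "ext_contract h"
  note Da = ext_contract_closed[OF pure(1), of h]
  \<comment> \<open>The sign is a bound variable here because the formula is used for
    \<open>s\<close> and for its negative.\<close>
  have mul: "pe a' b \<otimes>\<^bsub>A\<^esub> y s g = pe (a' \<otimes>\<^bsub>E\<^esub> x g) b \<oplus>\<^bsub>A\<^esub> s \<odot>\<^bsub>A\<^esub> pe a' (x g \<otimes>\<^bsub>E\<^esub> b)"
    if "a' \<in> carrier E" "s \<in> carrier K" for a' s
    using that pure g
    by (simp add: y_def reg.E.A.r_distr reg.E.mult_smult_right reg.pe_mult reg.pe_closed)
  have c: "pe (?D (a \<otimes>\<^bsub>E\<^esub> x g)) b \<in> carrier A" "pe (?D a) (x g \<otimes>\<^bsub>E\<^esub> b) \<in> carrier A"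
    "pe (?D a \<otimes>\<^bsub>E\<^esub> x g) b \<in> carrier A" "pe (a \<otimes>\<^bsub>E\<^esub> x g) b \<in> carrier A" "pe a (x g \<otimes>\<^bsub>E\<^esub> b) \<in> carrier A"
    using pure g by (auto intro!: reg.pe_closed ext_contract_closed)
  have "env_contract h (pe a b \<otimes>\<^bsub>A\<^esub> y s g) \<oplus>\<^bsub>A\<^esub> env_contract h (pe a b) \<otimes>\<^bsub>A\<^esub> y (\<ominus>\<^bsub>K\<^esub> s) g =
      (pe (?D (a \<otimes>\<^bsub>E\<^esub> x g)) b \<oplus>\<^bsub>A\<^esub> s \<odot>\<^bsub>A\<^esub> pe (?D a) (x g \<otimes>\<^bsub>E\<^esub> b)) \<oplus>\<^bsub>A\<^esub>
      (pe (?D a \<otimes>\<^bsub>E\<^esub> x g) b \<oplus>\<^bsub>A\<^esub> (\<ominus>\<^bsub>K\<^esub> s) \<odot>\<^bsub>A\<^esub> pe (?D a) (x g \<otimes>\<^bsub>E\<^esub> b))"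
    using pure g s Da c
    by (simp add: mul left_module_hom_add[OF env_contract_hom]
        left_module_hom_smult[OF env_contract_hom] env_contract_pure)
  also have "\<dots> = (pe (?D (a \<otimes>\<^bsub>E\<^esub> x g)) b \<oplus>\<^bsub>A\<^esub> pe (?D a \<otimes>\<^bsub>E\<^esub> x g) b) \<oplus>\<^bsub>A\<^esub>
      (s \<odot>\<^bsub>A\<^esub> pe (?D a) (x g \<otimes>\<^bsub>E\<^esub> b) \<oplus>\<^bsub>A\<^esub> \<ominus>\<^bsub>A\<^esub> (s \<odot>\<^bsub>A\<^esub> pe (?D a) (x g \<otimes>\<^bsub>E\<^esub> b)))"
    using s c by (simp add: reg.E.M.smult_l_minus reg.E.M.M.a_ac)
  also have "\<dots> = pe (?D (a \<otimes>\<^bsub>E\<^esub> x g) \<oplus>\<^bsub>E\<^esub> ?D a \<otimes>\<^bsub>E\<^esub> x g) b"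
    using s c pure g Da
    by (simp add: reg.E.M.M.r_neg pe_add_left ext_contract_closed)
  also have "\<dots> = (if g = h then pe a b else \<zero>\<^bsub>A\<^esub>)"
    using pure by (simp add: ext_contract_x[OF pure(1) g] pe_zero_left)
  finally show ?case .
next
  case (add V Z)
  note c = env_contract_closed[OF add.hyps(1), of h] env_contract_closed[OF add.hyps(2), of h]
  have "env_contract h ((V \<oplus>\<^bsub>A\<^esub> Z) \<otimes>\<^bsub>A\<^esub> y s g) \<oplus>\<^bsub>A\<^esub> env_contract h (V \<oplus>\<^bsub>A\<^esub> Z) \<otimes>\<^bsub>A\<^esub> y (\<ominus>\<^bsub>K\<^esub> s) g =
      (env_contract h (V \<otimes>\<^bsub>A\<^esub> y s g) \<oplus>\<^bsub>A\<^esub> env_contract h V \<otimes>\<^bsub>A\<^esub> y (\<ominus>\<^bsub>K\<^esub> s) g) \<oplus>\<^bsub>A\<^esub>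
      (env_contract h (Z \<otimes>\<^bsub>A\<^esub> y s g) \<oplus>\<^bsub>A\<^esub> env_contract h Z \<otimes>\<^bsub>A\<^esub> y (\<ominus>\<^bsub>K\<^esub> s) g)"
    using add.hyps c s g
    by (simp add: reg.E.A.l_distr left_module_hom_add[OF env_contract_hom]
        env_contract_closed reg.E.M.M.a_ac)
  then show ?case using add by simp
qed

end

section \<open>Free left modules with a finite basis\<close>

text \<open>Freeness is expressed by linear coordinate functions: \<open>expand\<close> says that
  the basis spans, and \<open>c_smult\<close> with \<open>c_e\<close> makes coefficients unique.
  Concrete coordinates are available for the complex, and maps can then be written as finite sums
  over \<open>B\<close>.\<close>

locale based_module = left_module R P
  for R :: "('r, 'e) ring_scheme" and P :: "('r, 'a, 'm) module_scheme" +
  fixes B :: "'i set" and e :: "'i \<Rightarrow> 'a" and c :: "'i \<Rightarrow> 'a \<Rightarrow> 'r"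
  assumes finite_basis: "finite B"
    and e_closed: "i \<in> B \<Longrightarrow> e i \<in> carrier P"
    and c_closed: "i \<in> B \<Longrightarrow> p \<in> carrier P \<Longrightarrow> c i p \<in> carrier R"
    and c_add: "i \<in> B \<Longrightarrow> p \<in> carrier P \<Longrightarrow> q \<in> carrier P \<Longrightarrow> c i (p \<oplus>\<^bsub>P\<^esub> q) = c i p \<oplus>\<^bsub>R\<^esub> c i q"
    and c_smult: "i \<in> B \<Longrightarrow> a \<in> carrier R \<Longrightarrow> p \<in> carrier P \<Longrightarrow> c i (a \<odot>\<^bsub>P\<^esub> p) = a \<otimes>\<^bsub>R\<^esub> c i p"
    and c_e: "i \<in> B \<Longrightarrow> j \<in> B \<Longrightarrow> c i (e j) = (if i = j then \<one>\<^bsub>R\<^esub> else \<zero>\<^bsub>R\<^esub>)"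
    and expand: "p \<in> carrier P \<Longrightarrow> p = finsum P (\<lambda>i. c i p \<odot>\<^bsub>P\<^esub> e i) B"
begin

lemma basis_induct [consumes 1, case_names smult zero add]:
  assumes p: "p \<in> carrier P"
    and s: "\<And>a i. a \<in> carrier R \<Longrightarrow> i \<in> B \<Longrightarrow> Q (a \<odot>\<^bsub>P\<^esub> e i)"
    and z: "Q \<zero>\<^bsub>P\<^esub>"
    and ad: "\<And>p q. p \<in> carrier P \<Longrightarrow> q \<in> carrier P \<Longrightarrow> Q p \<Longrightarrow> Q q \<Longrightarrow> Q (p \<oplus>\<^bsub>P\<^esub> q)"
  shows "Q p"
proof -
  have cl: "c i p \<odot>\<^bsub>P\<^esub> e i \<in> carrier P" if "i \<in> B" for i
    using that p by (intro smult_closed c_closed e_closed)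
  have "Q (finsum P (\<lambda>i. c i p \<odot>\<^bsub>P\<^esub> e i) C)" if "C \<subseteq> B" for C
    using finite_subset[OF that finite_basis] that
  proof (induction C rule: finite_induct)
    case empty
    show ?case using z by simp
  next
    case (insert i C)
    have f: "(\<lambda>i. c i p \<odot>\<^bsub>P\<^esub> e i) \<in> C \<rightarrow> carrier P" using insert.prems cl by auto
    show ?case
      using insert cl f p c_closed
      by (simp add: M.finsum_insert ad s)
  qed
  then show ?thesis by (subst expand[OF p]) blast
qed

lemma hom_eq:
  assumes "left_module R N" "f \<in> left_module_hom R P N" "g \<in> left_module_hom R P N"
    and "\<And>i. i \<in> B \<Longrightarrow> f (e i) = g (e i)" and p: "p \<in> carrier P"
  shows "f p = g p"
proof -
  interpret N: left_module R N by fact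
  note ha = left_module_hom_add_hom
  show ?thesis using p
  proof (induction p rule: basis_induct)
    case (smult a i)
    then show ?case
      by (simp add: left_module_hom_smult[OF assms(2)] left_module_hom_smult[OF assms(3)] e_closed assms(4))
  next
    case zero
    then show ?case
      using add_hom_zero[OF ha[OF assms(2)] M.abelian_group_axioms N.M.abelian_group_axioms]
        add_hom_zero[OF ha[OF assms(3)] M.abelian_group_axioms N.M.abelian_group_axioms] by simp
  next
    case (add p q)
    then show ?case
      by (simp add: left_module_hom_add[OF assms(2)] left_module_hom_add[OF assms(3)])
  qed
qed

definition extend :: "('r, 'b, 'n) module_scheme \<Rightarrow> ('i \<Rightarrow> 'b) \<Rightarrow> 'a \<Rightarrow> 'b"
  where "extend N v p = finsum N (\<lambda>i. c i p \<odot>\<^bsub>N\<^esub> v i) B"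

lemma extend_hom:
  assumes "left_module R N" "\<And>i. i \<in> B \<Longrightarrow> v i \<in> carrier N"
  shows "extend N v \<in> left_module_hom R P N"
proof -
  interpret N: left_module R N by fact
  have cl: "(\<lambda>i. c i p \<odot>\<^bsub>N\<^esub> v i) \<in> B \<rightarrow> carrier N" if "p \<in> carrier P" for p
    using that assms(2) c_closed N.smult_closed by auto
  show ?thesis
  proof (rule left_module_homI)
    fix p assume p: "p \<in> carrier P"
    show "extend N v p \<in> carrier N" unfolding extend_def by (rule N.M.finsum_closed[OF cl[OF p]])
    show "extend N v (a \<odot>\<^bsub>P\<^esub> p) = a \<odot>\<^bsub>N\<^esub> extend N v p" if a: "a \<in> carrier R" for a
    proof -
      have "extend N v (a \<odot>\<^bsub>P\<^esub> p) = finsum N (\<lambda>i. a \<odot>\<^bsub>N\<^esub> (c i p \<odot>\<^bsub>N\<^esub> v i)) B"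
        unfolding extend_def
        using p a assms(2) c_closed
        by (intro N.M.finsum_cong') (auto simp: c_smult N.smult_assoc1 intro!: N.smult_closed)
      then show ?thesis
        unfolding extend_def using left_module_smult_finsum[OF assms(1) a cl[OF p]] by simp
    qed
    fix q assume q: "q \<in> carrier P"
    have "extend N v (p \<oplus>\<^bsub>P\<^esub> q) = finsum N (\<lambda>i. c i p \<odot>\<^bsub>N\<^esub> v i \<oplus>\<^bsub>N\<^esub> c i q \<odot>\<^bsub>N\<^esub> v i) B"
      unfolding extend_def
      using p q assms(2) c_closed
      by (intro N.M.finsum_cong') (auto simp: c_add N.smult_l_distr intro!: N.smult_closed N.M.a_closed)
    then show "extend N v (p \<oplus>\<^bsub>P\<^esub> q) = extend N v p \<oplus>\<^bsub>N\<^esub> extend N v q"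
      unfolding extend_def using N.M.finsum_addf[OF cl[OF p] cl[OF q]] by simp
  qed
qed

lemma extend_e:
  assumes "left_module R N" "\<And>i. i \<in> B \<Longrightarrow> v i \<in> carrier N" "j \<in> B"
  shows "extend N v (e j) = v j"
proof -
  interpret N: left_module R N by fact
  have "extend N v (e j) = finsum N (\<lambda>i. if j = i then v i else \<zero>\<^bsub>N\<^esub>) B"
    unfolding extend_def
    using assms(2,3)
    by (intro N.M.finsum_cong') (auto simp: c_e N.smult_one left_module_smult_zero[OF assms(1)])
  also have "\<dots> = v j"
    using assms(2,3) finite_basis by (intro N.M.finsum_singleton) auto
  finally show ?thesis .
qed

text \<open>A lift is obtained by choosing preimages of the images of the basis elements and
  extending linearly.\<close>

lemma projective: "projective_module (tc :: 'c itself) (td :: 'd itself) R P"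
  unfolding projective_module_def
proof (intro conjI allI impI)
  show "left_module R P" by (rule left_module_axioms)
  fix M :: "('r, 'c) module" and N :: "('r, 'd) module" and g f
  assume "left_module R M \<and> left_module R N \<and> g \<in> left_module_hom R M N \<and>
    g ` carrier M = carrier N \<and> f \<in> left_module_hom R P N"
  then have M: "left_module R M" and N: "left_module R N" and g: "g \<in> left_module_hom R M N"
    and sur: "g ` carrier M = carrier N" and f: "f \<in> left_module_hom R P N" by auto
  have "\<forall>i\<in>B. \<exists>v. v \<in> carrier M \<and> g v = f (e i)"
    using left_module_hom_closed[OF f e_closed] sur by (metis imageE)
  then obtain v where v: "\<And>i. i \<in> B \<Longrightarrow> v i \<in> carrier M" "\<And>i. i \<in> B \<Longrightarrow> g (v i) = f (e i)"
    by metis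
  note h = extend_hom[OF M v(1)]
  have ve: "extend M v (e i) = v i" if "i \<in> B" for i
    by (rule extend_e[OF M _ that]) (rule v(1))
  have "g (extend M v p) = f p" if "p \<in> carrier P" for p
  proof (rule hom_eq[OF N left_module_hom_comp[OF h g] f _ that])
    fix i assume "i \<in> B"
    then show "g (extend M v (e i)) = f (e i)" using ve v(2) by simp
  qed
  then show "\<exists>h\<in>left_module_hom R P M. \<forall>x\<in>carrier P. g (h x) = f x"
    by (intro bexI[OF _ h] ballI)
qed

end

section \<open>Coefficients of the elements f\<close>

lemma multi_indices_lower:
  assumes "i \<in> multi_indices n (Suc m)" "i g \<noteq> 0"
  shows "i(g := i g - 1) \<in> multi_indices n m"
proof -
  have g: "g \<in> {1..n}" using assms by (auto simp: multi_indices_def)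
  have "(\<Sum>h = 1..n. i h) = i g + (\<Sum>h \<in> {1..n} - {g}. i h)"
    using g by (intro sum.remove) auto
  moreover have "(\<Sum>h = 1..n. (i(g := i g - 1)) h) = i g - 1 + (\<Sum>h \<in> {1..n} - {g}. (i(g := i g - 1)) h)"
    using g by (subst sum.remove[of _ g]) auto
  moreover have "(\<Sum>h \<in> {1..n} - {g}. (i(g := i g - 1)) h) = (\<Sum>h \<in> {1..n} - {g}. i h)"
    by (rule sum.cong) auto
  ultimately show ?thesis using assms by (auto simp: multi_indices_def)
qed

lemma multi_indices_raise:
  assumes "i \<in> multi_indices n m" "g \<in> {1..n}"
  shows "i(g := Suc (i g)) \<in> multi_indices n (Suc m)"
proof -
  have "(\<Sum>h = 1..n. i h) = i g + (\<Sum>h \<in> {1..n} - {g}. i h)"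
    using assms(2) by (intro sum.remove) auto
  moreover have "(\<Sum>h = 1..n. (i(g := Suc (i g))) h) =
      Suc (i g) + (\<Sum>h \<in> {1..n} - {g}. (i(g := Suc (i g))) h)"
    using assms(2) by (subst sum.remove[of _ g]) auto
  moreover have "(\<Sum>h \<in> {1..n} - {g}. (i(g := Suc (i g))) h) = (\<Sum>h \<in> {1..n} - {g}. i h)"
    by (rule sum.cong) auto
  ultimately show ?thesis using assms by (auto simp: multi_indices_def)
qed

lemma finite_multi_indices: "finite (multi_indices n m)"
proof (rule finite_subset)
  show "multi_indices n m \<subseteq> {i. \<forall>h. (h \<in> {1..n} \<longrightarrow> i h \<in> {0..m}) \<and> (h \<notin> {1..n} \<longrightarrow> i h = 0)}"
  proof
    fix i assume i: "i \<in> multi_indices n m"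
    have "i h \<le> m" if "h \<in> {1..n}" for h
      using i member_le_sum[of h "{1..n}" i] that by (auto simp: multi_indices_def)
    then show "i \<in> {i. \<forall>h. (h \<in> {1..n} \<longrightarrow> i h \<in> {0..m}) \<and> (h \<notin> {1..n} \<longrightarrow> i h = 0)}"
      using i by (auto simp: multi_indices_def)
  qed
  show "finite {i. \<forall>h. (h \<in> {1..n} \<longrightarrow> i h \<in> {0..m}) \<and> (h \<notin> {1..n} \<longrightarrow> i h = (0::nat))}"
    by (rule finite_set_of_finite_funs) auto
qed

lemma multi_indices_nonzero:
  assumes "i \<in> multi_indices n (Suc m)"
  obtains g where "g \<in> {1..n}" "i g \<noteq> 0"
proof -
  have "(\<Sum>h = 1..n. i h) \<noteq> 0" using assms by (auto simp: multi_indices_def)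
  then show thesis using that by (meson sum.neutral)
qed

text \<open>Existence of a word with prescribed letter counts makes every element f nonzero and
  provides a place at which to read off its coefficient.\<close>

lemma multi_indices_word:
  "i \<in> multi_indices n m \<Longrightarrow> \<exists>w. w \<in> words n \<and> length w = m \<and> count_list w = i"
proof (induction m arbitrary: i)
  case 0
  then have "i = (\<lambda>_. 0)" by (auto simp: multi_indices_def fun_eq_iff)
  then show ?case by (intro exI[of _ "[]"]) auto
next
  case (Suc m)
  obtain g where g: "g \<in> {1..n}" "i g \<noteq> 0" by (rule multi_indices_nonzero[OF Suc.prems])
  obtain w where w: "w \<in> words n" "length w = m" "count_list w = i(g := i g - 1)"
    using Suc.IH[OF multi_indices_lower[OF Suc.prems g(2)]] by blast
  have "count_list (w @ [g]) = i" using g(2) by (auto simp: w(3) fun_eq_iff)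
  then show ?case using g(1) w by (intro exI[of _ "w @ [g]"]) auto
qed

context exterior
begin

lemma mult_gen_apply_Nil:
  assumes "f \<in> carrier T" "h \<in> {1..n}"
  shows "(f \<otimes>\<^bsub>T\<^esub> gen h) [] = \<zero>\<^bsub>K\<^esub>"
  using assms by (simp add: free_mult_apply free_gen_def single_def free_algebra_simps)

text \<open>In the convolution sum only the cut just before the last letter leaves a right part of
  length one.\<close>

lemma mult_gen_apply_snoc:
  assumes f: "f \<in> carrier T"
  shows "(f \<otimes>\<^bsub>T\<^esub> gen h) (v @ [g]) = (if g = h then f v else \<zero>\<^bsub>K\<^esub>)"
proof -
  have fc: "f w \<in> carrier K" for w using f by (simp add: free_algebra_simps)
  have d: "drop j (v @ [g]) = [h] \<longleftrightarrow> length v = j \<and> g = h" if "j \<in> {0..length (v @ [g])}" for j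
  proof
    assume a: "drop j (v @ [g]) = [h]"
    then have "length (drop j (v @ [g])) = 1" by simp
    then have "j = length v" using that by auto
    then show "length v = j \<and> g = h" using a by simp
  qed auto
  have "(f \<otimes>\<^bsub>T\<^esub> gen h) (v @ [g]) =
      finsum K (\<lambda>j. if length v = j then if g = h then f v else \<zero>\<^bsub>K\<^esub> else \<zero>\<^bsub>K\<^esub>) {0..length (v @ [g])}"
    unfolding free_mult_apply free_gen_def
  proof (rule K.finsum_cong'[OF refl])
    fix j assume j: "j \<in> {0..length (v @ [g])}"
    show "f (take j (v @ [g])) \<otimes>\<^bsub>K\<^esub> single K [h] (drop j (v @ [g])) =
        (if length v = j then if g = h then f v else \<zero>\<^bsub>K\<^esub> else \<zero>\<^bsub>K\<^esub>)"
      unfolding single_def d[OF j] using fc by auto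
  qed (use fc in auto)
  also have "\<dots> = (if g = h then f v else \<zero>\<^bsub>K\<^esub>)"
    using fc by (intro K.finsum_singleton) auto
  finally show ?thesis .
qed

lemma f_elt_closed: "f_elt K n m i \<in> carrier T"
proof (induction m arbitrary: i)
  case 0
  show ?case by simp
next
  case (Suc m)
  show ?case
    unfolding f_elt.simps by (rule T.M.M.finsum_closed) (use Suc gen_closed in auto)
qed

lemma f_elt_Suc_apply:
  "f_elt K n (Suc m) i w = finsum K (\<lambda>h. if i h = 0 then \<zero>\<^bsub>K\<^esub>
    else (f_elt K n m (i(h := i h - 1)) \<otimes>\<^bsub>T\<^esub> gen h) w) {1..n}"
proof -
  have cl: "(\<lambda>h. if i h = 0 then \<zero>\<^bsub>T\<^esub> else f_elt K n m (i(h := i h - 1)) \<otimes>\<^bsub>T\<^esub> gen h)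
      \<in> {1..n} \<rightarrow> carrier W"
    using f_elt_closed gen_closed T.M.M.zero_closed by (auto simp flip: free_algebra_simps)
  have fs: "finsum T = finsum W" by (simp add: free_algebra_def)
  have "f_elt K n (Suc m) i w =
      finsum K (\<lambda>h. (if i h = 0 then \<zero>\<^bsub>T\<^esub> else f_elt K n m (i(h := i h - 1)) \<otimes>\<^bsub>T\<^esub> gen h) w) {1..n}"
    unfolding f_elt.simps fs by (rule finsum_free_module[OF K.cring_axioms cl])
  also have "(\<lambda>h. (if i h = 0 then \<zero>\<^bsub>T\<^esub> else f_elt K n m (i(h := i h - 1)) \<otimes>\<^bsub>T\<^esub> gen h) w) =
      (\<lambda>h. if i h = 0 then \<zero>\<^bsub>K\<^esub> else (f_elt K n m (i(h := i h - 1)) \<otimes>\<^bsub>T\<^esub> gen h) w)"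
    by (auto simp: free_algebra_simps)
  finally show ?thesis .
qed

text \<open>The recursion sorts the words with letter counts \<open>i\<close> by their last letter,
  so it produces each of them exactly once. In particular the supports for different
  \<open>i\<close> are disjoint.\<close>

lemma f_elt_apply:
  "i \<in> multi_indices n m \<Longrightarrow> f_elt K n m i w =
    (if w \<in> words n \<and> length w = m \<and> count_list w = i then \<one>\<^bsub>K\<^esub> else \<zero>\<^bsub>K\<^esub>)"
proof (induction m arbitrary: i w)
  case 0
  then have "i = (\<lambda>_. 0)" by (auto simp: multi_indices_def fun_eq_iff)
  then show ?case by (auto simp: single_def free_algebra_simps fun_eq_iff)
next
  case (Suc m)
  show ?case
  proof (cases w rule: rev_cases)
    case Nil
    have "f_elt K n (Suc m) i w = finsum K (\<lambda>h. \<zero>\<^bsub>K\<^esub>) {1..n}"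
      unfolding f_elt_Suc_apply Nil
      by (rule K.finsum_cong') (auto simp: mult_gen_apply_Nil f_elt_closed)
    then show ?thesis using Nil by (simp add: K.finsum_zero)
  next
    case (snoc v g)
    let ?c = "i g \<noteq> 0 \<and> v \<in> words n \<and> length v = m \<and> count_list v = i(g := i g - 1)"
    have eq: "w \<in> words n \<and> length w = Suc m \<and> count_list w = i \<longleftrightarrow> g \<in> {1..n} \<and> ?c"
    proof -
      have "count_list w = i \<longleftrightarrow> i g \<noteq> 0 \<and> count_list v = i(g := i g - 1)"
        unfolding snoc fun_eq_iff by (auto split: if_splits) 
      then show ?thesis unfolding snoc by auto
    qed
    have "f_elt K n (Suc m) i w =
        finsum K (\<lambda>h. if g = h then if ?c then \<one>\<^bsub>K\<^esub> else \<zero>\<^bsub>K\<^esub> else \<zero>\<^bsub>K\<^esub>) {1..n}"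
      unfolding f_elt_Suc_apply snoc
    proof (rule K.finsum_cong'[OF refl])
      fix h assume "h \<in> {1..n}"
      show "(if i h = 0 then \<zero>\<^bsub>K\<^esub> else (f_elt K n m (i(h := i h - 1)) \<otimes>\<^bsub>T\<^esub> gen h) (v @ [g])) =
          (if g = h then if ?c then \<one>\<^bsub>K\<^esub> else \<zero>\<^bsub>K\<^esub> else \<zero>\<^bsub>K\<^esub>)"
      proof (cases "g = h \<and> i h \<noteq> 0")
        case True
        then have ih: "i h \<noteq> 0" and gh: "g = h" by auto
        show ?thesis
          unfolding mult_gen_apply_snoc[OF f_elt_closed] gh
            Suc.IH[OF multi_indices_lower[OF Suc.prems ih]]
          using ih by auto
      next
        case False
        then show ?thesis unfolding mult_gen_apply_snoc[OF f_elt_closed] by auto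
      qed
    qed auto
    also have "\<dots> = (if g \<in> {1..n} \<and> ?c then \<one>\<^bsub>K\<^esub> else \<zero>\<^bsub>K\<^esub>)"
    proof (cases "g \<in> {1..n}")
      case True
      then have "finsum K (\<lambda>h. if g = h then if ?c then \<one>\<^bsub>K\<^esub> else \<zero>\<^bsub>K\<^esub> else \<zero>\<^bsub>K\<^esub>) {1..n} =
          (if ?c then \<one>\<^bsub>K\<^esub> else \<zero>\<^bsub>K\<^esub>)"
        by (intro K.finsum_singleton) auto
      then show ?thesis using True by simp
    next
      case False
      then have "finsum K (\<lambda>h. if g = h then if ?c then \<one>\<^bsub>K\<^esub> else \<zero>\<^bsub>K\<^esub> else \<zero>\<^bsub>K\<^esub>) {1..n} =
          finsum K (\<lambda>h. \<zero>\<^bsub>K\<^esub>) {1..n}"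
        by (intro K.finsum_cong') auto
      then show ?thesis using False unfolding K.finsum_zero by auto
    qed
    finally show ?thesis unfolding eq .
  qed
qed

text \<open>Which word is taken is immaterial: evaluation at any word with these letter counts gives
  one on the element f of \<open>i\<close> and zero on the others of the same degree.\<close>

definition index_word :: "nat \<Rightarrow> (nat \<Rightarrow> nat) \<Rightarrow> nat list"
  where "index_word m i = (SOME w. w \<in> words n \<and> length w = m \<and> count_list w = i)"

lemma f_elt_index_word:
  assumes "i \<in> multi_indices n m" "j \<in> multi_indices n m"
  shows "f_elt K n m j (index_word m i) = (if i = j then \<one>\<^bsub>K\<^esub> else \<zero>\<^bsub>K\<^esub>)"
  using someI_ex[OF multi_indices_word[OF assms(1)]]
  by (simp add: f_elt_apply[OF assms(2)] index_word_def)

abbreviation "D m \<equiv> free_algebra_deg K n m"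

lemma f_elt_deg:
  assumes i: "i \<in> multi_indices n m"
  shows "f_elt K n m i \<in> carrier (D m)"
  using f_elt_closed[of m i]
  unfolding free_algebra_deg_def free_algebra_simps free_module_mem_iff
  by (auto simp: f_elt_apply[OF i])

lemma deg_module: "module K (D m)"
  unfolding free_algebra_deg_def by (rule free_module_module[OF K.cring_axioms])

lemma deg_eval_hom: "(\<lambda>u. u w \<odot>\<^bsub>V\<^esub> v) \<in> left_module_hom K (D m) V"
  if "module K V" "v \<in> carrier V"
proof -
  interpret V: module K V by fact
  show ?thesis
    unfolding free_algebra_deg_def
    by (rule left_module_homI) (auto simp: V.smult_l_distr V.smult_assoc1 that(2))
qed

end

section \<open>The bimodules of the complex\<close>

context exterior
begin

section \<open>The triple tensor product\<close>

abbreviation "LF m \<equiv> left_factor K n m"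
abbreviation "TT m \<equiv> triple_tensor K n m"
abbreviation "pt m \<equiv> pure_triple K n m"

lemma left_factor_module: "module K (LF m)"
  unfolding left_factor_def by (rule tensor_module[OF E.M.module_axioms deg_module])

lemma triple_tensor_module: "module K (TT m)"
  unfolding triple_tensor_def by (rule tensor_module[OF left_factor_module E.M.module_axioms])

sublocale TT: module K "TT m" for m by (rule triple_tensor_module)

lemma outer_bilinear:
  "bilinear K (LF m) E (TT m) (pure_tensor K (LF m) E)"
  unfolding triple_tensor_def by (rule pure_tensor_bilinear[OF left_factor_module E.M.module_axioms])

lemma inner_bilinear:
  "bilinear K E (D m) (LF m) (pure_tensor K E (D m))"
  unfolding left_factor_def by (rule pure_tensor_bilinear[OF E.M.module_axioms deg_module])

lemma pure_triple_bilinear: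
  "b \<in> carrier E \<Longrightarrow> bilinear K E (D m) (TT m) (\<lambda>a u. pt m a u b)"
  unfolding pure_triple_def
  by (rule bilinear_postcompose[OF inner_bilinear bilinear_left[OF outer_bilinear]])

lemma pure_triple_hom_right:
  "a \<in> carrier E \<Longrightarrow> u \<in> carrier (D m) \<Longrightarrow> (\<lambda>b. pt m a u b) \<in> left_module_hom K E (TT m)"
  unfolding pure_triple_def
  by (rule bilinear_right[OF outer_bilinear bilinear_closed[OF inner_bilinear]])

lemma pure_triple_closed:
  "a \<in> carrier E \<Longrightarrow> u \<in> carrier (D m) \<Longrightarrow> b \<in> carrier E \<Longrightarrow> pt m a u b \<in> carrier (TT m)"
  by (rule left_module_hom_closed[OF pure_triple_hom_right])

lemma triple_induct [consumes 1, case_names pure add]: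
  assumes t: "t \<in> carrier (TT m)"
    and pure: "\<And>a u b. a \<in> carrier E \<Longrightarrow> u \<in> carrier (D m) \<Longrightarrow> b \<in> carrier E \<Longrightarrow> P (pt m a u b)"
    and add: "\<And>s t. s \<in> carrier (TT m) \<Longrightarrow> t \<in> carrier (TT m) \<Longrightarrow> P s \<Longrightarrow> P t \<Longrightarrow> P (s \<oplus>\<^bsub>TT m\<^esub> t)"
  shows "P t"
proof -
  note ob = outer_bilinear[of m]
  have outer: "P (pure_tensor K (LF m) E s b)" if "s \<in> carrier (LF m)" "b \<in> carrier E" for s b
    using that(1) unfolding left_factor_def
  proof (induction s rule: tensor_induct[OF E.M.module_axioms deg_module, consumes 1])
    case (1 a u)
    then show ?case
      using pure[of a u b] that(2) by (simp add: pure_triple_def left_factor_def)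
  next
    case (2 s t)
    then show ?case
      using add bilinear_closed[OF ob _ that(2)] bilinear_add_left[OF ob _ _ that(2)]
      by (simp add: left_factor_def)
  qed
  show ?thesis
    using t unfolding triple_tensor_def
  proof (induction t rule: tensor_induct[OF left_factor_module E.M.module_axioms, consumes 1])
    case (1 s b)
    then show ?case by (rule outer)
  next
    case (2 s t)
    then show ?case using add by (simp add: triple_tensor_def)
  qed
qed

lemma triple_add_hom_eq:
  assumes "f \<in> add_hom (TT m) V" "g \<in> add_hom (TT m) V"
    and "\<And>a u b. a \<in> carrier E \<Longrightarrow> u \<in> carrier (D m) \<Longrightarrow> b \<in> carrier E \<Longrightarrow>
      f (pt m a u b) = g (pt m a u b)"
    and "t \<in> carrier (TT m)"
  shows "f t = g t"
  using assms(4)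
  by (induction t rule: triple_induct)
    (simp_all add: assms(3) add_hom_add[OF assms(1)] add_hom_add[OF assms(2)])

context
  fixes V :: "('k, 'v, 'p) module_scheme" and \<gamma> :: "'k ext \<Rightarrow> (nat list \<Rightarrow> 'k) \<Rightarrow> 'k ext \<Rightarrow> 'v"
    and m :: nat
  assumes V: "module K V"
    and \<gamma>1: "\<And>b. b \<in> carrier E \<Longrightarrow> bilinear K E (D m) V (\<lambda>a u. \<gamma> a u b)"
    and \<gamma>2: "\<And>a u. a \<in> carrier E \<Longrightarrow> u \<in> carrier (D m) \<Longrightarrow> (\<lambda>b. \<gamma> a u b) \<in> left_module_hom K E V"
begin

lemma triple_lift_bilinear:
  "bilinear K (LF m) E V (\<lambda>t b. tensor_lift K V (\<lambda>a u. \<gamma> a u b) t)"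
  unfolding left_factor_def
  by (rule tensor_lift_bilinear[OF E.M.module_axioms deg_module E.M.module_axioms V \<gamma>1 \<gamma>2])

lemma triple_lift_hom: "triple_lift K V \<gamma> \<in> left_module_hom K (TT m) V"
  unfolding triple_lift_def triple_tensor_def
  by (rule tensor_lift_hom[OF left_factor_module E.M.module_axioms V triple_lift_bilinear])

lemma triple_lift_pure:
  assumes "a \<in> carrier E" "u \<in> carrier (D m)" "b \<in> carrier E"
  shows "triple_lift K V \<gamma> (pt m a u b) = \<gamma> a u b"
proof -
  have "triple_lift K V \<gamma> (pt m a u b) =
      tensor_lift K V (\<lambda>a u. \<gamma> a u b) (pure_tensor K E (D m) a u)"
    unfolding triple_lift_def pure_triple_def
    by (rule tensor_lift_pure[OF left_factor_module E.M.module_axioms V triple_lift_bilinear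
          bilinear_closed[OF inner_bilinear assms(1,2)] assms(3)])
  also have "\<dots> = \<gamma> a u b"
    by (rule tensor_lift_pure[OF E.M.module_axioms deg_module V \<gamma>1[OF assms(3)] assms(1,2)])
  finally show ?thesis .
qed

end

section \<open>The two actions on the triple tensor product\<close>

lemma lact_bilinear_aux:
  "c \<in> carrier E \<Longrightarrow> b \<in> carrier E \<Longrightarrow> bilinear K E (D m) (TT m) (\<lambda>a u. pt m (c \<otimes>\<^bsub>E\<^esub> a) u b)"
  by (rule bilinear_compose[OF pure_triple_bilinear E.left_mult_hom left_module_hom_id])

lemma lact_hom: "c \<in> carrier E \<Longrightarrow> lact K n m c \<in> left_module_hom K (TT m) (TT m)"
  unfolding lact_def
  by (rule triple_lift_hom[OF triple_tensor_module lact_bilinear_aux pure_triple_hom_right]) auto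

lemma lact_pure:
  "c \<in> carrier E \<Longrightarrow> a \<in> carrier E \<Longrightarrow> u \<in> carrier (D m) \<Longrightarrow> b \<in> carrier E \<Longrightarrow>
    lact K n m c (pt m a u b) = pt m (c \<otimes>\<^bsub>E\<^esub> a) u b"
  unfolding lact_def
  by (rule triple_lift_pure[OF triple_tensor_module lact_bilinear_aux pure_triple_hom_right]) auto

lemma ract_hom: "c \<in> carrier E \<Longrightarrow> (\<lambda>t. ract K n m t c) \<in> left_module_hom K (TT m) (TT m)"
  unfolding ract_def
  by (rule triple_lift_hom[OF triple_tensor_module pure_triple_bilinear
        left_module_hom_comp[OF E.right_mult_hom pure_triple_hom_right]]) auto

lemma ract_pure:
  "c \<in> carrier E \<Longrightarrow> a \<in> carrier E \<Longrightarrow> u \<in> carrier (D m) \<Longrightarrow> b \<in> carrier E \<Longrightarrow>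
    ract K n m (pt m a u b) c = pt m a u (b \<otimes>\<^bsub>E\<^esub> c)"
  unfolding ract_def
  by (rule triple_lift_pure[OF triple_tensor_module pure_triple_bilinear
        left_module_hom_comp[OF E.right_mult_hom pure_triple_hom_right]]) auto

lemmas lact_add_hom = left_module_hom_add_hom[OF lact_hom]
lemmas ract_add_hom = left_module_hom_add_hom[OF ract_hom]
lemmas lact_closed = left_module_hom_closed[OF lact_hom]
lemmas ract_closed = left_module_hom_closed[OF ract_hom]

text \<open>Linearity in the triple belongs to the lift. Linearity in \<open>c\<close> compares two
  linear maps in the triple on pure triples.\<close>

lemma lact_bilinear: "bilinear K E (TT m) (TT m) (lact K n m)"
proof (rule bilinearI)
  fix t assume t: "t \<in> carrier (TT m)"
  note tm = triple_tensor_module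
  show "(\<lambda>c. lact K n m c t) \<in> left_module_hom K E (TT m)"
  proof (rule left_module_homI)
    fix c assume c: "c \<in> carrier E"
    show "lact K n m c t \<in> carrier (TT m)" by (rule lact_closed[OF c t])
    show "lact K n m (k \<odot>\<^bsub>E\<^esub> c) t = k \<odot>\<^bsub>TT m\<^esub> lact K n m c t" if k: "k \<in> carrier K" for k
      by (rule triple_add_hom_eq[OF lact_add_hom[OF E.M.smult_closed[OF k c]]
            left_module_hom_add_hom[OF left_module_hom_scale[OF tm tm lact_hom[OF c] k]] _ t])
         (use c k in \<open>simp add: lact_pure E.mult_smult_left bilinear_smult_left[OF pure_triple_bilinear]\<close>)
    fix c' assume c': "c' \<in> carrier E"
    show "lact K n m (c \<oplus>\<^bsub>E\<^esub> c') t = lact K n m c t \<oplus>\<^bsub>TT m\<^esub> lact K n m c' t"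
      by (rule triple_add_hom_eq[OF lact_add_hom[OF E.M.M.a_closed[OF c c']]
            left_module_hom_add_hom[OF left_module_hom_plus[OF tm tm lact_hom[OF c] lact_hom[OF c']]] _ t])
         (use c c' in \<open>simp add: lact_pure E.A.l_distr bilinear_add_left[OF pure_triple_bilinear]\<close>)
  qed
qed (rule lact_hom)

lemma ract_bilinear: "bilinear K (TT m) E (TT m) (ract K n m)"
proof (rule bilinearI)
  fix t assume t: "t \<in> carrier (TT m)"
  note tm = triple_tensor_module
  show "ract K n m t \<in> left_module_hom K E (TT m)"
  proof (rule left_module_homI)
    fix c assume c: "c \<in> carrier E"
    show "ract K n m t c \<in> carrier (TT m)" by (rule ract_closed[OF c t])
    show "ract K n m t (k \<odot>\<^bsub>E\<^esub> c) = k \<odot>\<^bsub>TT m\<^esub> ract K n m t c" if k: "k \<in> carrier K" for k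
      by (rule triple_add_hom_eq[OF ract_add_hom[OF E.M.smult_closed[OF k c]]
            left_module_hom_add_hom[OF left_module_hom_scale[OF tm tm ract_hom[OF c] k]] _ t])
         (use c k in \<open>simp add: ract_pure E.mult_smult_right left_module_hom_smult[OF pure_triple_hom_right]\<close>)
    fix c' assume c': "c' \<in> carrier E"
    show "ract K n m t (c \<oplus>\<^bsub>E\<^esub> c') = ract K n m t c \<oplus>\<^bsub>TT m\<^esub> ract K n m t c'"
      by (rule triple_add_hom_eq[OF ract_add_hom[OF E.M.M.a_closed[OF c c']]
            left_module_hom_add_hom[OF left_module_hom_plus[OF tm tm ract_hom[OF c] ract_hom[OF c']]] _ t])
         (use c c' in \<open>simp add: ract_pure E.A.r_distr left_module_hom_add[OF pure_triple_hom_right]\<close>)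
  qed
qed (rule ract_hom)

lemma triple_bimodule: "bimodule K E (TT m) (lact K n m) (ract K n m)"
proof (intro bimodule.intro bimodule_axioms.intro E.assoc_algebra_axioms triple_tensor_module
    lact_bilinear ract_bilinear)
  fix t assume t: "t \<in> carrier (TT m)"
  show "lact K n m \<one>\<^bsub>E\<^esub> t = t"
    using t by (induction t rule: triple_induct)
      (simp_all add: lact_pure add_hom_add[OF lact_add_hom])
  show "ract K n m t \<one>\<^bsub>E\<^esub> = t"
    using t by (induction t rule: triple_induct)
      (simp_all add: ract_pure add_hom_add[OF ract_add_hom])
  fix a b assume ab: "a \<in> carrier E" "b \<in> carrier E"
  show "lact K n m (a \<otimes>\<^bsub>E\<^esub> b) t = lact K n m a (lact K n m b t)"
    using t ab by (induction t rule: triple_induct)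
      (simp_all add: lact_pure add_hom_add[OF lact_add_hom] E.A.m_assoc lact_closed)
  show "ract K n m t (a \<otimes>\<^bsub>E\<^esub> b) = ract K n m (ract K n m t a) b"
    using t ab by (induction t rule: triple_induct)
      (simp_all add: ract_pure add_hom_add[OF ract_add_hom] E.A.m_assoc ract_closed)
  show "ract K n m (lact K n m a t) b = lact K n m a (ract K n m t b)"
    using t ab by (induction t rule: triple_induct)
      (simp_all add: ract_pure lact_pure add_hom_add[OF ract_add_hom] add_hom_add[OF lact_add_hom]
        ract_closed lact_closed)
qed

sublocale tri: bimodule K E "TT m" "lact K n m" "ract K n m" for m
  by (rule triple_bimodule)

abbreviation "Q m \<equiv> enveloping_module K (TT m) (lact K n m) (ract K n m)"

lemma env_smult_pure_triple:
  "a \<in> carrier E \<Longrightarrow> b \<in> carrier E \<Longrightarrow> c \<in> carrier E \<Longrightarrow> u \<in> carrier (D m) \<Longrightarrow> d \<in> carrier E \<Longrightarrow>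
    pe a b \<odot>\<^bsub>Q m\<^esub> pt m c u d = pt m (a \<otimes>\<^bsub>E\<^esub> c) u (d \<otimes>\<^bsub>E\<^esub> b)"
  by (simp add: tri.enveloping_smult_pure pure_triple_closed lact_pure ract_pure)

section \<open>Coordinates with values in the enveloping algebra\<close>

text \<open>The middle factor is evaluated at one word, and the outer factors become an element of
  the enveloping algebra. The map is defined on the whole triple tensor product, so its linearity
  comes from the universal property.\<close>

definition coord :: "nat \<Rightarrow> (nat \<Rightarrow> nat) \<Rightarrow> 'k triple \<Rightarrow> 'k ext_env"
  where "coord m i = triple_lift K A (\<lambda>a u b. u (index_word m i) \<odot>\<^bsub>A\<^esub> pe a b)"

lemma deg_apply: "u \<in> carrier (D m) \<Longrightarrow> u w \<in> carrier K"
  by (simp add: free_algebra_deg_def)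

lemma coord_bilinear:
  assumes b: "b \<in> carrier E"
  shows "bilinear K E (D m) A (\<lambda>a u. u w \<odot>\<^bsub>A\<^esub> pe a b)"
  by (intro bilinearI deg_eval_hom[OF reg.E.M.module_axioms] reg.pe_closed b
      left_module_hom_scale[OF E.M.module_axioms reg.E.M.module_axioms bilinear_left[OF reg.pe_bilinear b]]
      deg_apply)

lemma coord_hom_right:
  assumes "a \<in> carrier E" "u \<in> carrier (D m)"
  shows "(\<lambda>b. u w \<odot>\<^bsub>A\<^esub> pe a b) \<in> left_module_hom K E A"
  by (rule left_module_hom_scale[OF E.M.module_axioms reg.E.M.module_axioms
      bilinear_right[OF reg.pe_bilinear assms(1)] deg_apply[OF assms(2)]])

lemma coord_hom: "coord m i \<in> left_module_hom K (TT m) A"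
  unfolding coord_def
  by (rule triple_lift_hom[OF reg.E.M.module_axioms coord_bilinear coord_hom_right])

lemma coord_pure:
  "a \<in> carrier E \<Longrightarrow> u \<in> carrier (D m) \<Longrightarrow> b \<in> carrier E \<Longrightarrow>
    coord m i (pt m a u b) = u (index_word m i) \<odot>\<^bsub>A\<^esub> pe a b"
  unfolding coord_def
  by (rule triple_lift_pure[OF reg.E.M.module_axioms coord_bilinear coord_hom_right])

lemmas coord_closed = left_module_hom_closed[OF coord_hom]
lemmas coord_add = left_module_hom_add[OF coord_hom]

lemmas env_smult_bilinear = tri.enveloping_smult_bilinear
lemmas env_smult_closed = bilinear_closed[OF env_smult_bilinear]

text \<open>On pure tensors both sides multiply the outer factors from outside, and the coefficient
  taken from the middle factor is a central scalar.\<close>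

lemma coord_smult:
  assumes Z: "Z \<in> carrier A" and t: "t \<in> carrier (TT m)"
  shows "coord m i (Z \<odot>\<^bsub>Q m\<^esub> t) = Z \<otimes>\<^bsub>A\<^esub> coord m i t"
  using Z
proof (induction Z rule: reg.enveloping_induct)
  case (pure a b)
  have pe: "pe a b \<in> carrier A" using pure by (rule reg.pe_closed)
  show ?case using t
  proof (induction t rule: triple_induct)
    case (pure c u d)
    then show ?case
      using \<open>a \<in> carrier E\<close> \<open>b \<in> carrier E\<close> deg_apply[of u m]
      by (simp add: env_smult_pure_triple coord_pure reg.E.mult_smult_right reg.pe_mult reg.pe_closed)
  next
    case (add s t)
    then show ?case
      using pe by (simp add: bilinear_add_right[OF env_smult_bilinear] coord_add env_smult_closed
          coord_closed reg.E.A.r_distr)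
  qed
next
  case (add y z)
  then show ?case
    using t by (simp add: bilinear_add_left[OF env_smult_bilinear] coord_add env_smult_closed
          coord_closed reg.E.A.l_distr)
qed

abbreviation "ft m \<equiv> f_tilde K n m"
abbreviation "MI m \<equiv> multi_indices n m"
abbreviation "P m \<equiv> koszul_module K n m"

lemma f_tilde_closed: "i \<in> MI m \<Longrightarrow> ft m i \<in> carrier (TT m)"
  unfolding f_tilde_def by (rule pure_triple_closed) (simp_all add: f_elt_deg)

lemma coord_f_tilde:
  assumes "i \<in> MI m" "j \<in> MI m"
  shows "coord m i (ft m j) = (if i = j then \<one>\<^bsub>A\<^esub> else \<zero>\<^bsub>A\<^esub>)"
  unfolding f_tilde_def
  using assms by (simp add: coord_pure f_elt_deg f_elt_index_word reg.pe_one reg.pe_closed)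

lemma env_smult_f_tilde:
  "a \<in> carrier E \<Longrightarrow> b \<in> carrier E \<Longrightarrow> i \<in> MI m \<Longrightarrow>
    pe a b \<odot>\<^bsub>Q m\<^esub> ft m i = pt m a (f_elt K n m i) b"
  unfolding f_tilde_def by (simp add: env_smult_pure_triple f_elt_deg)

section \<open>The modules of the complex and their bases\<close>

lemma koszul_module_simps [simp]:
  "zero (P m) = zero (TT m)" "add (P m) = add (TT m)" "smult (P m) = smult (Q m)"
  by (simp_all add: koszul_module_def enveloping_module_def)

definition generators :: "nat \<Rightarrow> 'k triple set"
  where "generators m = {pt m a (f_elt K n m i) b | a i b.
    a \<in> carrier E \<and> i \<in> MI m \<and> b \<in> carrier E}"

lemma koszul_carrier: "carrier (P m) = generated_submodule K (TT m) (generators m)"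
  by (simp add: koszul_module_def generators_def)

lemma generators_closed: "generators m \<subseteq> carrier (TT m)"
  by (auto simp: generators_def pure_triple_closed f_elt_deg)

lemma koszul_submodule: "submodule (carrier (P m)) K (TT m)"
  unfolding koszul_carrier
  by (rule generated_submodule_submodule[OF triple_tensor_module generators_closed])

lemmas koszul_submoduleD = koszul_submodule[unfolded submodule_iff[OF TT.M.abelian_group_axioms]]

lemma koszul_subset: "p \<in> carrier (P m) \<Longrightarrow> p \<in> carrier (TT m)"
  using koszul_submoduleD by blast

lemma env_smult_f_tilde_closed:
  assumes Z: "Z \<in> carrier A" and i: "i \<in> MI m"
  shows "Z \<odot>\<^bsub>Q m\<^esub> ft m i \<in> carrier (P m)"
  using Z
proof (induction Z rule: reg.enveloping_induct)
  case (pure a b)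
  then have "pt m a (f_elt K n m i) b \<in> generators m" using i by (auto simp: generators_def)
  then show ?case
    using pure i generated_submodule_incl[of "generators m" K "TT m"]
    by (auto simp: env_smult_f_tilde koszul_carrier)
next
  case (add y z)
  then show ?case
    using koszul_submoduleD[of m] f_tilde_closed[OF i] by (simp add: bilinear_add_left[OF env_smult_bilinear])
qed

text \<open>The carrier is defined as a span over \<open>K\<close>. The difference of the two sides
  is linear over \<open>K\<close> on the whole triple tensor product, so its kernel is a subspace,
  and it contains the generators.\<close>

lemma koszul_expand:
  assumes p: "p \<in> carrier (P m)"
  shows "p = finsum (TT m) (\<lambda>i. coord m i p \<odot>\<^bsub>Q m\<^esub> ft m i) (MI m)"
proof -
  let ?r = "\<lambda>p. finsum (TT m) (\<lambda>i. coord m i p \<odot>\<^bsub>Q m\<^esub> ft m i) (MI m)"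
  note tm = triple_tensor_module[of m]
  have r: "?r \<in> left_module_hom K (TT m) (TT m)"
    by (rule left_module_hom_finsum[OF tm tm finite_multi_indices
          left_module_hom_comp[OF coord_hom bilinear_left[OF env_smult_bilinear f_tilde_closed]]])
  have d: "(\<lambda>p. ?r p \<ominus>\<^bsub>TT m\<^esub> p) \<in> left_module_hom K (TT m) (TT m)"
    by (rule left_module_hom_diff[OF tm tm r left_module_hom_id])
  have eq: "?r p = p" if gen: "p \<in> generators m" for p
  proof -
    obtain a j b where ab: "a \<in> carrier E" "b \<in> carrier E" and j: "j \<in> MI m"
      and p: "p = pt m a (f_elt K n m j) b"
      using gen by (auto simp: generators_def)
    have pj: "p = pe a b \<odot>\<^bsub>Q m\<^esub> ft m j" unfolding p by (simp add: env_smult_f_tilde ab j)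
    have pc: "p \<in> carrier (TT m)" using gen generators_closed by auto
    have z: "\<zero>\<^bsub>A\<^esub> \<odot>\<^bsub>Q m\<^esub> ft m i = \<zero>\<^bsub>TT m\<^esub>" if "i \<in> MI m" for i
      using left_module_smult_zero[OF tri.enveloping_left_module, of "ft m i" m] f_tilde_closed[OF that]
      by simp
    have "?r p = finsum (TT m) (\<lambda>i. if j = i then p else \<zero>\<^bsub>TT m\<^esub>) (MI m)"
    proof (rule TT.M.finsum_cong'[OF refl])
      fix i assume i: "i \<in> MI m"
      show "coord m i p \<odot>\<^bsub>Q m\<^esub> ft m i = (if j = i then p else \<zero>\<^bsub>TT m\<^esub>)"
        using i j ab z[OF i]
        by (auto simp: pj coord_smult reg.pe_closed f_tilde_closed coord_f_tilde)
    qed (use pc in auto)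
    also have "\<dots> = p"
      using pc finite_multi_indices by (intro TT.M.finsum_singleton j) auto
    finally show ?thesis .
  qed
  have "generators m \<subseteq> {p \<in> carrier (TT m). ?r p \<ominus>\<^bsub>TT m\<^esub> p = \<zero>\<^bsub>TT m\<^esub>}"
  proof
    fix p assume g: "p \<in> generators m"
    then have pc: "p \<in> carrier (TT m)" using generators_closed by auto
    have "?r p \<ominus>\<^bsub>TT m\<^esub> p = \<zero>\<^bsub>TT m\<^esub>" unfolding eq[OF g] a_minus_def by (rule TT.M.r_neg[OF pc])
    then show "p \<in> {p \<in> carrier (TT m). ?r p \<ominus>\<^bsub>TT m\<^esub> p = \<zero>\<^bsub>TT m\<^esub>}" using pc by simp
  qed
  from generated_submodule_minimal[OF kernel_submodule[OF tm tm d] this]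
  have "?r p \<ominus>\<^bsub>TT m\<^esub> p = \<zero>\<^bsub>TT m\<^esub>" using p unfolding koszul_carrier by auto
  then have "?r p = p"
    by (rule TT.M.diff_zero_imp_eq[OF left_module_hom_closed[OF r koszul_subset[OF p]] koszul_subset[OF p]])
  then show ?thesis by simp
qed

text \<open>Being a span over \<open>K\<close>, the carrier is not closed under the enveloping
  algebra by definition. In the expansion of an element the scalar is absorbed by the
  coordinates.\<close>

lemma koszul_env_submodule: "submodule (carrier (P m)) A (Q m)"
proof -
  note D = koszul_submoduleD[of m]
  have ag: "abelian_group (Q m)"
    using tri.enveloping_left_module[of m] by (simp add: left_module_def)
  have "Z \<odot>\<^bsub>Q m\<^esub> p \<in> carrier (P m)" if Z: "Z \<in> carrier A" and p: "p \<in> carrier (P m)" for Z p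
  proof -
    have cl: "coord m i p \<in> carrier A" for i by (rule coord_closed[OF koszul_subset[OF p]])
    have f: "(\<lambda>i. coord m i p \<odot>\<^bsub>Q m\<^esub> ft m i) \<in> MI m \<rightarrow> carrier (TT m)"
      using cl by (auto intro!: env_smult_closed f_tilde_closed)
    have "Z \<odot>\<^bsub>Q m\<^esub> p = finsum (TT m) (\<lambda>i. Z \<odot>\<^bsub>Q m\<^esub> (coord m i p \<odot>\<^bsub>Q m\<^esub> ft m i)) (MI m)"
      using add_hom_finsum[OF left_module_hom_add_hom[OF bilinear_right[OF env_smult_bilinear Z]]
          TT.M.abelian_group_axioms TT.M.abelian_group_axioms f] koszul_expand[OF p] by simp
    also have "\<dots> \<in> carrier (P m)"
    proof (rule submodule_finsum_closed[OF TT.M.abelian_group_axioms koszul_submodule])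
      fix i assume i: "i \<in> MI m"
      interpret Q: left_module A "Q m" by (rule tri.enveloping_left_module)
      have "Z \<odot>\<^bsub>Q m\<^esub> (coord m i p \<odot>\<^bsub>Q m\<^esub> ft m i) = (Z \<otimes>\<^bsub>A\<^esub> coord m i p) \<odot>\<^bsub>Q m\<^esub> ft m i"
        using Q.smult_assoc1[OF Z cl, of "ft m i"] f_tilde_closed[OF i] by simp
      then show "Z \<odot>\<^bsub>Q m\<^esub> (coord m i p \<odot>\<^bsub>Q m\<^esub> ft m i) \<in> carrier (P m)"
        using env_smult_f_tilde_closed[OF reg.E.A.m_closed[OF Z cl] i] by simp
    qed
    finally show ?thesis .
  qed
  \<comment> \<open>Both records have the same additive structure, and additive inverses depend on
    nothing else.\<close>
  moreover have "\<ominus>\<^bsub>Q m\<^esub> p = \<ominus>\<^bsub>TT m\<^esub> p" for p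
    by (simp add: a_inv_def m_inv_def)
  ultimately show ?thesis
    unfolding submodule_iff[OF ag] using D by simp
qed

lemma koszul_left_module: "left_module A (P m)"
proof -
  have "P m = (Q m)\<lparr>carrier := carrier (P m)\<rparr>" by (simp add: koszul_module_def)
  then show ?thesis
    using left_module_submodule[OF tri.enveloping_left_module koszul_env_submodule, of m] by simp
qed

text \<open>Finite sums are defined relative to the carrier, so sums in the submodule and in the
  ambient module are identified through the inclusion.\<close>

lemma koszul_finsum:
  assumes "f \<in> B \<rightarrow> carrier (P m)"
  shows "finsum (P m) f B = finsum (TT m) f B"
proof -
  interpret P: left_module A "P m" by (rule koszul_left_module)
  have "(\<lambda>p. p) \<in> add_hom (P m) (TT m)"
    by (rule add_homI) (simp_all add: koszul_subset)
  from add_hom_finsum[OF this P.M.abelian_group_axioms TT.M.abelian_group_axioms assms]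
  show ?thesis .
qed

lemma f_tilde_mem: "i \<in> MI m \<Longrightarrow> ft m i \<in> carrier (P m)"
  using env_smult_f_tilde_closed[OF reg.E.A.one_closed, of i m] f_tilde_closed[of i m]
    left_module.smult_one[OF tri.enveloping_left_module, of "ft m i" m] by simp

text \<open>This freeness yields projectivity, the existence and uniqueness of the differential, and
  the comparison of maps on basis elements.\<close>

lemma koszul_based: "based_module A (P m) (MI m) (ft m) (coord m)"
proof (intro based_module.intro based_module_axioms.intro koszul_left_module finite_multi_indices)
  fix p assume p: "p \<in> carrier (P m)"
  have "(\<lambda>i. coord m i p \<odot>\<^bsub>Q m\<^esub> ft m i) \<in> MI m \<rightarrow> carrier (P m)"
    using coord_closed[OF koszul_subset[OF p]] by (auto intro!: env_smult_f_tilde_closed)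
  then show "p = finsum (P m) (\<lambda>i. coord m i p \<odot>\<^bsub>P m\<^esub> ft m i) (MI m)"
    using koszul_expand[OF p] by (simp add: koszul_finsum)
qed (simp_all add: f_tilde_mem coord_closed coord_add coord_smult coord_f_tilde koszul_subset)

sublocale P: based_module A "P m" "MI m" "ft m" "coord m" for m
  by (rule koszul_based)

end

section \<open>The differential\<close>

context exterior
begin

definition koszul_sign :: "nat \<Rightarrow> 'k"
  where "koszul_sign m = (\<ominus>\<^bsub>K\<^esub> \<one>\<^bsub>K\<^esub>) [^]\<^bsub>K\<^esub> m"

lemma koszul_sign_closed [simp]: "koszul_sign m \<in> carrier K"
  by (simp add: koszul_sign_def)

lemma koszul_sign_Suc: "koszul_sign (Suc m) = \<ominus>\<^bsub>K\<^esub> koszul_sign m"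
  by (simp add: koszul_sign_def K.r_minus)

abbreviation lower :: "(nat \<Rightarrow> nat) \<Rightarrow> nat \<Rightarrow> nat \<Rightarrow> nat"
  where "lower i h \<equiv> i(h := i h - 1)"

abbreviation raise :: "(nat \<Rightarrow> nat) \<Rightarrow> nat \<Rightarrow> nat \<Rightarrow> nat"
  where "raise i h \<equiv> i(h := Suc (i h))"

abbreviation "d m \<equiv> koszul_diff K n m"

text \<open>This turns the two one-sided actions in the prescribed values of the differential into a
  single coefficient in the enveloping algebra.\<close>

lemma y_action:
  assumes "t \<in> carrier (TT m)" "h \<in> {1..n}" "s \<in> carrier K"
  shows "y s h \<odot>\<^bsub>Q m\<^esub> t = lact K n m (x h) t \<oplus>\<^bsub>TT m\<^esub> s \<odot>\<^bsub>TT m\<^esub> ract K n m t (x h)"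
  using assms
  by (simp add: y_def bilinear_add_left[OF env_smult_bilinear] bilinear_smult_left[OF env_smult_bilinear]
      tri.enveloping_smult_pure tri.r_one tri.l_one lact_closed)

lemma koszul_diff_value_eq:
  assumes i: "i \<in> MI (Suc m)"
  shows "koszul_diff_value K n (Suc m) i = finsum (TT m)
    (\<lambda>h. if i h = 0 then \<zero>\<^bsub>TT m\<^esub> else y (koszul_sign (Suc m)) h \<odot>\<^bsub>Q m\<^esub> ft m (lower i h)) {1..n}"
  unfolding koszul_diff_value_def diff_Suc_1
proof (rule TT.M.finsum_cong'[OF refl])
  show "(\<lambda>h. if i h = 0 then \<zero>\<^bsub>TT m\<^esub> else y (koszul_sign (Suc m)) h \<odot>\<^bsub>Q m\<^esub> ft m (lower i h))
      \<in> {1..n} \<rightarrow> carrier (TT m)"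
    using multi_indices_lower[OF i] by (auto intro!: env_smult_closed f_tilde_closed)
  fix h assume "h \<in> {1..n}"
  then show "(if i h = 0 then \<zero>\<^bsub>TT m\<^esub>
      else lact K n m (x h) (ft m (lower i h)) \<oplus>\<^bsub>TT m\<^esub>
        ((\<ominus>\<^bsub>K\<^esub> \<one>\<^bsub>K\<^esub>) [^]\<^bsub>K\<^esub> Suc m) \<odot>\<^bsub>TT m\<^esub> ract K n m (ft m (lower i h)) (x h)) =
      (if i h = 0 then \<zero>\<^bsub>TT m\<^esub> else y (koszul_sign (Suc m)) h \<odot>\<^bsub>Q m\<^esub> ft m (lower i h))"
    using y_action[OF f_tilde_closed[OF multi_indices_lower[OF i]], of h h "koszul_sign (Suc m)"]
      koszul_sign_closed[of "Suc m"]
    unfolding koszul_sign_def by auto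
qed

lemma koszul_diff_value_closed:
  assumes i: "i \<in> MI (Suc m)"
  shows "koszul_diff_value K n (Suc m) i \<in> carrier (P m)"
  unfolding koszul_diff_value_eq[OF i]
proof (rule submodule_finsum_closed[OF TT.M.abelian_group_axioms koszul_submodule])
  fix h assume "h \<in> {1..n}"
  then show "(if i h = 0 then \<zero>\<^bsub>TT m\<^esub> else y (koszul_sign (Suc m)) h \<odot>\<^bsub>Q m\<^esub> ft m (lower i h)) \<in> carrier (P m)"
    using koszul_submoduleD[of m] multi_indices_lower[OF i]
    by (auto intro!: env_smult_f_tilde_closed)
qed

text \<open>The differential is a definite description, so a unique candidate has to be exhibited.
  Linear extension from the basis gives existence, after restriction to the carrier; agreement on
  the basis together with extensionality gives uniqueness.\<close>

lemma koszul_diff_spec: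
  "d (Suc m) \<in> left_module_hom A (P (Suc m)) (P m) \<and>
    d (Suc m) \<in> extensional (carrier (P (Suc m))) \<and>
    (\<forall>i\<in>MI (Suc m). d (Suc m) (ft (Suc m) i) = koszul_diff_value K n (Suc m) i)"
proof -
  let ?e = "P.extend (Suc m) (P m) (koszul_diff_value K n (Suc m))"
  have h: "?e \<in> left_module_hom A (P (Suc m)) (P m)"
    by (rule P.extend_hom[OF koszul_left_module koszul_diff_value_closed])
  have he: "?e (ft (Suc m) i) = koszul_diff_value K n (Suc m) i" if "i \<in> MI (Suc m)" for i
    by (rule P.extend_e[OF koszul_left_module koszul_diff_value_closed that])
  have "\<exists>!f. f \<in> left_module_hom A (P (Suc m)) (P m) \<and> f \<in> extensional (carrier (P (Suc m))) \<and>
    (\<forall>i\<in>MI (Suc m). f (ft (Suc m) i) = koszul_diff_value K n (Suc m) i)"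
  proof (rule ex1I[of _ "restrict ?e (carrier (P (Suc m)))"], intro conjI ballI)
    show "restrict ?e (carrier (P (Suc m))) \<in> left_module_hom A (P (Suc m)) (P m)"
      using h P.M.a_closed P.smult_closed
      by (intro left_module_homI)
        (simp_all add: left_module_hom_closed left_module_hom_add left_module_hom_smult
          del: koszul_module_simps)
    show "restrict ?e (carrier (P (Suc m))) \<in> extensional (carrier (P (Suc m)))" by simp
    show "restrict ?e (carrier (P (Suc m))) (ft (Suc m) i) = koszul_diff_value K n (Suc m) i"
      if i: "i \<in> MI (Suc m)" for i
      using he[OF i] f_tilde_mem[OF i] by simp
    fix f assume f: "f \<in> left_module_hom A (P (Suc m)) (P m) \<and> f \<in> extensional (carrier (P (Suc m))) \<and>
      (\<forall>i\<in>MI (Suc m). f (ft (Suc m) i) = koszul_diff_value K n (Suc m) i)"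
    have "f p = ?e p" if "p \<in> carrier (P (Suc m))" for p
      by (rule P.hom_eq[OF koszul_left_module _ h _ that]) (use f he in simp_all)
    then show "f = restrict ?e (carrier (P (Suc m)))"
      using f by (intro extensionalityI[of _ "carrier (P (Suc m))"]) auto
  qed
  from theI'[OF this] show ?thesis unfolding koszul_diff_def diff_Suc_1 .
qed

lemma koszul_diff_hom: "d (Suc m) \<in> left_module_hom A (P (Suc m)) (P m)"
  using koszul_diff_spec by blast

lemmas koszul_diff_closed = left_module_hom_closed[OF koszul_diff_hom]
lemmas koszul_diff_add_hom = left_module_hom_add_hom[OF koszul_diff_hom]

lemma koszul_abelian_group: "abelian_group (P m)"
  using koszul_left_module[of m] by (simp add: left_module_def)

text \<open>The coefficient stands to the right of \<open>Z\<close> because the differential is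
  linear from the left. A general \<open>Z\<close> is kept so that the formula can be iterated and
  combined with contractions.\<close>

definition diff_term :: "nat \<Rightarrow> 'k ext_env \<Rightarrow> (nat \<Rightarrow> nat) \<Rightarrow> nat \<Rightarrow> 'k triple"
  where "diff_term m Z i h = (if i h = 0 then \<zero>\<^bsub>P m\<^esub>
    else (Z \<otimes>\<^bsub>A\<^esub> y (koszul_sign (Suc m)) h) \<odot>\<^bsub>P m\<^esub> ft m (lower i h))"

lemma diff_term_closed:
  "i \<in> MI (Suc m) \<Longrightarrow> Z \<in> carrier A \<Longrightarrow> h \<in> {1..n} \<Longrightarrow> diff_term m Z i h \<in> carrier (P m)"
  using koszul_submoduleD[of m] multi_indices_lower[of i n m h]
  by (auto simp: diff_term_def intro!: env_smult_f_tilde_closed)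

lemma koszul_diff_smult:
  assumes Z: "Z \<in> carrier A" and i: "i \<in> MI (Suc m)"
  shows "d (Suc m) (Z \<odot>\<^bsub>P (Suc m)\<^esub> ft (Suc m) i) = finsum (P m) (diff_term m Z i) {1..n}"
proof -
  note Pm = koszul_left_module[of m]
  let ?f = "\<lambda>h. if i h = 0 then \<zero>\<^bsub>TT m\<^esub> else y (koszul_sign (Suc m)) h \<odot>\<^bsub>Q m\<^esub> ft m (lower i h)"
  have f: "?f \<in> {1..n} \<rightarrow> carrier (P m)"
    using koszul_submoduleD[of m] multi_indices_lower[OF i]
    by (auto intro!: env_smult_f_tilde_closed)
  have "d (Suc m) (Z \<odot>\<^bsub>P (Suc m)\<^esub> ft (Suc m) i) = Z \<odot>\<^bsub>P m\<^esub> finsum (P m) ?f {1..n}"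
    using koszul_diff_spec[of m] i koszul_diff_value_eq[OF i] koszul_finsum[OF f]
      left_module_hom_smult[OF koszul_diff_hom Z f_tilde_mem[OF i]] by simp
  also have "\<dots> = finsum (P m) (\<lambda>h. Z \<odot>\<^bsub>P m\<^esub> ?f h) {1..n}"
    by (rule left_module_smult_finsum[OF Pm Z f])
  also have "\<dots> = finsum (P m) (diff_term m Z i) {1..n}"
  proof (rule P.M.finsum_cong'[OF refl])
    show "diff_term m Z i \<in> {1..n} \<rightarrow> carrier (P m)" using diff_term_closed[OF i Z] by auto
    fix h assume h: "h \<in> {1..n}"
    have "Z \<odot>\<^bsub>P m\<^esub> \<zero>\<^bsub>P m\<^esub> = \<zero>\<^bsub>P m\<^esub>"
    proof -
      have "(\<lambda>p. Z \<odot>\<^bsub>P m\<^esub> p) \<in> add_hom (P m) (P m)"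
        using Z P.smult_closed P.smult_r_distr by (intro add_homI) blast+
      from add_hom_zero[OF this P.M.abelian_group_axioms P.M.abelian_group_axioms]
      show ?thesis .
    qed
    then show "Z \<odot>\<^bsub>P m\<^esub> ?f h = diff_term m Z i h"
      using P.smult_assoc1[OF Z, of "y (koszul_sign (Suc m)) h" "ft m (lower i h)"]
        f_tilde_mem[OF multi_indices_lower[OF i, of h]] h
      by (simp add: diff_term_def)
  qed
  finally show ?thesis .
qed

lemma koszul_diff_f_tilde:
  assumes "i \<in> MI (Suc m)"
  shows "d (Suc m) (ft (Suc m) i) = finsum (P m) (diff_term m \<one>\<^bsub>A\<^esub> i) {1..n}"
  using koszul_diff_smult[OF reg.E.A.one_closed assms]
    left_module.smult_one[OF koszul_left_module f_tilde_mem[OF assms]] by simp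

text \<open>Lowering at g and h in either order gives the same basis element, and the two
  coefficients cancel by \<open>y_anticommute\<close>. Lowering twice at one index has coefficient
  zero by \<open>y_square\<close>.\<close>

lemma koszul_diff_diff:
  assumes p: "p \<in> carrier (P (Suc (Suc m)))"
  shows "d (Suc m) (d (Suc (Suc m)) p) = \<zero>\<^bsub>P m\<^esub>"
proof -
  \<comment> \<open>Regarding zero as a linear map reduces the claim to basis elements.\<close>
  have zero: "(\<lambda>p. \<zero>\<^bsub>P m\<^esub>) \<in> left_module_hom A (P (Suc (Suc m))) (P m)"
  proof (rule left_module_homI)
    fix Z assume Z: "Z \<in> carrier A"
    have "(\<lambda>p. Z \<odot>\<^bsub>P m\<^esub> p) \<in> add_hom (P m) (P m)"
      using Z P.smult_closed P.smult_r_distr by (intro add_homI) blast+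
    from add_hom_zero[OF this P.M.abelian_group_axioms P.M.abelian_group_axioms]
    show "\<zero>\<^bsub>P m\<^esub> = Z \<odot>\<^bsub>P m\<^esub> \<zero>\<^bsub>P m\<^esub>" by simp
  qed (use P.M.zero_closed P.M.l_zero in \<open>simp_all del: koszul_module_simps\<close>)
  show ?thesis
  proof (rule P.hom_eq[OF koszul_left_module left_module_hom_comp[OF koszul_diff_hom koszul_diff_hom]
        zero _ p])
    fix i assume i: "i \<in> MI (Suc (Suc m))"
    let ?s = "koszul_sign (Suc m)"
    have s: "?s \<in> carrier K" "koszul_sign (Suc (Suc m)) = \<ominus>\<^bsub>K\<^esub> ?s" by (simp_all add: koszul_sign_Suc[of "Suc m"])
    \<comment> \<open>The second condition looks at the exponent after lowering at \<open>g\<close>,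
      so for \<open>g = h\<close> an entry with coefficient \<open>y_square\<close> remains only for
      exponents of at least two.\<close>
    define F where "F g h = (if i g = 0 \<or> lower i g h = 0 then \<zero>\<^bsub>P m\<^esub>
      else (y (\<ominus>\<^bsub>K\<^esub> ?s) g \<otimes>\<^bsub>A\<^esub> y ?s h) \<odot>\<^bsub>P m\<^esub> ft m (lower (lower i g) h))" for g h
    have low: "lower i g \<in> MI (Suc m)" if "i g \<noteq> 0" for g by (rule multi_indices_lower[OF i that])
    have low2: "ft m (lower (lower i g) h) \<in> carrier (P m)" if "i g \<noteq> 0" "lower i g h \<noteq> 0" for g h
      by (rule f_tilde_mem[OF multi_indices_lower[OF low[OF that(1)] that(2)]])
    have Fc: "F g h \<in> carrier (P m)" if "g \<in> {1..n}" "h \<in> {1..n}" for g h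
      using that low2[of g h] P.M.zero_closed
      by (auto simp: F_def simp del: koszul_module_simps intro!: P.smult_closed)
    have z: "\<zero>\<^bsub>A\<^esub> \<odot>\<^bsub>P m\<^esub> p = \<zero>\<^bsub>P m\<^esub>" if "p \<in> carrier (P m)" for p
      by (rule left_module_smult_zero[OF koszul_left_module that])
    have row: "d (Suc m) (diff_term (Suc m) \<one>\<^bsub>A\<^esub> i g) = finsum (P m) (F g) {1..n}"
      if g: "g \<in> {1..n}" for g
    proof (cases "i g = 0")
      case True
      have "d (Suc m) (diff_term (Suc m) \<one>\<^bsub>A\<^esub> i g) = \<zero>\<^bsub>P m\<^esub>"
        using True add_hom_zero[OF koszul_diff_add_hom koszul_abelian_group koszul_abelian_group, of m]
        by (simp add: diff_term_def)
      moreover have "F g = (\<lambda>h. \<zero>\<^bsub>P m\<^esub>)"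
        using True by (simp add: F_def fun_eq_iff)
      ultimately show ?thesis by (simp add: P.M.finsum_zero del: koszul_module_simps)
    next
      case False
      have "d (Suc m) (diff_term (Suc m) \<one>\<^bsub>A\<^esub> i g) =
          finsum (P m) (diff_term m (y (\<ominus>\<^bsub>K\<^esub> ?s) g) (lower i g)) {1..n}"
        using False g s(1)
          koszul_diff_smult[OF y_closed[OF K.a_inv_closed[OF s(1)] g] low[OF False]]
        by (simp add: diff_term_def s(2))
      also have "diff_term m (y (\<ominus>\<^bsub>K\<^esub> ?s) g) (lower i g) = F g"
        using False by (auto simp: diff_term_def F_def fun_eq_iff)
      finally show ?thesis .
    qed
    have dt: "diff_term (Suc m) \<one>\<^bsub>A\<^esub> i \<in> {1..n} \<rightarrow> carrier (P (Suc m))"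
      using diff_term_closed[OF i reg.E.A.one_closed] by auto
    have "d (Suc m) (d (Suc (Suc m)) (ft (Suc (Suc m)) i)) =
        finsum (P m) (\<lambda>g. d (Suc m) (diff_term (Suc m) \<one>\<^bsub>A\<^esub> i g)) {1..n}"
      unfolding koszul_diff_f_tilde[OF i]
      by (rule add_hom_finsum[OF koszul_diff_add_hom koszul_abelian_group koszul_abelian_group dt])
    also have "\<dots> = finsum (P m) (\<lambda>g. finsum (P m) (F g) {1..n}) {1..n}"
      using Fc by (intro P.M.finsum_cong') (auto simp: row intro!: P.M.finsum_closed)
    also have "\<dots> = \<zero>\<^bsub>P m\<^esub>"
    proof (rule P.M.antisymmetric_double_sum)
      fix g assume g: "g \<in> {1..n}"
      show "F g g = \<zero>\<^bsub>P m\<^esub>"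
        using z[OF low2[of g g]] y_square[OF s(1) g] by (simp add: F_def)
      fix h assume h: "h \<in> {1..n}"
      show "F g h \<oplus>\<^bsub>P m\<^esub> F h g = \<zero>\<^bsub>P m\<^esub>"
      \<comment> \<open>For distinct indices, lowering at one leaves a zero exponent at the other,
        so a missing letter kills both orders.\<close>
      proof (cases "g = h \<or> i g = 0 \<or> i h = 0")
        case True
        have hh: "F h h = \<zero>\<^bsub>P m\<^esub>"
          using z[OF low2[of h h]] y_square[OF s(1) h] by (simp add: F_def)
        have "F g h = \<zero>\<^bsub>P m\<^esub>" "F h g = \<zero>\<^bsub>P m\<^esub>"
        proof -
          show "F g h = \<zero>\<^bsub>P m\<^esub>"
            using True hh by (cases "g = h") (simp_all add: F_def)
          show "F h g = \<zero>\<^bsub>P m\<^esub>"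
          proof (cases "h = g")
            case False
            then have "i h = 0 \<or> lower i h g = 0" using True by auto
            then show ?thesis unfolding F_def by (simp only: if_True)
          qed (use hh in simp)
        qed
        then show ?thesis by (simp only: P.M.l_zero[OF P.M.zero_closed])
      next
        case False
        have tw: "lower (lower i g) h = lower (lower i h) g"
          using False by (auto simp: fun_eq_iff)
        have "F g h \<oplus>\<^bsub>P m\<^esub> F h g = (y (\<ominus>\<^bsub>K\<^esub> ?s) g \<otimes>\<^bsub>A\<^esub> y ?s h \<oplus>\<^bsub>A\<^esub> y (\<ominus>\<^bsub>K\<^esub> ?s) h \<otimes>\<^bsub>A\<^esub> y ?s g)
            \<odot>\<^bsub>P m\<^esub> ft m (lower (lower i g) h)"
        proof -
          have nz: "\<not> (i g = 0 \<or> lower i g h = 0)" "\<not> (i h = 0 \<or> lower i h g = 0)"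
            using False by auto
          have e: "F g h = (y (\<ominus>\<^bsub>K\<^esub> ?s) g \<otimes>\<^bsub>A\<^esub> y ?s h) \<odot>\<^bsub>P m\<^esub> ft m (lower (lower i g) h)"
            "F h g = (y (\<ominus>\<^bsub>K\<^esub> ?s) h \<otimes>\<^bsub>A\<^esub> y ?s g) \<odot>\<^bsub>P m\<^esub> ft m (lower (lower i g) h)"
            unfolding tw unfolding F_def by (simp_all only: nz if_False tw)
          have "ft m (lower (lower i g) h) \<in> carrier (P m)" using nz by (intro low2) auto
          then show ?thesis
            unfolding e using g h s(1)
            by (intro P.smult_l_distr[symmetric]) (simp_all del: koszul_module_simps)
        qed
        also have "\<dots> = \<zero>\<^bsub>P m\<^esub>"
          unfolding y_anticommute[OF s(1) g h] using False by (intro z low2) auto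
        finally show ?thesis .
      qed
    qed (use Fc in auto)
    finally show "d (Suc m) (d (Suc (Suc m)) (ft (Suc (Suc m)) i)) = \<zero>\<^bsub>P m\<^esub>" .
  qed
qed

end

section \<open>Exactness\<close>

context exterior
begin

lemma coord_smult_f_tilde:
  assumes "Z \<in> carrier A" "i \<in> MI m" "j \<in> MI m"
  shows "coord m j (Z \<odot>\<^bsub>P m\<^esub> ft m i) = (if i = j then Z else \<zero>\<^bsub>A\<^esub>)"
  using assms by (auto simp: coord_smult f_tilde_closed coord_f_tilde)

lemma coord_add_hom: "j \<in> MI m \<Longrightarrow> coord m j \<in> add_hom (P m) A"
  by (rule add_homI[OF P.c_closed P.c_add])

lemma env_contract_zero: "env_contract h \<zero>\<^bsub>A\<^esub> = \<zero>\<^bsub>A\<^esub>"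
  by (rule add_hom_zero[OF left_module_hom_add_hom[OF env_contract_hom]
        reg.E.M.M.abelian_group_axioms reg.E.M.M.abelian_group_axioms])

lemma koszul_zero_smult: "p \<in> carrier (P m) \<Longrightarrow> \<zero>\<^bsub>A\<^esub> \<odot>\<^bsub>P m\<^esub> p = \<zero>\<^bsub>P m\<^esub>"
  by (rule left_module_smult_zero[OF koszul_left_module])

section \<open>The homotopy attached to one generator\<close>

text \<open>The map is written in coordinates because contraction is not linear over the enveloping
  algebra, so it cannot be obtained by linear extension from the basis.\<close>

definition homotopy :: "nat \<Rightarrow> nat \<Rightarrow> 'k triple \<Rightarrow> 'k triple"
  where "homotopy m h p = finsum (P (Suc m))
    (\<lambda>i. env_contract h (coord m i p) \<odot>\<^bsub>P (Suc m)\<^esub> ft (Suc m) (raise i h)) (MI m)"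

lemma raised_f_tilde: "i \<in> MI m \<Longrightarrow> h \<in> {1..n} \<Longrightarrow> ft (Suc m) (raise i h) \<in> carrier (P (Suc m))"
  by (rule f_tilde_mem[OF multi_indices_raise])

lemma homotopy_term_closed:
  "p \<in> carrier (P m) \<Longrightarrow> h \<in> {1..n} \<Longrightarrow>
    (\<lambda>i. env_contract h (coord m i p) \<odot>\<^bsub>P (Suc m)\<^esub> ft (Suc m) (raise i h)) \<in> MI m \<rightarrow> carrier (P (Suc m))"
  by (intro Pi_I P.smult_closed env_contract_closed P.c_closed raised_f_tilde)

lemma homotopy_add_hom:
  assumes h: "h \<in> {1..n}"
  shows "homotopy m h \<in> add_hom (P m) (P (Suc m))"
proof (rule add_homI)
  note cl = homotopy_term_closed[OF _ h]
  fix p assume p: "p \<in> carrier (P m)"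
  show "homotopy m h p \<in> carrier (P (Suc m))"
    unfolding homotopy_def by (rule P.M.finsum_closed[OF cl[OF p]])
  fix q assume q: "q \<in> carrier (P m)"
  have "homotopy m h (p \<oplus>\<^bsub>P m\<^esub> q) = finsum (P (Suc m))
      (\<lambda>i. env_contract h (coord m i p) \<odot>\<^bsub>P (Suc m)\<^esub> ft (Suc m) (raise i h) \<oplus>\<^bsub>P (Suc m)\<^esub>
        env_contract h (coord m i q) \<odot>\<^bsub>P (Suc m)\<^esub> ft (Suc m) (raise i h)) (MI m)"
    unfolding homotopy_def
  proof (rule P.M.finsum_cong'[OF refl])
    show "(\<lambda>i. env_contract h (coord m i p) \<odot>\<^bsub>P (Suc m)\<^esub> ft (Suc m) (raise i h) \<oplus>\<^bsub>P (Suc m)\<^esub>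
        env_contract h (coord m i q) \<odot>\<^bsub>P (Suc m)\<^esub> ft (Suc m) (raise i h)) \<in> MI m \<rightarrow> carrier (P (Suc m))"
      using cl[OF p] cl[OF q] by (intro Pi_I P.M.a_closed) auto
    fix i assume i: "i \<in> MI m"
    note c = P.c_closed[OF i p] P.c_closed[OF i q]
    show "env_contract h (coord m i (p \<oplus>\<^bsub>P m\<^esub> q)) \<odot>\<^bsub>P (Suc m)\<^esub> ft (Suc m) (raise i h) =
        env_contract h (coord m i p) \<odot>\<^bsub>P (Suc m)\<^esub> ft (Suc m) (raise i h) \<oplus>\<^bsub>P (Suc m)\<^esub>
        env_contract h (coord m i q) \<odot>\<^bsub>P (Suc m)\<^esub> ft (Suc m) (raise i h)"
      unfolding P.c_add[OF i p q] left_module_hom_add[OF env_contract_hom c]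
      by (rule P.smult_l_distr[OF env_contract_closed[OF c(1)] env_contract_closed[OF c(2)]
            raised_f_tilde[OF i h]])
  qed
  also have "\<dots> = homotopy m h p \<oplus>\<^bsub>P (Suc m)\<^esub> homotopy m h q"
    unfolding homotopy_def by (rule P.M.finsum_addf[OF cl[OF p] cl[OF q]])
  finally show "homotopy m h (p \<oplus>\<^bsub>P m\<^esub> q) = homotopy m h p \<oplus>\<^bsub>P (Suc m)\<^esub> homotopy m h q" .
qed

lemmas homotopy_closed = add_hom_closed[OF homotopy_add_hom]

lemma homotopy_smult:
  assumes h: "h \<in> {1..n}" and Z: "Z \<in> carrier A" and i: "i \<in> MI m"
  shows "homotopy m h (Z \<odot>\<^bsub>P m\<^esub> ft m i) = env_contract h Z \<odot>\<^bsub>P (Suc m)\<^esub> ft (Suc m) (raise i h)"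
    (is "_ = ?r")
proof -
  have r: "?r \<in> carrier (P (Suc m))"
    by (rule P.smult_closed[OF env_contract_closed[OF Z] raised_f_tilde[OF i h]])
  have "homotopy m h (Z \<odot>\<^bsub>P m\<^esub> ft m i) =
      finsum (P (Suc m)) (\<lambda>j. if i = j then ?r else \<zero>\<^bsub>P (Suc m)\<^esub>) (MI m)"
    unfolding homotopy_def
  proof (rule P.M.finsum_cong'[OF refl])
    show "(\<lambda>j. if i = j then ?r else \<zero>\<^bsub>P (Suc m)\<^esub>) \<in> MI m \<rightarrow> carrier (P (Suc m))"
      using r P.M.zero_closed[of "Suc m"] by auto
    fix j assume j: "j \<in> MI m"
    show "env_contract h (coord m j (Z \<odot>\<^bsub>P m\<^esub> ft m i)) \<odot>\<^bsub>P (Suc m)\<^esub> ft (Suc m) (raise j h) =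
        (if i = j then ?r else \<zero>\<^bsub>P (Suc m)\<^esub>)"
      using koszul_zero_smult[OF raised_f_tilde[OF j h]]
      unfolding coord_smult_f_tilde[OF Z i j] by (cases "i = j") (simp_all add: env_contract_zero)
  qed
  also have "\<dots> = ?r"
    using r finite_multi_indices i by (intro P.M.finsum_singleton) auto
  finally show ?thesis .
qed

text \<open>For each \<open>g\<close> the summand of d s and that of s d belong to the same index,
  \<open>i\<close> raised at \<open>h\<close> and lowered at \<open>g\<close>. By
  \<open>env_contract_y\<close> their coefficients add up to zero for \<open>g\<close> different
  from \<open>h\<close>, and to \<open>Z\<close> for \<open>g = h\<close>. If
  \<open>i h = 0\<close>, the summand of s d at \<open>g = h\<close> is absent, and only the
  contraction term is left.\<close>

lemma homotopy_identity:
  assumes h: "h \<in> {1..n}" and Z: "Z \<in> carrier A" and i: "i \<in> MI (Suc m)"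
  shows "d (Suc (Suc m)) (homotopy (Suc m) h (Z \<odot>\<^bsub>P (Suc m)\<^esub> ft (Suc m) i))
      \<oplus>\<^bsub>P (Suc m)\<^esub> homotopy m h (d (Suc m) (Z \<odot>\<^bsub>P (Suc m)\<^esub> ft (Suc m) i)) =
    (if i h \<noteq> 0 then Z else env_contract h Z \<otimes>\<^bsub>A\<^esub> y (koszul_sign (Suc (Suc m))) h)
      \<odot>\<^bsub>P (Suc m)\<^esub> ft (Suc m) i"
proof -
  let ?\<kappa> = "env_contract h" and ?M = "P (Suc m)" and ?s = "koszul_sign (Suc m)"
  \<comment> \<open>The differential applied after the homotopy lives one degree higher and has the
    opposite sign, as \<open>env_contract_y\<close> requires.\<close>
  have s: "?s \<in> carrier K" "koszul_sign (Suc (Suc m)) = \<ominus>\<^bsub>K\<^esub> ?s" by (simp_all add: koszul_sign_Suc[of "Suc m"])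
  note \<kappa>Z = env_contract_closed[OF Z, of h]
  note ri = multi_indices_raise[OF i h]
  let ?X = "(if i h \<noteq> 0 then Z else ?\<kappa> Z \<otimes>\<^bsub>A\<^esub> y (\<ominus>\<^bsub>K\<^esub> ?s) h)"
  have X: "?X \<odot>\<^bsub>?M\<^esub> ft (Suc m) i \<in> carrier ?M"
    using Z \<kappa>Z h s(1) by (intro P.smult_closed f_tilde_mem i) auto
  define a where "a g = diff_term (Suc m) (?\<kappa> Z) (raise i h) g" for g
  define b where "b g = homotopy m h (diff_term m Z i g)" for g
  have a: "a \<in> {1..n} \<rightarrow> carrier ?M"
    unfolding a_def using diff_term_closed[OF ri \<kappa>Z] by auto
  have dt: "diff_term m Z i \<in> {1..n} \<rightarrow> carrier (P m)"
    using diff_term_closed[OF i Z] by auto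
  have b: "b \<in> {1..n} \<rightarrow> carrier ?M"
    unfolding b_def using dt homotopy_closed[OF h] by auto
  have "d (Suc (Suc m)) (homotopy (Suc m) h (Z \<odot>\<^bsub>?M\<^esub> ft (Suc m) i)) = finsum ?M a {1..n}"
    unfolding homotopy_smult[OF h Z i] koszul_diff_smult[OF \<kappa>Z ri] a_def ..
  moreover have "homotopy m h (d (Suc m) (Z \<odot>\<^bsub>?M\<^esub> ft (Suc m) i)) = finsum ?M b {1..n}"
    unfolding koszul_diff_smult[OF Z i] b_def
    by (rule add_hom_finsum[OF homotopy_add_hom[OF h] koszul_abelian_group koszul_abelian_group dt])
  moreover have "finsum ?M a {1..n} \<oplus>\<^bsub>?M\<^esub> finsum ?M b {1..n} = finsum ?M (\<lambda>g. a g \<oplus>\<^bsub>?M\<^esub> b g) {1..n}"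
    by (rule P.M.finsum_addf[OF a b, symmetric])
  moreover have "finsum ?M (\<lambda>g. a g \<oplus>\<^bsub>?M\<^esub> b g) {1..n} =
      finsum ?M (\<lambda>g. if h = g then ?X \<odot>\<^bsub>?M\<^esub> ft (Suc m) i else \<zero>\<^bsub>?M\<^esub>) {1..n}"
  proof (rule P.M.finsum_cong'[OF refl])
    show "(\<lambda>g. if h = g then ?X \<odot>\<^bsub>?M\<^esub> ft (Suc m) i else \<zero>\<^bsub>?M\<^esub>) \<in> {1..n} \<rightarrow> carrier ?M"
      using X P.M.zero_closed[of "Suc m"] by auto
    fix g assume g: "g \<in> {1..n}"
    have bnz: "b g = ?\<kappa> (Z \<otimes>\<^bsub>A\<^esub> y ?s g) \<odot>\<^bsub>?M\<^esub> ft (Suc m) (raise (lower i g) h)" if "i g \<noteq> 0"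
      using that homotopy_smult[OF h reg.E.A.m_closed[OF Z y_closed[OF s(1) g]] multi_indices_lower[OF i that]]
      by (simp add: b_def diff_term_def)
    have bz: "b g = \<zero>\<^bsub>?M\<^esub>" if "i g = 0"
      using that add_hom_zero[OF homotopy_add_hom[OF h] koszul_abelian_group koszul_abelian_group, of m]
      by (simp add: b_def diff_term_def)
    have anz: "a g = (?\<kappa> Z \<otimes>\<^bsub>A\<^esub> y (\<ominus>\<^bsub>K\<^esub> ?s) g) \<odot>\<^bsub>?M\<^esub> ft (Suc m) (lower (raise i h) g)"
      if "raise i h g \<noteq> 0"
      using that by (simp add: a_def diff_term_def s(2))
    have az: "a g = \<zero>\<^bsub>?M\<^esub>" if "raise i h g = 0"
      using that by (simp add: a_def diff_term_def)
    have cl: "?\<kappa> (Z \<otimes>\<^bsub>A\<^esub> y ?s g) \<in> carrier A" "?\<kappa> Z \<otimes>\<^bsub>A\<^esub> y (\<ominus>\<^bsub>K\<^esub> ?s) g \<in> carrier A"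
      using Z s(1) g \<kappa>Z by (auto intro!: env_contract_closed)
    have sum: "(?\<kappa> Z \<otimes>\<^bsub>A\<^esub> y (\<ominus>\<^bsub>K\<^esub> ?s) g) \<odot>\<^bsub>?M\<^esub> t \<oplus>\<^bsub>?M\<^esub> ?\<kappa> (Z \<otimes>\<^bsub>A\<^esub> y ?s g) \<odot>\<^bsub>?M\<^esub> t =
        (if g = h then Z else \<zero>\<^bsub>A\<^esub>) \<odot>\<^bsub>?M\<^esub> t" if t: "t \<in> carrier ?M" for t
      unfolding P.smult_l_distr[OF cl(2,1) t, symmetric]
      using env_contract_y[OF Z s(1) g, of h] reg.E.M.M.a_comm[OF cl] by simp
    show "a g \<oplus>\<^bsub>?M\<^esub> b g = (if h = g then ?X \<odot>\<^bsub>?M\<^esub> ft (Suc m) i else \<zero>\<^bsub>?M\<^esub>)"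
    proof (cases "h = g")
      case True
      have l: "lower (raise i h) g = i" using True by auto
      have a': "a g = (?\<kappa> Z \<otimes>\<^bsub>A\<^esub> y (\<ominus>\<^bsub>K\<^esub> ?s) g) \<odot>\<^bsub>?M\<^esub> ft (Suc m) i"
        using anz unfolding l using True by simp
      show ?thesis
      proof (cases "i g = 0")
        case z: True
        have "a g \<in> carrier ?M" using a g by auto
        from P.M.r_zero[OF this] show ?thesis
          unfolding bz[OF z] using z True a' by (simp del: koszul_module_simps)
      next
        case nz: False
        have "raise (lower i g) h = i" using True nz by auto
        then have "a g \<oplus>\<^bsub>?M\<^esub> b g = Z \<odot>\<^bsub>?M\<^esub> ft (Suc m) i"
          using sum[OF f_tilde_mem[OF i]] True
          unfolding a' bnz[OF nz] by (simp del: koszul_module_simps)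
        then show ?thesis using True nz by (simp del: koszul_module_simps)
      qed
    next
      case False
      then have rg: "raise i h g = i g" by simp
      show ?thesis
      proof (cases "i g = 0")
        case True
        then show ?thesis
          using False P.M.l_zero[OF P.M.zero_closed[of "Suc m"]] bz az rg by (simp del: koszul_module_simps)
      next
        case nz: False
        have t: "ft (Suc m) (raise (lower i g) h) \<in> carrier ?M"
          by (rule raised_f_tilde[OF multi_indices_lower[OF i nz] h])
        have c: "lower (raise i h) g = raise (lower i g) h"
          using False by (auto simp: fun_eq_iff)
        have a': "a g = (?\<kappa> Z \<otimes>\<^bsub>A\<^esub> y (\<ominus>\<^bsub>K\<^esub> ?s) g) \<odot>\<^bsub>?M\<^esub> ft (Suc m) (raise (lower i g) h)"
          using anz[unfolded c] nz rg by simp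
        have "a g \<oplus>\<^bsub>?M\<^esub> b g = \<zero>\<^bsub>A\<^esub> \<odot>\<^bsub>?M\<^esub> ft (Suc m) (raise (lower i g) h)"
          unfolding bnz[OF nz] a' sum[OF t] using False by simp
        then show ?thesis using False koszul_zero_smult[OF t] by (simp del: koszul_module_simps)
      qed
    qed
  qed
  moreover have "finsum ?M (\<lambda>g. if h = g then ?X \<odot>\<^bsub>?M\<^esub> ft (Suc m) i else \<zero>\<^bsub>?M\<^esub>) {1..n} =
      ?X \<odot>\<^bsub>?M\<^esub> ft (Suc m) i"
    using X h by (intro P.M.finsum_singleton) auto
  ultimately show ?thesis unfolding s(2) by metis
qed

text \<open>The right-hand side involves only the coordinate at the same \<open>j\<close>. This is
  what lets the homotopies be used one after another without undoing earlier corrections.\<close>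

lemma coord_homotopy:
  assumes h: "h \<in> {1..n}" and p: "p \<in> carrier (P (Suc m))" and j: "j \<in> MI (Suc m)"
  shows "coord (Suc m) j (d (Suc (Suc m)) (homotopy (Suc m) h p)
      \<oplus>\<^bsub>P (Suc m)\<^esub> homotopy m h (d (Suc m) p)) =
    (if j h \<noteq> 0 then coord (Suc m) j p
      else env_contract h (coord (Suc m) j p) \<otimes>\<^bsub>A\<^esub> y (koszul_sign (Suc (Suc m))) h)"
    (is "?l p = ?r p")
proof -
  let ?s = "koszul_sign (Suc (Suc m))"
  note ys = y_closed[OF koszul_sign_closed[of "Suc (Suc m)"] h]
  have L: "?l \<in> add_hom (P (Suc m)) A"
  proof -
    let ?f = "\<lambda>p. d (Suc (Suc m)) (homotopy (Suc m) h p)" and ?g = "\<lambda>p. homotopy m h (d (Suc m) p)"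
    have f: "?f \<in> add_hom (P (Suc m)) (P (Suc m))" and g: "?g \<in> add_hom (P (Suc m)) (P (Suc m))"
      by (rule add_hom_comp[OF homotopy_add_hom[OF h] koszul_diff_add_hom],
          rule add_hom_comp[OF koszul_diff_add_hom homotopy_add_hom[OF h]])
    note fc = add_hom_closed[OF f] and gc = add_hom_closed[OF g]
    have "(\<lambda>p. ?f p \<oplus>\<^bsub>P (Suc m)\<^esub> ?g p) \<in> add_hom (P (Suc m)) (P (Suc m))"
    proof (rule add_homI)
      fix p q assume p: "p \<in> carrier (P (Suc m))" and q: "q \<in> carrier (P (Suc m))"
      show "?f (p \<oplus>\<^bsub>P (Suc m)\<^esub> q) \<oplus>\<^bsub>P (Suc m)\<^esub> ?g (p \<oplus>\<^bsub>P (Suc m)\<^esub> q) =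
          (?f p \<oplus>\<^bsub>P (Suc m)\<^esub> ?g p) \<oplus>\<^bsub>P (Suc m)\<^esub> (?f q \<oplus>\<^bsub>P (Suc m)\<^esub> ?g q)"
        unfolding add_hom_add[OF f p q] add_hom_add[OF g p q]
        using fc[OF p] fc[OF q] gc[OF p] gc[OF q] by (simp add: P.M.a_ac del: koszul_module_simps)
    qed (use fc gc P.M.a_closed in blast)
    from add_hom_comp[OF this coord_add_hom[OF j]] show ?thesis .
  qed
  have R: "?r \<in> add_hom (P (Suc m)) A"
    using j ys env_contract_closed
    by (intro add_homI) (auto simp: P.c_closed P.c_add left_module_hom_add[OF env_contract_hom]
        reg.E.A.l_distr simp del: koszul_module_simps)
  show ?thesis using p
  proof (induction p rule: P.basis_induct)
    case (smult Z i)
    have "?l (Z \<odot>\<^bsub>P (Suc m)\<^esub> ft (Suc m) i) = (if i = j then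
        (if i h \<noteq> 0 then Z else env_contract h Z \<otimes>\<^bsub>A\<^esub> y ?s h) else \<zero>\<^bsub>A\<^esub>)"
      unfolding homotopy_identity[OF h smult]
      using smult ys env_contract_closed by (intro coord_smult_f_tilde j) auto
    also have "\<dots> = ?r (Z \<odot>\<^bsub>P (Suc m)\<^esub> ft (Suc m) i)"
      unfolding coord_smult_f_tilde[OF smult j] using ys by (auto simp: env_contract_zero)
    finally show ?case .
  next
    case zero
    show ?case
      using add_hom_zero[OF L koszul_abelian_group reg.E.M.M.abelian_group_axioms]
        add_hom_zero[OF R koszul_abelian_group reg.E.M.M.abelian_group_axioms] by simp
  next
    case (add p q)
    then show ?case using add_hom_add[OF L add(1,2)] add_hom_add[OF R add(1,2)] by simp
  qed
qed

section \<open>Cycles of positive degree are boundaries\<close>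

lemma coord_eq_zero:
  assumes p: "p \<in> carrier (P m)" and z: "\<And>i. i \<in> MI m \<Longrightarrow> coord m i p = \<zero>\<^bsub>A\<^esub>"
  shows "p = \<zero>\<^bsub>P m\<^esub>"
proof -
  have "p = finsum (P m) (\<lambda>i. coord m i p \<odot>\<^bsub>P m\<^esub> ft m i) (MI m)" by (rule P.expand[OF p])
  also have "\<dots> = finsum (P m) (\<lambda>i. \<zero>\<^bsub>P m\<^esub>) (MI m)"
    by (rule P.M.finsum_cong'[OF refl])
      (use z koszul_zero_smult[OF f_tilde_mem] P.M.zero_closed[of m] in auto)
  finally show ?thesis by (simp only: P.M.finsum_zero)
qed

lemma koszul_diff_zero: "d (Suc m) \<zero>\<^bsub>P (Suc m)\<^esub> = \<zero>\<^bsub>P m\<^esub>"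
  by (rule add_hom_zero[OF koszul_diff_add_hom koszul_abelian_group koszul_abelian_group])

text \<open>The correction for the next index is the boundary of the homotopy of the current
  remainder. Where that exponent is nonzero it equals the coordinate and removes it; elsewhere it is
  built from the contraction of the coordinate, hence zero if the coordinate has been cleared
  before.\<close>

lemma cycle_boundary_filtration:
  assumes p: "p \<in> carrier (P (Suc m))" and dp: "d (Suc m) p = \<zero>\<^bsub>P m\<^esub>" and "h \<le> n"
  shows "\<exists>q\<in>carrier (P (Suc (Suc m))). \<forall>j\<in>MI (Suc m). (\<exists>g\<in>{1..h}. j g \<noteq> 0) \<longrightarrow>
    coord (Suc m) j (p \<ominus>\<^bsub>P (Suc m)\<^esub> d (Suc (Suc m)) q) = \<zero>\<^bsub>A\<^esub>"
  using assms(3)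
proof (induction h)
  case 0
  show ?case using P.M.zero_closed[of "Suc (Suc m)"] by auto
next
  case (Suc h)
  let ?M = "P (Suc m)"
  from Suc obtain q where q: "q \<in> carrier (P (Suc (Suc m)))"
    and qz: "\<And>j. j \<in> MI (Suc m) \<Longrightarrow> \<exists>g\<in>{1..h}. j g \<noteq> 0 \<Longrightarrow>
      coord (Suc m) j (p \<ominus>\<^bsub>?M\<^esub> d (Suc (Suc m)) q) = \<zero>\<^bsub>A\<^esub>" by auto
  have h: "Suc h \<in> {1..n}" using Suc.prems by simp
  define r where "r = p \<ominus>\<^bsub>?M\<^esub> d (Suc (Suc m)) q"
  note dq = koszul_diff_closed[OF q]
  have r: "r \<in> carrier ?M" unfolding r_def using p dq by (rule P.M.minus_closed)
  have dr: "d (Suc m) r = \<zero>\<^bsub>P m\<^esub>"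
  proof -
    have "d (Suc m) r = d (Suc m) p \<ominus>\<^bsub>P m\<^esub> d (Suc m) (d (Suc (Suc m)) q)"
      unfolding r_def
      by (rule add_hom_diff[OF koszul_diff_add_hom koszul_abelian_group koszul_abelian_group p dq])
    also have "\<dots> = \<zero>\<^bsub>P m\<^esub>"
      unfolding dp koszul_diff_diff[OF q] a_minus_def by (rule P.M.r_neg[OF P.M.zero_closed])
    finally show ?thesis .
  qed
  let ?t = "homotopy (Suc m) (Suc h) r"
  have t: "?t \<in> carrier (P (Suc (Suc m)))" by (rule homotopy_closed[OF h r])
  note dt = koszul_diff_closed[OF t]
  \<comment> \<open>The remainder is still a cycle, so s d contributes nothing and
    \<open>coord_homotopy\<close> describes the boundary d s alone.\<close>
  have "homotopy m (Suc h) (d (Suc m) r) = \<zero>\<^bsub>?M\<^esub>"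
    unfolding dr by (rule add_hom_zero[OF homotopy_add_hom[OF h] koszul_abelian_group koszul_abelian_group])
  then have c: "coord (Suc m) j (d (Suc (Suc m)) ?t) =
      (if j (Suc h) \<noteq> 0 then coord (Suc m) j r
        else env_contract (Suc h) (coord (Suc m) j r) \<otimes>\<^bsub>A\<^esub> y (koszul_sign (Suc (Suc m))) (Suc h))"
    if "j \<in> MI (Suc m)" for j
    using coord_homotopy[OF h r that] P.M.r_zero[OF dt] by simp
  have eq: "p \<ominus>\<^bsub>?M\<^esub> d (Suc (Suc m)) (q \<oplus>\<^bsub>P (Suc (Suc m))\<^esub> ?t) = r \<ominus>\<^bsub>?M\<^esub> d (Suc (Suc m)) ?t"
    unfolding left_module_hom_add[OF koszul_diff_hom q t] P.M.minus_add_right[OF p dq dt]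
      r_def[symmetric] ..
  show ?case
  proof (intro bexI[of _ "q \<oplus>\<^bsub>P (Suc (Suc m))\<^esub> ?t"] ballI impI)
    show "q \<oplus>\<^bsub>P (Suc (Suc m))\<^esub> ?t \<in> carrier (P (Suc (Suc m)))" using q t by (rule P.M.a_closed)
    fix j assume j: "j \<in> MI (Suc m)" and ex: "\<exists>g\<in>{1..Suc h}. j g \<noteq> 0"
    note ca = coord_add_hom[OF j]
    have cr: "coord (Suc m) j r \<in> carrier A" by (rule P.c_closed[OF j r])
    have "coord (Suc m) j (r \<ominus>\<^bsub>?M\<^esub> d (Suc (Suc m)) ?t) =
        coord (Suc m) j r \<ominus>\<^bsub>A\<^esub> coord (Suc m) j (d (Suc (Suc m)) ?t)"
      by (rule add_hom_diff[OF ca koszul_abelian_group reg.E.M.M.abelian_group_axioms r dt])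
    also have "\<dots> = \<zero>\<^bsub>A\<^esub>"
    proof (cases "j (Suc h) \<noteq> 0")
      case True
      then show ?thesis unfolding c[OF j] using reg.E.M.M.r_neg[OF cr] by (simp add: a_minus_def)
    next
      case False
      then have "\<exists>g\<in>{1..h}. j g \<noteq> 0" using ex atLeastAtMostSuc_conv[of 1 h] by auto
      then have "coord (Suc m) j r = \<zero>\<^bsub>A\<^esub>" unfolding r_def by (rule qz[OF j])
      then show ?thesis
        unfolding c[OF j] using False y_closed[OF koszul_sign_closed[of "Suc (Suc m)"] h] reg.E.M.M.r_neg[of "\<zero>\<^bsub>A\<^esub>"]
        by (simp add: env_contract_zero a_minus_def)
    qed
    finally show "coord (Suc m) j (p \<ominus>\<^bsub>?M\<^esub> d (Suc (Suc m)) (q \<oplus>\<^bsub>P (Suc (Suc m))\<^esub> ?t)) = \<zero>\<^bsub>A\<^esub>"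
      unfolding eq .
  qed
qed

lemma cycle_is_boundary:
  assumes p: "p \<in> carrier (P (Suc m))" and dp: "d (Suc m) p = \<zero>\<^bsub>P m\<^esub>"
  shows "p \<in> d (Suc (Suc m)) ` carrier (P (Suc (Suc m)))"
proof -
  obtain q where q: "q \<in> carrier (P (Suc (Suc m)))"
    and qz: "\<And>j. j \<in> MI (Suc m) \<Longrightarrow> \<exists>g\<in>{1..n}. j g \<noteq> 0 \<Longrightarrow>
      coord (Suc m) j (p \<ominus>\<^bsub>P (Suc m)\<^esub> d (Suc (Suc m)) q) = \<zero>\<^bsub>A\<^esub>"
    using cycle_boundary_filtration[OF p dp le_refl] by auto
  note dq = koszul_diff_closed[OF q]
  have "p \<ominus>\<^bsub>P (Suc m)\<^esub> d (Suc (Suc m)) q = \<zero>\<^bsub>P (Suc m)\<^esub>"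
  \<comment> \<open>An exponent vector of positive total degree has a nonzero entry, so after the
    last correction every coordinate is covered.\<close>
  proof (rule coord_eq_zero[OF P.M.minus_closed[OF p dq]])
    fix j assume j: "j \<in> MI (Suc m)"
    obtain g where "g \<in> {1..n}" "j g \<noteq> 0" by (rule multi_indices_nonzero[OF j])
    then show "coord (Suc m) j (p \<ominus>\<^bsub>P (Suc m)\<^esub> d (Suc (Suc m)) q) = \<zero>\<^bsub>A\<^esub>" using qz[OF j] by blast
  qed
  from P.M.diff_zero_imp_eq[OF p dq this] show ?thesis using q by blast
qed

section \<open>The augmentation and exactness in degree zero\<close>

lemma aug_bilinear:
  assumes b: "b \<in> carrier E"
  shows "bilinear K E (D m) E (\<lambda>a u. u w \<odot>\<^bsub>E\<^esub> (a \<otimes>\<^bsub>E\<^esub> b))"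
proof (rule bilinearI)
  show "(\<lambda>a. u w \<odot>\<^bsub>E\<^esub> (a \<otimes>\<^bsub>E\<^esub> b)) \<in> left_module_hom K E E" if "u \<in> carrier (D m)" for u
    by (rule left_module_hom_scale[OF E.M.module_axioms E.M.module_axioms E.right_mult_hom[OF b]
          deg_apply[OF that]])
  show "(\<lambda>u. u w \<odot>\<^bsub>E\<^esub> (a \<otimes>\<^bsub>E\<^esub> b)) \<in> left_module_hom K (D m) E" if "a \<in> carrier E" for a
    by (rule deg_eval_hom[OF E.M.module_axioms E.A.m_closed[OF that b]])
qed

lemma aug_hom_right:
  assumes "a \<in> carrier E" "u \<in> carrier (D m)"
  shows "(\<lambda>b. u w \<odot>\<^bsub>E\<^esub> (a \<otimes>\<^bsub>E\<^esub> b)) \<in> left_module_hom K E E"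
  by (rule left_module_hom_scale[OF E.M.module_axioms E.M.module_axioms E.left_mult_hom[OF assms(1)]
        deg_apply[OF assms(2)]])

abbreviation "aug \<equiv> koszul_aug K n"

lemma aug_linear: "aug \<in> left_module_hom K (TT 0) E"
  unfolding koszul_aug_def
  by (rule triple_lift_hom[OF E.M.module_axioms aug_bilinear aug_hom_right])

lemma aug_pure:
  "a \<in> carrier E \<Longrightarrow> u \<in> carrier (D 0) \<Longrightarrow> b \<in> carrier E \<Longrightarrow>
    aug (pt 0 a u b) = u [] \<odot>\<^bsub>E\<^esub> (a \<otimes>\<^bsub>E\<^esub> b)"
  unfolding koszul_aug_def
  by (rule triple_lift_pure[OF E.M.module_axioms aug_bilinear aug_hom_right])

lemma ext_bimodule_eq: "ext_bimodule K n = reg.Me"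
  by (simp add: ext_bimodule_def)

lemma aug_smult:
  assumes Z: "Z \<in> carrier A" and t: "t \<in> carrier (TT 0)"
  shows "aug (Z \<odot>\<^bsub>Q 0\<^esub> t) = Z \<odot>\<^bsub>reg.Me\<^esub> aug t"
  using Z
proof (induction Z rule: reg.enveloping_induct)
  case (pure a b)
  have pe: "pe a b \<in> carrier A" using pure by (rule reg.pe_closed)
  show ?case using t
  proof (induction t rule: triple_induct)
    case (pure c u d)
    then show ?case
      using \<open>a \<in> carrier E\<close> \<open>b \<in> carrier E\<close> deg_apply[of u 0 "[]"]
      by (simp add: env_smult_pure_triple aug_pure reg.enveloping_smult_pure E.mult_smult_left
          E.mult_smult_right E.A.m_assoc)
  next
    case (add s t)
    then show ?case
      using pe by (simp add: bilinear_add_right[OF env_smult_bilinear] env_smult_closed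
          left_module_hom_add[OF aug_linear] left_module_hom_closed[OF aug_linear]
          bilinear_add_right[OF reg.enveloping_smult_bilinear])
  qed
next
  case (add y z)
  then show ?case
    using t by (simp add: bilinear_add_left[OF env_smult_bilinear] env_smult_closed
          left_module_hom_add[OF aug_linear] left_module_hom_closed[OF aug_linear]
          bilinear_add_left[OF reg.enveloping_smult_bilinear])
qed

lemma aug_hom: "aug \<in> left_module_hom A (P 0) (ext_bimodule K n)"
  unfolding ext_bimodule_eq
  by (rule left_module_homI)
    (simp_all add: left_module_hom_closed[OF aug_linear] left_module_hom_add[OF aug_linear]
      aug_smult koszul_subset)

lemma ext_bimodule_left_module: "left_module A (ext_bimodule K n)"
  unfolding ext_bimodule_eq by (rule reg.enveloping_left_module)

text \<open>This is 1 \<otimes> 1 in \<Lambda> \<otimes> \<Lambda>, with the empty word in the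
  middle. It is the only basis element in degree zero.\<close>

abbreviation "e0 \<equiv> ft 0 (\<lambda>_. 0)"

lemma multi_indices_0: "MI 0 = {\<lambda>_. 0}"
proof
  show "MI 0 \<subseteq> {\<lambda>_. 0}"
  proof
    fix i assume "i \<in> MI 0"
    then have "i h = 0" for h by (cases "h \<in> {1..n}") (auto simp: multi_indices_def)
    then show "i \<in> {\<lambda>_. 0}" by auto
  qed
qed (simp add: multi_indices_def)

lemma e0_closed: "e0 \<in> carrier (P 0)"
  by (rule f_tilde_mem) (simp add: multi_indices_0)

lemma aug_e0: "aug e0 = \<one>\<^bsub>E\<^esub>"
proof -
  have "f_elt K n 0 (\<lambda>_. 0) \<in> carrier (D 0)" by (rule f_elt_deg) (simp add: multi_indices_0)
  then show ?thesis
    unfolding f_tilde_def by (simp add: aug_pure free_algebra_simps single_def)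
qed

lemma aug_pe_e0:
  assumes "a \<in> carrier E" "b \<in> carrier E"
  shows "aug (pe a b \<odot>\<^bsub>P 0\<^esub> e0) = a \<otimes>\<^bsub>E\<^esub> b"
  using assms aug_smult[OF reg.pe_closed[OF assms] koszul_subset[OF e0_closed]]
  by (simp add: aug_e0 reg.enveloping_smult_pure)

lemma aug_surj: "aug ` carrier (P 0) = carrier (ext_bimodule K n)"
proof
  show "aug ` carrier (P 0) \<subseteq> carrier (ext_bimodule K n)"
    using left_module_hom_closed[OF aug_hom] by auto
  show "carrier (ext_bimodule K n) \<subseteq> aug ` carrier (P 0)"
  proof
    fix a assume "a \<in> carrier (ext_bimodule K n)"
    then have a: "a \<in> carrier E" by (simp add: ext_bimodule_eq)
    then have "a = aug (pe a \<one>\<^bsub>E\<^esub> \<odot>\<^bsub>P 0\<^esub> e0)" by (simp add: aug_pe_e0 del: koszul_module_simps)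
    then show "a \<in> aug ` carrier (P 0)"
      using P.smult_closed[OF reg.pe_closed[OF a E.A.one_closed] e0_closed] by blast
  qed
qed

lemma koszul_sign_1: "koszul_sign (Suc 0) = \<ominus>\<^bsub>K\<^esub> \<one>\<^bsub>K\<^esub>"
  by (simp add: koszul_sign_def)

lemma koszul_diff_1:
  assumes Z: "Z \<in> carrier A" and g: "g \<in> {1..n}"
  shows "d (Suc 0) (Z \<odot>\<^bsub>P (Suc 0)\<^esub> ft (Suc 0) (raise (\<lambda>_. 0) g)) =
    (Z \<otimes>\<^bsub>A\<^esub> y (\<ominus>\<^bsub>K\<^esub> \<one>\<^bsub>K\<^esub>) g) \<odot>\<^bsub>P 0\<^esub> e0"
    (is "_ = ?r")
proof -
  let ?i = "raise (\<lambda>_. 0::nat) g"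
  have i: "?i \<in> MI (Suc 0)"
    using multi_indices_raise[of "\<lambda>_. 0" n 0 g] g by (simp add: multi_indices_0)
  have r: "?r \<in> carrier (P 0)"
    using Z g by (intro P.smult_closed e0_closed) auto
  have low: "lower ?i g = (\<lambda>_. 0)" by auto
  have "finsum (P 0) (diff_term 0 Z ?i) {1..n} =
      finsum (P 0) (\<lambda>h. if g = h then ?r else \<zero>\<^bsub>P 0\<^esub>) {1..n}"
  proof (rule P.M.finsum_cong'[OF refl])
    show "(\<lambda>h. if g = h then ?r else \<zero>\<^bsub>P 0\<^esub>) \<in> {1..n} \<rightarrow> carrier (P 0)"
      using r P.M.zero_closed[of 0] by auto
    fix h
    show "diff_term 0 Z ?i h = (if g = h then ?r else \<zero>\<^bsub>P 0\<^esub>)"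
    proof (cases "g = h")
      case True
      then show ?thesis unfolding diff_term_def koszul_sign_1 using low by (simp del: koszul_module_simps)
    next
      case False
      then show ?thesis unfolding diff_term_def by simp
    qed
  qed
  also have "\<dots> = ?r" using r g by (intro P.M.finsum_singleton) auto
  finally show ?thesis unfolding koszul_diff_smult[OF Z i] .
qed

lemma multi_indices_1:
  assumes "i \<in> MI (Suc 0)"
  obtains g where "g \<in> {1..n}" "i = raise (\<lambda>_. 0) g"
proof -
  obtain g where g: "g \<in> {1..n}" "i g \<noteq> 0" by (rule multi_indices_nonzero[OF assms])
  have "lower i g = (\<lambda>_. 0)" using multi_indices_lower[OF assms g(2)] by (simp add: multi_indices_0)
  then have "i = raise (\<lambda>_. 0) g"
    using g(2) by (auto simp: fun_eq_iff split: if_splits)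
  then show thesis using that g(1) by blast
qed

text \<open>A basis element in degree one goes to the difference of the two one-sided multiples of
  \<open>e0\<close> by a generator, and multiplication does not distinguish these.\<close>

lemma aug_diff:
  assumes p: "p \<in> carrier (P (Suc 0))"
  shows "aug (d (Suc 0) p) = \<zero>\<^bsub>E\<^esub>"
proof -
  have ag: "abelian_group (ext_bimodule K n)"
    using ext_bimodule_left_module by (simp add: left_module_def)
  have L: "(\<lambda>p. aug (d (Suc 0) p)) \<in> left_module_hom A (P (Suc 0)) (ext_bimodule K n)"
    by (rule left_module_hom_comp[OF koszul_diff_hom aug_hom])
  have val: "aug ((pe a b \<otimes>\<^bsub>A\<^esub> y (\<ominus>\<^bsub>K\<^esub> \<one>\<^bsub>K\<^esub>) g) \<odot>\<^bsub>P 0\<^esub> e0) = \<zero>\<^bsub>E\<^esub>"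
    if "a \<in> carrier E" "b \<in> carrier E" "g \<in> {1..n}" for a b g
  proof -
    have m1: "\<ominus>\<^bsub>K\<^esub> \<one>\<^bsub>K\<^esub> \<in> carrier K" by simp
    \<comment> \<open>The scalar is moved into the left entry so that both summands are pure
      tensors, to which \<open>aug_pe_e0\<close> applies.\<close>
    have "pe a b \<otimes>\<^bsub>A\<^esub> y (\<ominus>\<^bsub>K\<^esub> \<one>\<^bsub>K\<^esub>) g = pe (a \<otimes>\<^bsub>E\<^esub> x g) b \<oplus>\<^bsub>A\<^esub> pe ((\<ominus>\<^bsub>K\<^esub> \<one>\<^bsub>K\<^esub>) \<odot>\<^bsub>E\<^esub> a) (x g \<otimes>\<^bsub>E\<^esub> b)"
      using that m1 by (simp add: y_def reg.E.A.r_distr reg.E.mult_smult_right reg.pe_mult reg.pe_closed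
          bilinear_smult_left[OF reg.pe_bilinear])
    then have "aug ((pe a b \<otimes>\<^bsub>A\<^esub> y (\<ominus>\<^bsub>K\<^esub> \<one>\<^bsub>K\<^esub>) g) \<odot>\<^bsub>P 0\<^esub> e0) =
        aug (pe (a \<otimes>\<^bsub>E\<^esub> x g) b \<odot>\<^bsub>P 0\<^esub> e0) \<oplus>\<^bsub>E\<^esub> aug (pe ((\<ominus>\<^bsub>K\<^esub> \<one>\<^bsub>K\<^esub>) \<odot>\<^bsub>E\<^esub> a) (x g \<otimes>\<^bsub>E\<^esub> b) \<odot>\<^bsub>P 0\<^esub> e0)"
      using that m1 koszul_subset[OF e0_closed]
      by (simp add: bilinear_add_left[OF env_smult_bilinear] reg.pe_closed env_smult_closed
          left_module_hom_add[OF aug_linear])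
    also have "\<dots> = \<zero>\<^bsub>E\<^esub>"
      using that m1
      by (simp add: aug_pe_e0 E.mult_smult_left E.M.smult_l_minus E.A.l_minus E.A.m_assoc E.M.M.r_neg
          del: koszul_module_simps)
    finally show ?thesis .
  qed
  have gen: "aug (d (Suc 0) (ft (Suc 0) i)) = \<zero>\<^bsub>E\<^esub>" if i: "i \<in> MI (Suc 0)" for i
  proof -
    obtain g where g: "g \<in> {1..n}" "i = raise (\<lambda>_. 0) g" by (rule multi_indices_1[OF i])
    have "ft (Suc 0) i = \<one>\<^bsub>A\<^esub> \<odot>\<^bsub>P (Suc 0)\<^esub> ft (Suc 0) i"
      by (rule P.smult_one[OF f_tilde_mem[OF i], symmetric])
    then show ?thesis
      using koszul_diff_1[OF reg.E.A.one_closed g(1)] val[OF E.A.one_closed E.A.one_closed g(1)]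
      by (metis g(2) reg.pe_one)
  qed
  show ?thesis using p
  proof (induction p rule: P.basis_induct)
    case (smult Z i)
    have "(\<lambda>v. Z \<odot>\<^bsub>ext_bimodule K n\<^esub> v) \<in> left_module_hom K E E"
      using bilinear_right[OF reg.enveloping_smult_bilinear smult(1)] by (simp add: ext_bimodule_eq)
    from add_hom_zero[OF left_module_hom_add_hom[OF this] E.M.M.abelian_group_axioms E.M.M.abelian_group_axioms]
    show ?case
      using left_module_hom_smult[OF L smult(1) f_tilde_mem[OF smult(2)]] gen[OF smult(2)] by simp
  next
    case zero
    show ?case
      using add_hom_zero[OF left_module_hom_add_hom[OF L] koszul_abelian_group ag]
      by (simp add: ext_bimodule_eq)
  next
    case (add p q)
    then show ?case
      using left_module_hom_add[OF L add(1,2)] by (simp add: ext_bimodule_eq)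
  qed
qed

lemma aug_kernel_boundary:
  assumes p: "p \<in> carrier (P 0)" and ap: "aug p = \<zero>\<^bsub>E\<^esub>"
  shows "p \<in> d (Suc 0) ` carrier (P (Suc 0))"
proof -
  let ?B = "d (Suc 0) ` carrier (P (Suc 0))"
  have sub: "submodule ?B A (P 0)"
    by (rule image_submodule[OF koszul_left_module koszul_left_module koszul_diff_hom])
  note B = sub[unfolded submodule_iff[OF koszul_abelian_group]]
  \<comment> \<open>A left ideal of coefficients. The claim becomes membership of the single
    coordinate of \<open>p\<close> in it.\<close>
  define N where "N = {Z \<in> carrier A. Z \<odot>\<^bsub>P 0\<^esub> e0 \<in> ?B}"
  have Nc: "Z \<in> carrier A" if "Z \<in> N" for Z using that by (simp add: N_def)
  have N0: "\<zero>\<^bsub>A\<^esub> \<in> N"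
    using B koszul_zero_smult[OF e0_closed] by (simp add: N_def)
  have Na: "V \<oplus>\<^bsub>A\<^esub> Z \<in> N" if "V \<in> N" "Z \<in> N" for V Z
    using that B P.smult_l_distr[OF _ _ e0_closed, of V Z] by (auto simp: N_def)
  have Nm: "Z \<otimes>\<^bsub>A\<^esub> V \<in> N" if "Z \<in> carrier A" "V \<in> N" for V Z
    using that B P.smult_assoc1[OF _ _ e0_closed, of Z V] by (auto simp: N_def)
  have Ns: "c \<odot>\<^bsub>A\<^esub> V \<in> N" if "c \<in> carrier K" "V \<in> N" for c V
  proof -
    have "c \<odot>\<^bsub>A\<^esub> V = (c \<odot>\<^bsub>A\<^esub> \<one>\<^bsub>A\<^esub>) \<otimes>\<^bsub>A\<^esub> V"
      using that Nc reg.E.mult_smult_left[of c "\<one>\<^bsub>A\<^esub>" V] by simp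
    then show ?thesis using Nm[of "c \<odot>\<^bsub>A\<^esub> \<one>\<^bsub>A\<^esub>" V] that by simp
  qed
  \<comment> \<open>\<open>b\<close> stays arbitrary in the induction because the last generator of
    \<open>a\<close> is passed on to it.\<close>
  have pure_N: "pe a b \<ominus>\<^bsub>A\<^esub> pe \<one>\<^bsub>E\<^esub> (a \<otimes>\<^bsub>E\<^esub> b) \<in> N" if a: "a \<in> carrier E" and b: "b \<in> carrier E" for a b
    using a b
  proof (induction a arbitrary: b rule: ext_induct)
    case one
    then have "pe \<one>\<^bsub>E\<^esub> b \<in> carrier A" by (simp add: reg.pe_closed)
    from reg.E.M.M.r_neg[OF this] show ?case using one N0 by (simp add: a_minus_def)
  next
    case (gen a g)
    have c: "pe (a \<otimes>\<^bsub>E\<^esub> x g) b \<in> carrier A" "pe a (x g \<otimes>\<^bsub>E\<^esub> b) \<in> carrier A"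
      "pe \<one>\<^bsub>E\<^esub> (a \<otimes>\<^bsub>E\<^esub> x g \<otimes>\<^bsub>E\<^esub> b) \<in> carrier A"
      using gen.hyps gen.prems by (auto intro!: reg.pe_closed)
    have 1: "pe (a \<otimes>\<^bsub>E\<^esub> x g) b \<ominus>\<^bsub>A\<^esub> pe a (x g \<otimes>\<^bsub>E\<^esub> b) \<in> N"
    proof -
      have pe: "pe a b \<in> carrier A" using gen by (intro reg.pe_closed)
      have "pe a b \<otimes>\<^bsub>A\<^esub> y (\<ominus>\<^bsub>K\<^esub> \<one>\<^bsub>K\<^esub>) g = pe (a \<otimes>\<^bsub>E\<^esub> x g) b \<ominus>\<^bsub>A\<^esub> pe a (x g \<otimes>\<^bsub>E\<^esub> b)"
        using gen.hyps gen.prems c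
        by (simp add: y_def reg.E.A.r_distr reg.E.mult_smult_right reg.pe_mult reg.pe_closed
            reg.E.M.smult_l_minus reg.E.A.r_minus a_minus_def)
      moreover have "(pe a b \<otimes>\<^bsub>A\<^esub> y (\<ominus>\<^bsub>K\<^esub> \<one>\<^bsub>K\<^esub>) g) \<odot>\<^bsub>P 0\<^esub> e0 \<in> ?B"
      proof -
        have "raise (\<lambda>_. 0) g \<in> MI (Suc 0)"
          using multi_indices_raise[of "\<lambda>_. 0" n 0 g] gen.hyps(2) by (simp add: multi_indices_0)
        then show ?thesis
          unfolding koszul_diff_1[OF pe gen.hyps(2), symmetric]
          by (intro imageI P.smult_closed pe f_tilde_mem)
      qed
      ultimately show ?thesis using c by (simp add: N_def)
    qed
    have 2: "pe a (x g \<otimes>\<^bsub>E\<^esub> b) \<ominus>\<^bsub>A\<^esub> pe \<one>\<^bsub>E\<^esub> (a \<otimes>\<^bsub>E\<^esub> x g \<otimes>\<^bsub>E\<^esub> b) \<in> N"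
      using gen.IH[of "x g \<otimes>\<^bsub>E\<^esub> b"] gen.hyps gen.prems by (simp add: E.A.m_assoc)
    \<comment> \<open>Telescoping: the first difference is the coefficient of a boundary by
      \<open>koszul_diff_1\<close>, and the second is the induction hypothesis with the generator
      moved into the right entry.\<close>
    have "pe (a \<otimes>\<^bsub>E\<^esub> x g) b \<ominus>\<^bsub>A\<^esub> pe \<one>\<^bsub>E\<^esub> (a \<otimes>\<^bsub>E\<^esub> x g \<otimes>\<^bsub>E\<^esub> b) =
        (pe (a \<otimes>\<^bsub>E\<^esub> x g) b \<ominus>\<^bsub>A\<^esub> pe a (x g \<otimes>\<^bsub>E\<^esub> b)) \<oplus>\<^bsub>A\<^esub>
        (pe a (x g \<otimes>\<^bsub>E\<^esub> b) \<ominus>\<^bsub>A\<^esub> pe \<one>\<^bsub>E\<^esub> (a \<otimes>\<^bsub>E\<^esub> x g \<otimes>\<^bsub>E\<^esub> b))"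
      using c by (simp add: a_minus_def reg.E.M.M.a_assoc reg.E.M.M.r_neg1 reg.E.M.M.r_neg2)
    then show ?case using Na[OF 1 2] by simp
  next
    case (add a a')
    have "pe (a \<oplus>\<^bsub>E\<^esub> a') b \<ominus>\<^bsub>A\<^esub> pe \<one>\<^bsub>E\<^esub> ((a \<oplus>\<^bsub>E\<^esub> a') \<otimes>\<^bsub>E\<^esub> b) =
        (pe a b \<ominus>\<^bsub>A\<^esub> pe \<one>\<^bsub>E\<^esub> (a \<otimes>\<^bsub>E\<^esub> b)) \<oplus>\<^bsub>A\<^esub> (pe a' b \<ominus>\<^bsub>A\<^esub> pe \<one>\<^bsub>E\<^esub> (a' \<otimes>\<^bsub>E\<^esub> b))"
      using add.hyps add.prems
      by (simp add: pe_add_left pe_add_right E.A.l_distr reg.pe_closed a_minus_def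
          reg.E.M.M.minus_add reg.E.M.M.a_ac)
    then show ?case using Na[OF add.IH(1)[OF add.prems] add.IH(2)[OF add.prems]] by simp
  next
    case (smult c a)
    have "pe (c \<odot>\<^bsub>E\<^esub> a) b \<ominus>\<^bsub>A\<^esub> pe \<one>\<^bsub>E\<^esub> ((c \<odot>\<^bsub>E\<^esub> a) \<otimes>\<^bsub>E\<^esub> b) =
        c \<odot>\<^bsub>A\<^esub> (pe a b \<ominus>\<^bsub>A\<^esub> pe \<one>\<^bsub>E\<^esub> (a \<otimes>\<^bsub>E\<^esub> b))"
      using smult.hyps smult.prems
      by (simp add: bilinear_smult_left[OF reg.pe_bilinear] bilinear_smult_right[OF reg.pe_bilinear]
          E.mult_smult_left reg.pe_closed a_minus_def reg.E.M.smult_r_distr reg.E.M.smult_r_minus)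
    then show ?case using Ns[OF smult.hyps(1) smult.IH[OF smult.prems]] by simp
  qed
  \<comment> \<open>The additive extension of multiplication to the enveloping algebra. It lets the
    congruence for pure tensors be stated for every \<open>Z\<close>, and it vanishes on the
    coordinate of an element of the kernel.\<close>
  define \<mu> where "\<mu> Z = aug (Z \<odot>\<^bsub>P 0\<^esub> e0)" for Z
  have \<mu>c: "\<mu> Z \<in> carrier E" if "Z \<in> carrier A" for Z
    unfolding \<mu>_def using left_module_hom_closed[OF aug_hom P.smult_closed[OF that e0_closed]]
    by (simp add: ext_bimodule_eq)
  have \<mu>a: "\<mu> (V \<oplus>\<^bsub>A\<^esub> Z) = \<mu> V \<oplus>\<^bsub>E\<^esub> \<mu> Z" if "V \<in> carrier A" "Z \<in> carrier A" for V Z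
    unfolding \<mu>_def P.smult_l_distr[OF that e0_closed]
      left_module_hom_add[OF aug_hom P.smult_closed[OF that(1) e0_closed] P.smult_closed[OF that(2) e0_closed]]
    by (simp add: ext_bimodule_eq)
  have all: "Z \<ominus>\<^bsub>A\<^esub> pe \<one>\<^bsub>E\<^esub> (\<mu> Z) \<in> N" if "Z \<in> carrier A" for Z
    using that
  proof (induction Z rule: reg.enveloping_induct)
    case (pure a b)
    show ?case unfolding \<mu>_def aug_pe_e0[OF pure] by (rule pure_N[OF pure])
  next
    case (add V Z)
    have "(V \<oplus>\<^bsub>A\<^esub> Z) \<ominus>\<^bsub>A\<^esub> pe \<one>\<^bsub>E\<^esub> (\<mu> (V \<oplus>\<^bsub>A\<^esub> Z)) =
        (V \<ominus>\<^bsub>A\<^esub> pe \<one>\<^bsub>E\<^esub> (\<mu> V)) \<oplus>\<^bsub>A\<^esub> (Z \<ominus>\<^bsub>A\<^esub> pe \<one>\<^bsub>E\<^esub> (\<mu> Z))"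
      using add.hyps
      by (simp add: \<mu>a \<mu>c pe_add_right reg.pe_closed a_minus_def reg.E.M.M.minus_add reg.E.M.M.a_ac)
    then show ?case using Na[OF add.IH] by simp
  qed
  define Z where "Z = coord 0 (\<lambda>_. 0) p"
  have Z: "Z \<in> carrier A" unfolding Z_def by (rule P.c_closed[OF _ p]) (simp add: multi_indices_0)
  have pZ: "p = Z \<odot>\<^bsub>P 0\<^esub> e0"
  proof -
    let ?f = "\<lambda>i. coord 0 i p \<odot>\<^bsub>P 0\<^esub> ft 0 i"
    have f: "?f (\<lambda>_. 0) = Z \<odot>\<^bsub>P 0\<^esub> e0" by (simp only: Z_def)
    have Ze: "Z \<odot>\<^bsub>P 0\<^esub> e0 \<in> carrier (P 0)" by (rule P.smult_closed[OF Z e0_closed])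
    have "p = finsum (P 0) ?f (insert (\<lambda>_. 0) {})"
      using P.expand[OF p] unfolding multi_indices_0 .
    also have "\<dots> = ?f (\<lambda>_. 0) \<oplus>\<^bsub>P 0\<^esub> finsum (P 0) ?f {}"
      by (rule P.M.finsum_insert) (use Ze f in simp_all)
    also have "\<dots> = Z \<odot>\<^bsub>P 0\<^esub> e0"
      unfolding P.M.finsum_empty f by (rule P.M.r_zero[OF Ze])
    finally show ?thesis .
  qed
  have "\<mu> Z = \<zero>\<^bsub>E\<^esub>" using ap unfolding \<mu>_def pZ[symmetric] .
  then have "Z \<in> N" using all[OF Z] Z by (simp add: pe_zero_right a_minus_def)
  then show ?thesis unfolding pZ by (simp add: N_def)
qed

end

section \<open>Minimality\<close>

text \<open>If \<open>u p\<close> were not in \<open>H\<close>, then \<open>p = h + z u p\<close> for some \<open>h \<in> H\<close> and some scalar \<open>z\<close>;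
  multiplication by \<open>u\<close> gives \<open>u p = u h\<close>.\<close>

lemma maximal_submodule_square_zero:
  assumes "left_module R P" "maximal_submodule H R P"
    and u: "u \<in> carrier R" "\<And>z. z \<in> carrier R \<Longrightarrow> u \<otimes>\<^bsub>R\<^esub> z \<otimes>\<^bsub>R\<^esub> u = \<zero>\<^bsub>R\<^esub>"
    and p: "p \<in> carrier P"
  shows "u \<odot>\<^bsub>P\<^esub> p \<in> H"
proof (rule ccontr)
  assume up: "u \<odot>\<^bsub>P\<^esub> p \<notin> H"
  interpret P: left_module R P by fact
  have "submodule H R P" using assms(2) by (simp add: maximal_submodule_def)
  then have Hc: "\<And>h. h \<in> H \<Longrightarrow> h \<in> carrier P" and Hz: "\<zero>\<^bsub>P\<^esub> \<in> H"
    and Hp: "\<And>x y. x \<in> H \<Longrightarrow> y \<in> H \<Longrightarrow> x \<oplus>\<^bsub>P\<^esub> y \<in> H" and Hm: "\<And>x. x \<in> H \<Longrightarrow> \<ominus>\<^bsub>P\<^esub> x \<in> H"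
    and Hs: "\<And>a x. a \<in> carrier R \<Longrightarrow> x \<in> H \<Longrightarrow> a \<odot>\<^bsub>P\<^esub> x \<in> H"
    unfolding submodule_iff[OF P.M.abelian_group_axioms] by auto
  \<comment> \<open>The sum of \<open>H\<close> and the submodule generated by \<open>u p\<close>.
    It contains \<open>H\<close> properly, so maximality makes it everything.\<close>
  define L where "L = {h \<oplus>\<^bsub>P\<^esub> (z \<otimes>\<^bsub>R\<^esub> u) \<odot>\<^bsub>P\<^esub> p | h z. h \<in> H \<and> z \<in> carrier R}"
  have memL: "h \<oplus>\<^bsub>P\<^esub> (z \<otimes>\<^bsub>R\<^esub> u) \<odot>\<^bsub>P\<^esub> p \<in> L" if "h \<in> H" "z \<in> carrier R" for h z
    using that by (auto simp: L_def)
  have zp: "(z \<otimes>\<^bsub>R\<^esub> u) \<odot>\<^bsub>P\<^esub> p \<in> carrier P" if "z \<in> carrier R" for z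
    using that u p by (simp add: P.smult_closed)
  note z0 = left_module_smult_zero[OF assms(1) p]
  have HL: "H \<subseteq> L"
  proof
    fix h assume h: "h \<in> H"
    then show "h \<in> L" using memL[of h "\<zero>\<^bsub>R\<^esub>"] u(1) Hc[OF h] by (simp add: z0)
  qed
  have "submodule L R P"
    unfolding submodule_iff[OF P.M.abelian_group_axioms]
  proof (intro conjI ballI)
    show "L \<subseteq> carrier P" using Hc zp by (auto simp: L_def)
    show "\<zero>\<^bsub>P\<^esub> \<in> L" using HL Hz by auto
  next
    fix x y assume "x \<in> L" "y \<in> L"
    then obtain h z h' z' where hz: "h \<in> H" "z \<in> carrier R" "h' \<in> H" "z' \<in> carrier R"
      and xy: "x = h \<oplus>\<^bsub>P\<^esub> (z \<otimes>\<^bsub>R\<^esub> u) \<odot>\<^bsub>P\<^esub> p" "y = h' \<oplus>\<^bsub>P\<^esub> (z' \<otimes>\<^bsub>R\<^esub> u) \<odot>\<^bsub>P\<^esub> p"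
      by (auto simp: L_def)
    have "x \<oplus>\<^bsub>P\<^esub> y = (h \<oplus>\<^bsub>P\<^esub> h') \<oplus>\<^bsub>P\<^esub> ((z \<oplus>\<^bsub>R\<^esub> z') \<otimes>\<^bsub>R\<^esub> u) \<odot>\<^bsub>P\<^esub> p"
      using hz u p Hc zp
      by (simp add: xy P.R.l_distr P.smult_l_distr P.M.a_ac)
    then show "x \<oplus>\<^bsub>P\<^esub> y \<in> L" using memL[OF Hp[OF hz(1,3)], of "z \<oplus>\<^bsub>R\<^esub> z'"] hz by simp
  next
    fix x assume "x \<in> L"
    then obtain h z where hz: "h \<in> H" "z \<in> carrier R" and x: "x = h \<oplus>\<^bsub>P\<^esub> (z \<otimes>\<^bsub>R\<^esub> u) \<odot>\<^bsub>P\<^esub> p"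
      by (auto simp: L_def)
    have "\<ominus>\<^bsub>P\<^esub> x = (\<ominus>\<^bsub>P\<^esub> h) \<oplus>\<^bsub>P\<^esub> ((\<ominus>\<^bsub>R\<^esub> z) \<otimes>\<^bsub>R\<^esub> u) \<odot>\<^bsub>P\<^esub> p"
      using hz u p Hc zp
      by (simp add: x P.M.minus_add P.R.l_minus left_module_smult_minus[OF assms(1) p])
    then show "\<ominus>\<^bsub>P\<^esub> x \<in> L" using memL[OF Hm[OF hz(1)], of "\<ominus>\<^bsub>R\<^esub> z"] hz by simp
  next
    fix a x assume a: "a \<in> carrier R" and "x \<in> L"
    then obtain h z where hz: "h \<in> H" "z \<in> carrier R" and x: "x = h \<oplus>\<^bsub>P\<^esub> (z \<otimes>\<^bsub>R\<^esub> u) \<odot>\<^bsub>P\<^esub> p"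
      by (auto simp: L_def)
    have "a \<odot>\<^bsub>P\<^esub> x = (a \<odot>\<^bsub>P\<^esub> h) \<oplus>\<^bsub>P\<^esub> ((a \<otimes>\<^bsub>R\<^esub> z) \<otimes>\<^bsub>R\<^esub> u) \<odot>\<^bsub>P\<^esub> p"
      using hz u p Hc zp a
      by (simp add: x P.smult_r_distr P.R.m_assoc P.smult_assoc1 P.smult_closed)
    then show "a \<odot>\<^bsub>P\<^esub> x \<in> L" using memL[OF Hs[OF a hz(1)], of "a \<otimes>\<^bsub>R\<^esub> z"] hz a by simp
  qed
  moreover have "u \<odot>\<^bsub>P\<^esub> p \<in> L"
    using memL[OF Hz, of "\<one>\<^bsub>R\<^esub>"] u(1) zp[of "\<one>\<^bsub>R\<^esub>"] by simp
  ultimately have "L = carrier P"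
    using assms(2) HL up unfolding maximal_submodule_def by blast
  then have "p \<in> L" using p by simp
  then obtain h z where hz: "h \<in> H" "z \<in> carrier R" and ph: "p = h \<oplus>\<^bsub>P\<^esub> (z \<otimes>\<^bsub>R\<^esub> u) \<odot>\<^bsub>P\<^esub> p"
    unfolding L_def by blast
  have "u \<odot>\<^bsub>P\<^esub> p = u \<odot>\<^bsub>P\<^esub> (h \<oplus>\<^bsub>P\<^esub> (z \<otimes>\<^bsub>R\<^esub> u) \<odot>\<^bsub>P\<^esub> p)" using ph by simp
  also have "\<dots> = u \<odot>\<^bsub>P\<^esub> h \<oplus>\<^bsub>P\<^esub> (u \<otimes>\<^bsub>R\<^esub> z \<otimes>\<^bsub>R\<^esub> u) \<odot>\<^bsub>P\<^esub> p"
    using hz u p Hc zp by (simp add: P.smult_r_distr P.R.m_assoc flip: P.smult_assoc1)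
  also have "\<dots> = u \<odot>\<^bsub>P\<^esub> h"
    using hz u(1) Hc by (simp add: u(2) z0 P.smult_closed)
  finally show False using up Hs[OF u(1) hz(1)] by simp
qed

context exterior
begin

text \<open>The two parts of the coefficient are treated separately: each of them has vanishing
  sandwich products, while in those of their sum the mixed products need not cancel.\<close>

lemma diff_term_in_maximal:
  assumes H: "maximal_submodule H A (P m)" and i: "i \<in> MI (Suc m)" and h: "h \<in> {1..n}"
  shows "diff_term m \<one>\<^bsub>A\<^esub> i h \<in> H"
proof -
  have "submodule H A (P m)" using H by (simp add: maximal_submodule_def)
  note Hs = this[unfolded submodule_iff[OF koszul_abelian_group]]
  let ?s = "koszul_sign (Suc m)"
  show ?thesis
  proof (cases "i h = 0")
    case True
    then show ?thesis using Hs by (simp add: diff_term_def)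
  next
    case False
    let ?t = "ft m (lower i h)"
    have t: "?t \<in> carrier (P m)" by (rule f_tilde_mem[OF multi_indices_lower[OF i False]])
    have sY: "?s \<odot>\<^bsub>A\<^esub> Y h \<in> carrier A" using h by simp
    have 1: "X h \<odot>\<^bsub>P m\<^esub> ?t \<in> H"
      by (rule maximal_submodule_square_zero[OF koszul_left_module H X_closed[OF h] X_sandwich[OF _ h] t])
    have 2: "(?s \<odot>\<^bsub>A\<^esub> Y h) \<odot>\<^bsub>P m\<^esub> ?t \<in> H"
    proof (rule maximal_submodule_square_zero[OF koszul_left_module H sY _ t])
      fix Z assume Z: "Z \<in> carrier A"
      show "(?s \<odot>\<^bsub>A\<^esub> Y h) \<otimes>\<^bsub>A\<^esub> Z \<otimes>\<^bsub>A\<^esub> (?s \<odot>\<^bsub>A\<^esub> Y h) = \<zero>\<^bsub>A\<^esub>"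
        using h Z by (simp add: reg.E.mult_smult_left reg.E.mult_smult_right Y_sandwich)
    qed
    have "diff_term m \<one>\<^bsub>A\<^esub> i h = X h \<odot>\<^bsub>P m\<^esub> ?t \<oplus>\<^bsub>P m\<^esub> (?s \<odot>\<^bsub>A\<^esub> Y h) \<odot>\<^bsub>P m\<^esub> ?t"
      unfolding P.smult_l_distr[OF X_closed[OF h] sY t, symmetric] diff_term_def y_def
      using False h sY by simp
    then show ?thesis using 1 2 Hs by simp
  qed
qed

lemma koszul_diff_radical: "d (Suc m) ` carrier (P (Suc m)) \<subseteq> module_radical A (P m)"
proof
  fix q assume "q \<in> d (Suc m) ` carrier (P (Suc m))"
  then obtain p where p: "p \<in> carrier (P (Suc m))" and q: "q = d (Suc m) p" by auto
  have "d (Suc m) p \<in> H" if H: "maximal_submodule H A (P m)" for H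
  proof -
    have sub: "submodule H A (P m)" using H by (simp add: maximal_submodule_def)
    note Hs = sub[unfolded submodule_iff[OF koszul_abelian_group]]
    have zero: "\<zero>\<^bsub>P m\<^esub> \<in> H" and plus: "\<And>u v. u \<in> H \<Longrightarrow> v \<in> H \<Longrightarrow> u \<oplus>\<^bsub>P m\<^esub> v \<in> H"
      and scale: "\<And>Z v. Z \<in> carrier A \<Longrightarrow> v \<in> H \<Longrightarrow> Z \<odot>\<^bsub>P m\<^esub> v \<in> H"
      using Hs by simp_all
    show ?thesis using p
    proof (induction p rule: P.basis_induct)
      case (smult Z i)
      have "d (Suc m) (ft (Suc m) i) \<in> H"
        unfolding koszul_diff_f_tilde[OF smult(2)]
        by (rule submodule_finsum_closed[OF koszul_abelian_group sub diff_term_in_maximal[OF H smult(2)]])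
      then show ?case
        unfolding left_module_hom_smult[OF koszul_diff_hom smult(1) f_tilde_mem[OF smult(2)]]
        by (rule scale[OF smult(1)])
    next
      case zero
      show ?case unfolding koszul_diff_zero by fact
    next
      case (add p q)
      show ?case
        unfolding left_module_hom_add[OF koszul_diff_hom add(1,2)] by (rule plus[OF add.IH])
    qed
  qed
  then show "q \<in> module_radical A (P m)"
    using koszul_diff_closed[OF p] by (auto simp: q module_radical_def)
qed

end

theorem theorem1:
  fixes K :: "('k, 'e) ring_scheme" and n :: nat
  assumes "field K" and "n \<ge> 2"
  shows "projective_resolution TYPE('c) TYPE('d) (ext_env K n)
           (koszul_module K n) (koszul_diff K n) (ext_bimodule K n) (koszul_aug K n) \<and>
         minimal_complex (ext_env K n) (koszul_module K n) (koszul_diff K n)"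
proof -
  interpret exterior K n
    using assms(1) by (simp add: exterior_def field_def domain_def)
  have zE: "\<zero>\<^bsub>ext_bimodule K n\<^esub> = \<zero>\<^bsub>E\<^esub>" by (simp add: ext_bimodule_eq)
  have 1: "d 1 ` carrier (P 1) = {p \<in> carrier (P 0). aug p = \<zero>\<^bsub>ext_bimodule K n\<^esub>}"
    unfolding zE One_nat_def
    using koszul_diff_closed[of _ 0] aug_diff aug_kernel_boundary by blast
  have 2: "d (Suc (Suc m)) ` carrier (P (Suc (Suc m))) =
      {p \<in> carrier (P (Suc m)). d (Suc m) p = \<zero>\<^bsub>P m\<^esub>}" for m
    using koszul_diff_closed[of _ "Suc m"] koszul_diff_diff[of _ m] cycle_is_boundary[of _ m] by blast
  show ?thesis
    unfolding projective_resolution_def minimal_complex_def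
    using ext_bimodule_left_module P.projective koszul_diff_hom aug_hom aug_surj 1 2 koszul_diff_radical
    by (intro conjI allI) assumption+
qed

end
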